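(* Let $n\ge 1$, let ${\bf A}$ be an $n\times n$ positive definite matrix, and let $d_1,\ldots,d_n$ be the eigenvalues of ${\bf A}$, assumed pairwise distinct. Let $f:\mathbb{R}^{+}\to\mathbb{R}$ be a continuous function such that $\int_0^\infty e^{-\alpha t}|f(t)|^2\,dt<\infty$ for every $\alpha>0$. Then $$\int_{M_n}\mathrm{Tr}\big(f({\bf H}^{*}{\bf A}{\bf H})\big)\,d\nu({\bf H})=\frac{1}{\det(\Delta({\bf D}))}\sum_{k=0}^{n-1}\det({\bf T}_k),$$ where $\Delta({\bf D})$ is the $n\times n$ Vandermonde matrix whose $j$-th row ($j=1,\ldots,n$) is $(d_1^{n-j},d_2^{n-j},\ldots,d_n^{n-j})$, and ${\bf T}_k$ is the matrix obtained from $\Delta({\bf D})$ by replacing its $(k+1)$-th row $(d_i^{n-(k+1)})_{i=1}^n$ by the row $$\Big(\frac{1}{(n-(k+1))!}f_k(d_i)\Big)_{i=1}^n,\qquad f_k(x):=\int_0^\infty e^{-t}(tx)^{n-(k+1)}f(tx)\,dt.$$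
   Context: $M_n$ denotes the set of $n\times n$ complex matrices, $d{\bf H}$ Lebesgue measure on $M_n\cong\mathbb{R}^{2n^2}$, and $d\nu({\bf H})=\pi^{-n^2}\exp(-\mathrm{Tr}({\bf H}^*{\bf H}))\,d{\bf H}$ the Gaussian probability measure (the law of a matrix with i.i.d. complex entries of zero mean and unit variance). For a Hermitian matrix ${\bf B}={\bf U}\,\mathrm{diag}(b_1,\ldots,b_n){\bf U}^*$ with ${\bf U}$ unitary, $f({\bf B}):={\bf U}\,\mathrm{diag}(f(b_1),\ldots,f(b_n)){\bf U}^*$. ${\bf D}=\mathrm{diag}(d_1,\ldots,d_n)$. *)

theory Defs
  imports "HOL-Analysis.Analysis"
begin

definition cadj :: "complex^'n^'n \<Rightarrow> complex^'n^'n" where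
  "cadj H = (\<chi> i j. cnj (H $ j $ i))"

definition hermitian_mat :: "complex^'n^'n \<Rightarrow> bool" where
  "hermitian_mat A \<longleftrightarrow> cadj A = A"

definition unitary_mat :: "complex^'n^'n \<Rightarrow> bool" where
  "unitary_mat U \<longleftrightarrow> U ** cadj U = mat 1 \<and> cadj U ** U = mat 1"

definition positive_definite :: "complex^'n^'n \<Rightarrow> bool" where
  "positive_definite A \<longleftrightarrow> hermitian_mat A \<and>
     (\<forall>x::complex^'n. x \<noteq> 0 \<longrightarrow> 0 < Re (\<Sum>i\<in>UNIV. \<Sum>j\<in>UNIV. cnj (x $ i) * A $ i $ j * x $ j))"

definition diag_mat :: "('n \<Rightarrow> complex) \<Rightarrow> complex^'n^'n" where
  "diag_mat b = (\<chi> i j. if i = j then b i else 0)"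

definition mat_fun :: "(real \<Rightarrow> real) \<Rightarrow> complex^'n^'n \<Rightarrow> complex^'n^'n" where
  "mat_fun f B = (SOME M. \<exists>U b. unitary_mat U \<and>
       B = U ** diag_mat (\<lambda>i. complex_of_real (b i)) ** cadj U \<and>
       M = U ** diag_mat (\<lambda>i. complex_of_real (f (b i))) ** cadj U)"

definition eigenvalues_mat :: "complex^'n^'n \<Rightarrow> complex set" where
  "eigenvalues_mat A = {c. \<exists>v. v \<noteq> 0 \<and> A *v v = c *s v}"

text \<open>Gaussian probability measure on M_n = complex^'n^'n (identified with R^(2n^2)).\<close>
definition gauss_mat_measure :: "(complex^'n^'n) measure" where
  "gauss_mat_measure = density lborel
     (\<lambda>H. ennreal (exp (- Re (trace (cadj H ** H))) / pi ^ (CARD('n)^2)))"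

definition det_nat :: "nat \<Rightarrow> (nat \<Rightarrow> nat \<Rightarrow> real) \<Rightarrow> real" where
  "det_nat n M = (\<Sum>p | p permutes {..<n}. of_int (sign p) * (\<Prod>j<n. M j (p j)))"

text \<open>Vandermonde matrix; row j (0-based) is (d_i^(n-1-j))_i, i.e. row j+1 is (d_i^(n-(j+1))).\<close>
definition vandermonde :: "nat \<Rightarrow> (nat \<Rightarrow> real) \<Rightarrow> nat \<Rightarrow> nat \<Rightarrow> real" where
  "vandermonde n d = (\<lambda>j i. d i ^ (n - (j + 1)))"

definition f_aux :: "nat \<Rightarrow> (real \<Rightarrow> real) \<Rightarrow> nat \<Rightarrow> real \<Rightarrow> real" where
  "f_aux n f k x = (LBINT t:{0..}. exp (- t) * (t * x) ^ (n - (k + 1)) * f (t * x))"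

definition T_mat :: "nat \<Rightarrow> (real \<Rightarrow> real) \<Rightarrow> (nat \<Rightarrow> real) \<Rightarrow> nat \<Rightarrow> nat \<Rightarrow> nat \<Rightarrow> real" where
  "T_mat n f d k = (\<lambda>j i. if j = k then f_aux n f k (d i) / fact (n - (k + 1))
                          else vandermonde n d j i)"

end

theory Submission
  imports Defs "HOL-Real_Asymp.Real_Asymp" "HOL-Computational_Algebra.Polynomial" "HOL-Probability.Distributions"
begin

text \<open>After diagonalising \<open>A\<close> it suffices to treat \<open>W = H\<^sup>* D H\<close> with \<open>D\<close> the diagonal matrix of eigenvalues \<open>a\<close>.
  The trace of \<open>(w + W)\<^sup>-\<^sup>1\<close> equals \<open>det (w + W)\<close> times a Gaussian integral over a vector \<open>x\<close>, so that the
  expectation over \<open>H\<close>, for fixed \<open>x\<close>, is the average of a determinant against a Gaussian whose covariance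
  depends on \<open>x\<close> only through its norm: rotating \<open>x\<close> onto a coordinate axis makes the entries of \<open>H\<close> independent.
  Integrating over \<open>x\<close> by parts gives the expected resolvent trace, which is matched with the Lagrange
  interpolation coefficients produced by Cramer's rule on the right-hand side. Since resolvents span a dense
  algebra, this determines the expectation for every continuous \<open>f\<close>, the growth condition on \<open>f\<close> providing
  integrability.\<close>

section \<open>Hermitian matrices and the functional calculus\<close>

text \<open>Two obstacles shape the route through resolvents. Eigenvalues of a random matrix would
  have to be chosen measurably in \<open>H\<close>; here they are chosen pointwise, and
  measurability is obtained only for symmetric sums: first for the resolvent trace, a determinant
  times an integral with parameter, then for limits. And a function of an inverse matrix is not a
  Gaussian moment; the normalisation of the vector integral supplies 1 / det (w + W), so multiplying
  by the determinant leaves, for each \<open>x\<close>, a polynomial in the entries of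
  \<open>H\<close> under a Gaussian weight. The \<open>H\<close> and \<open>x\<close> integrals are
  exchanged for a nonnegative integrand, where Tonelli applies; estimates concern the signed Leibniz
  terms. The outcome is a truncation: \<open>rtrans\<close> divides the part of degree below n of
  exp (w r) prod (1 + r a_i) by the full product. Partial fractions at the poles r = -1 / a_i and
  the substitution s = w a_i r turn its integral into one of 1 / (w + s) against a sum of multiples
  of s^j exp (-s / a_i), which is the density behind the right-hand side of the theorem.\<close>

abbreviation cdiag :: "('n \<Rightarrow> real) \<Rightarrow> complex^'n^'n" where
  "cdiag b \<equiv> diag_mat (\<lambda>i. complex_of_real (b i))"

lemma cadj_nth [simp]: "cadj H $ i $ j = cnj (H $ j $ i)"
  by (simp add: cadj_def)

lemma cadj_cadj [simp]: "cadj (cadj H) = H"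
  by (simp add: vec_eq_iff)

lemma cadj_mul: "cadj (A ** B) = cadj B ** cadj A"
  by (simp add: vec_eq_iff matrix_matrix_mult_def mult.commute)

lemma inner_mult_cadj:
  fixes A :: "complex^'n^'n"
  shows "(A *v x) \<bullet> y = x \<bullet> (cadj A *v y)"
proof -
  have inner_cnj: "u \<bullet> v = Re (\<Sum>i\<in>UNIV. u $ i * cnj (v $ i))" for u v :: "complex^'n"
    by (simp add: inner_vec_def inner_complex_def)
  have "(\<Sum>i\<in>UNIV. (A *v x) $ i * cnj (y $ i)) = (\<Sum>i\<in>UNIV. \<Sum>j\<in>UNIV. A $ i $ j * x $ j * cnj (y $ i))"
    by (simp add: matrix_vector_mult_def sum_distrib_right)
  also have "\<dots> = (\<Sum>j\<in>UNIV. \<Sum>i\<in>UNIV. A $ i $ j * x $ j * cnj (y $ i))"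
    by (rule sum.swap)
  also have "\<dots> = (\<Sum>j\<in>UNIV. x $ j * cnj ((cadj A *v y) $ j))"
    by (simp add: matrix_vector_mult_def sum_distrib_left mult_ac)
  finally show ?thesis unfolding inner_cnj by simp
qed

section \<open>The Hermitian product expressed through the real inner product\<close>

definition cprod :: "complex^'n \<Rightarrow> complex^'n \<Rightarrow> complex" where
  "cprod x y = (\<Sum>i\<in>UNIV. cnj (x $ i) * y $ i)"

lemma Re_cprod: "Re (cprod x y) = x \<bullet> y"
  by (simp add: cprod_def inner_vec_def inner_complex_def)

lemma Im_cprod: "Im (cprod x y) = (\<i> *s x) \<bullet> y"
  unfolding cprod_def inner_vec_def inner_complex_def Im_sum
  by (intro sum.cong) auto

text \<open>One complex orthogonality condition becomes two real ones, so dimension counts and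
  orthogonal complements of the real inner product space apply to Hermitian orthogonality.\<close>

lemma cprod_eq_0: "cprod x y = 0 \<longleftrightarrow> x \<bullet> y = 0 \<and> (\<i> *s x) \<bullet> y = 0"
  by (simp add: complex_eq_iff Re_cprod Im_cprod)

lemma cprod_self: "cprod x x = complex_of_real ((norm x)\<^sup>2)"
proof -
  have "Im (cprod x x) = 0" by (simp add: cprod_def mult.commute)
  then show ?thesis by (simp add: complex_eq_iff Re_cprod power2_norm_eq_inner)
qed

lemma cprod_commute: "cprod y x = cnj (cprod x y)"
  by (simp add: cprod_def mult.commute)

lemma cprod_mult_cadj: "cprod (A *v x) y = cprod x (cadj A *v y)"
  by (simp add: complex_eq_iff Re_cprod Im_cprod inner_mult_cadj flip: vector_scalar_commute)

lemma cprod_scale: "cprod x (c *s y) = c * cprod x y" "cprod (c *s x) y = cnj c * cprod x y"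
  by (simp_all add: cprod_def sum_distrib_left mult_ac)

lemma mult_vec_scaleR: "(A::complex^'n^'m) *v (r *\<^sub>R x) = r *\<^sub>R (A *v x)"
  by (simp add: vec_eq_iff matrix_vector_mult_def scaleR_sum_right)

text \<open>Rayleigh quotient: on the unit sphere of the orthogonal complement of the eigenvectors found so
  far, a maximiser of the quadratic form is again an eigenvector.\<close>

lemma hermitian_extend_eigenvectors:
  fixes B :: "complex^'n^'n" and u :: "'n \<Rightarrow> complex^'n"
  assumes B: "hermitian_mat B" and K: "K \<noteq> UNIV"
    and eig: "\<And>k. k \<in> K \<Longrightarrow> B *v u k = complex_of_real (b k) *s u k"
  shows "\<exists>x c. norm x = 1 \<and> (\<forall>k\<in>K. cprod (u k) x = 0) \<and> B *v x = complex_of_real c *s x"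
proof -
  have cB: "cadj B = B" using B by (simp add: hermitian_mat_def)
  define M where "M = {x. \<forall>k\<in>K. cprod (u k) x = 0}"
  let ?S = "u ` K \<union> (\<lambda>k. \<i> *s u k) ` K"
  have M_eq: "M = {x. \<forall>y\<in>?S. y \<bullet> x = 0}"
    by (auto simp: M_def cprod_eq_0)
  have subM: "subspace M" unfolding M_eq
    by (auto simp: subspace_def inner_right_distrib)
  have "finite ?S" by simp
  \<comment> \<open>Each vector already found costs two real dimensions, and
    \<open>DIM(complex^'n)\<close> is twice the number of indices, so one missing index leaves
    room.\<close>
  have card_S: "card ?S \<le> card K + card K"
    by (meson card_Un_le card_image_le finite le_trans add_mono)
  have "card K < CARD('n)" using K by (simp add: psubset_card_mono psubset_eq)
  with card_S have "dim ?S < DIM(complex^'n)"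
    using dim_le_card'[of ?S] by simp
  then obtain z where z: "z \<noteq> 0" "\<And>y. y \<in> span ?S \<Longrightarrow> orthogonal z y"
    using orthogonal_to_subspace_exists[of ?S] by blast
  have zM: "z \<in> M" unfolding M_eq
  proof (intro CollectI ballI)
    fix y assume "y \<in> ?S"
    from z(2)[OF span_base[OF this]] show "y \<bullet> z = 0" by (simp add: orthogonal_def inner_commute)
  qed
  have closedM: "closed M" using subM by (rule closed_subspace)
  let ?C = "M \<inter> sphere 0 1"
  have comp: "compact ?C" using closedM by (simp add: closed_Int_compact)
  have "z /\<^sub>R norm z \<in> ?C" using z zM subM by (simp add: subspace_scale)
  then have ne: "?C \<noteq> {}" by blast
  have cont: "continuous_on ?C (\<lambda>x. x \<bullet> (B *v x))"
    by (intro continuous_intros)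
  obtain x where x: "x \<in> ?C" and max: "\<And>y. y \<in> ?C \<Longrightarrow> y \<bullet> (B *v y) \<le> x \<bullet> (B *v x)"
    using continuous_attains_sup[OF comp ne cont] by blast
  define c where "c = x \<bullet> (B *v x)"
  have le: "y \<bullet> (B *v y) \<le> c * (norm y)\<^sup>2" if "y \<in> M" for y
  proof (cases "y = 0")
    case False
    have "y /\<^sub>R norm y \<in> ?C" using False that subM by (simp add: subspace_scale)
    from max[OF this] have "(y \<bullet> (B *v y)) / (norm y)\<^sup>2 \<le> c"
      by (simp add: c_def mult_vec_scaleR divide_inverse power2_eq_square mult_ac)
    then show ?thesis using False by (simp add: divide_le_eq)
  qed (simp)
  have xM: "x \<in> M" and xn: "norm x = 1" using x by auto
  have BM: "B *v y \<in> M" if "y \<in> M" for y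
    unfolding M_def
  proof (intro CollectI ballI)
    fix k assume k: "k \<in> K"
    have "cprod (u k) (B *v y) = cprod (B *v u k) y" by (simp add: cprod_mult_cadj cB)
    also have "\<dots> = 0" using that k by (simp add: eig cprod_scale M_def)
    finally show "cprod (u k) (B *v y) = 0" .
  qed
  \<comment> \<open>The residual of the eigenvector equation. It lies in \<open>M\<close>, hence is
    an admissible direction of variation at the maximiser, and the first-order change along it is
    governed by its own squared norm.\<close>
  define y where "y = B *v x - c *\<^sub>R x"
  have yM: "y \<in> M" unfolding y_def using subM BM xM by (simp add: subspace_diff subspace_scale)
  have sym: "x \<bullet> (B *v y) = y \<bullet> (B *v x)"
    by (metis inner_mult_cadj cB inner_commute)
  have poly: "0 \<le> - 2 * t * (y \<bullet> y) + t\<^sup>2 * (c * (norm y)\<^sup>2 - y \<bullet> (B *v y))" for t :: real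
  proof -
    have "x + t *\<^sub>R y \<in> M" using subM xM yM by (simp add: subspace_add subspace_scale)
    from le[OF this] have "(x + t *\<^sub>R y) \<bullet> (B *v x + t *\<^sub>R (B *v y)) \<le> c * ((x + t *\<^sub>R y) \<bullet> (x + t *\<^sub>R y))"
      by (simp add: matrix_vector_right_distrib mult_vec_scaleR power2_norm_eq_inner)
    moreover have "(x + t *\<^sub>R y) \<bullet> (B *v x + t *\<^sub>R (B *v y))
        = c + 2 * t * (y \<bullet> (B *v x)) + t\<^sup>2 * (y \<bullet> (B *v y))"
      by (simp add: inner_add_left inner_add_right sym c_def power2_eq_square algebra_simps)
    moreover have "(x + t *\<^sub>R y) \<bullet> (x + t *\<^sub>R y) = 1 + 2 * t * (y \<bullet> x) + t\<^sup>2 * (norm y)\<^sup>2"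
    proof -
      have "x \<bullet> x = 1" using xn by (simp add: dot_square_norm)
      then show ?thesis unfolding power2_norm_eq_inner
        by (simp add: inner_add_left inner_add_right inner_commute[of x y] power2_eq_square algebra_simps)
    qed
    moreover have "y \<bullet> (B *v x) = y \<bullet> y + c * (y \<bullet> x)"
    proof -
      have "B *v x = y + c *\<^sub>R x" by (simp add: y_def)
      then show ?thesis by (simp add: inner_add_right)
    qed
    ultimately have "c + 2 * t * (y \<bullet> y + c * (y \<bullet> x)) + t\<^sup>2 * (y \<bullet> (B *v y))
        \<le> c * (1 + 2 * t * (y \<bullet> x) + t\<^sup>2 * (norm y)\<^sup>2)" by (simp only:)
    then show ?thesis by (simp add: algebra_simps)
  qed
  have "y \<bullet> y = 0"
  proof (rule ccontr)
    assume "y \<bullet> y \<noteq> 0"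
    then have yp: "0 < y \<bullet> y" by simp
    define d where "d = c * (norm y)\<^sup>2 - y \<bullet> (B *v y)"
    have d0: "d \<ge> 0" using le[OF yM] by (simp add: d_def)
    \<comment> \<open>Small enough for the linear term of \<open>poly\<close> to beat the quadratic
      one; the added 1 keeps the denominator positive when \<open>d\<close> is 0.\<close>
    define t where "t = (y \<bullet> y) / (d + 1)"
    have t0: "t > 0" using yp d0 by (simp add: t_def)
    have "0 \<le> t * (t * d - 2 * (y \<bullet> y))"
      using poly[of t] by (simp add: d_def power2_eq_square algebra_simps)
    then have "2 * (y \<bullet> y) \<le> t * d" using t0 by (simp add: zero_le_mult_iff)
    also have "\<dots> \<le> t * (d + 1)" using t0 by simp
    also have "\<dots> = y \<bullet> y" using d0 by (simp add: t_def)
    finally show False using yp by simp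
  qed
  then have "B *v x = complex_of_real c *s x"
    unfolding y_def vec_eq_iff by (simp add: vector_scaleR_component scaleR_conv_of_real[where 'a=complex] vector_scalar_mult_def)
  with xM xn show ?thesis unfolding M_def by blast
qed

text \<open>The orthonormal eigenvectors are indexed by a growing set of matrix indices, so that at
  \<open>UNIV\<close> they are already the columns of a square matrix.\<close>

theorem hermitian_spectral:
  fixes B :: "complex^'n^'n"
  assumes B: "hermitian_mat B"
  obtains U b where "unitary_mat U" "B = U ** cdiag b ** cadj U"
proof -
  have "\<exists>u b. (\<forall>k\<in>K. \<forall>l\<in>K. cprod (u k) (u l) = (if k = l then 1 else 0)) \<and>
      (\<forall>k\<in>K. B *v u k = complex_of_real (b k) *s u k)" for K :: "'n set"
  proof (induction K rule: infinite_finite_induct)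
    case (insert k K)
    then obtain u b where u: "\<forall>k\<in>K. \<forall>l\<in>K. cprod (u k) (u l) = (if k = l then 1 else 0)"
      "\<forall>k\<in>K. B *v u k = complex_of_real (b k) *s u k" by blast
    have "K \<noteq> UNIV" using insert by auto
    from hermitian_extend_eigenvectors[OF B this] u obtain x c
      where x: "norm x = 1" "\<forall>k\<in>K. cprod (u k) x = 0" "B *v x = complex_of_real c *s x" by metis
    have x': "\<forall>k\<in>K. cprod x (u k) = 0" using x(2) by (metis cprod_commute complex_cnj_zero)
    have xx: "cprod x x = 1" using x(1) by (simp add: cprod_self)
    show ?case
      apply (rule exI[of _ "u(k := x)"], rule exI[of _ "b(k := c)"])
      using insert.hyps u x(2,3) x' xx by auto
  qed auto
  from this[of UNIV] obtain u :: "'n \<Rightarrow> complex^'n" and b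
    where "\<forall>k\<in>UNIV. \<forall>l\<in>UNIV. cprod (u k) (u l) = (if k = l then 1 else 0)"
      and "\<forall>k\<in>UNIV. B *v u k = complex_of_real (b k) *s u k" by blast
  then have u: "\<And>k l. cprod (u k) (u l) = (if k = l then 1 else 0)"
    and e: "\<And>k. B *v u k = complex_of_real (b k) *s u k" by auto
  define U :: "complex^'n^'n" where "U = (\<chi> i j. u j $ i)"
  let ?D = "cdiag b"
  have 1: "cadj U ** U = mat 1"
    using u by (simp add: vec_eq_iff U_def matrix_matrix_mult_def mat_def cprod_def)
  then have 2: "U ** cadj U = mat 1" by (simp add: matrix_left_right_inverse)
  have "(B ** U) $ i $ j = (U ** ?D) $ i $ j" for i j
  proof -
    have "(B ** U) $ i $ j = (B *v u j) $ i"
      by (simp add: matrix_matrix_mult_def matrix_vector_mult_def U_def)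
    also have "\<dots> = (U ** ?D) $ i $ j"
      by (simp add: e matrix_matrix_mult_def diag_mat_def U_def if_distrib cong: if_cong)
    finally show ?thesis .
  qed
  then have "B ** U = U ** ?D" by (simp add: vec_eq_iff)
  then have "B ** (U ** cadj U) = U ** ?D ** cadj U" by (simp add: matrix_mul_assoc)
  then have "B = U ** ?D ** cadj U" by (simp add: 2)
  with 1 2 that show ?thesis by (simp add: unitary_mat_def)
qed

text \<open>Independence of the diagonalisation: for two of them, P = \<open>cadj V ** U\<close>
  intertwines the diagonal matrices of \<open>b\<close> and \<open>c\<close>. Hence an entry of P at
  (i, j) is nonzero only if b j = c i, and then P intertwines the images under \<open>f\<close> as
  well.\<close>

lemma mat_fun_eq:
  fixes U :: "complex^'n^'n"
  assumes U: "unitary_mat U" and B: "B = U ** cdiag b ** cadj U"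
  shows "mat_fun f B = U ** cdiag (\<lambda>i. f (b i)) ** cadj U"
  unfolding mat_fun_def
proof (rule some_equality, use U B in blast)
  fix M assume "\<exists>V c. unitary_mat V \<and> B = V ** cdiag c ** cadj V \<and>
    M = V ** cdiag (\<lambda>i. f (c i)) ** cadj V"
  then obtain V c where V: "unitary_mat V" and BV: "B = V ** cdiag c ** cadj V"
    and M: "M = V ** cdiag (\<lambda>i. f (c i)) ** cadj V" by blast
  define P where "P = cadj V ** U"
  have U1: "cadj U ** U = mat 1" "U ** cadj U = mat 1" and V1: "cadj V ** V = mat 1" "V ** cadj V = mat 1"
    using U V by (auto simp: unitary_mat_def)
  have DP: "(diag_mat g ** P) $ i $ j = g i * P $ i $ j" for g :: "'n \<Rightarrow> complex" and i j
    by (simp add: matrix_matrix_mult_def diag_mat_def if_distrib if_distribR cong: if_cong)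
  have PD: "(P ** diag_mat g) $ i $ j = P $ i $ j * g j" for g :: "'n \<Rightarrow> complex" and i j
    by (simp add: matrix_matrix_mult_def diag_mat_def if_distrib if_distribR cong: if_cong)
  have V2: "V ** (cadj V ** X) = X" "cadj V ** (V ** X) = X" for X
    by (simp_all add: matrix_mul_assoc U1 V1)
  note assoc = matrix_mul_assoc[symmetric]
  have "P ** cdiag b = cadj V ** B ** U"
    unfolding B P_def by (simp add: assoc U1)
  also have "\<dots> = cdiag c ** P"
    unfolding BV P_def by (simp add: assoc V2)
  finally have "P $ i $ j * b j = c i * P $ i $ j" for i j by (simp add: vec_eq_iff PD DP)
  then have "P $ i $ j = 0 \<or> b j = c i" for i j
    by (metis mult.commute mult_cancel_right of_real_eq_iff)
  then have "P $ i $ j * f (b j) = f (c i) * P $ i $ j" for i j by (metis mult.commute mult_zero_left)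
  then have "P ** cdiag (\<lambda>i. f (b i)) = cdiag (\<lambda>i. f (c i)) ** P"
    by (simp add: vec_eq_iff PD DP)
  then have "V ** (P ** cdiag (\<lambda>i. f (b i))) ** cadj U
      = V ** (cdiag (\<lambda>i. f (c i)) ** P) ** cadj U" by simp
  then show "M = U ** cdiag (\<lambda>i. f (b i)) ** cadj U"
    unfolding M P_def by (simp add: assoc V2 U1)
qed

section \<open>Lebesgue measure on vectors and matrices\<close>

lemma borel_measurable_linear:
  "linear (T :: 'a::euclidean_space \<Rightarrow> 'b::euclidean_space) \<Longrightarrow> T \<in> borel_measurable borel"
  by (intro borel_measurable_continuous_onI linear_continuous_on linear_conv_bounded_linear[THEN iffD1])

lemma lborel_translation:
  fixes c :: "'a::euclidean_space"
  shows "distr lborel borel (\<lambda>x. c + x) = lborel"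
  using lborel_affine[of 1 c] by (simp add: density_1)

lemma nn_integral_lborel_translate:
  fixes c :: "'a::euclidean_space"
  assumes [measurable]: "f \<in> borel_measurable borel"
  shows "(\<integral>\<^sup>+x. f (c + x) \<partial>lborel) = (\<integral>\<^sup>+x. f x \<partial>lborel)"
  by (subst (2) lborel_translation[of c, symmetric]) (simp add: nn_integral_distr)

text \<open>Uniqueness of Haar measure by a Fubini swap, normalised on the invariant unit ball.\<close>

lemma lborel_distr_isometry:
  fixes T :: "'a::euclidean_space \<Rightarrow> 'a"
  assumes lin: "linear T" and norm: "\<And>x. norm (T x) = norm x"
  shows "distr lborel borel T = lborel"
proof -
  let ?M = "distr lborel borel T"
  have [measurable]: "T \<in> borel_measurable borel"
    using lin by (rule borel_measurable_linear)
  have inj: "inj T" using lin norm by (metis linear_injective_0 norm_eq_zero)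
  then have surj: "surj T" using lin by (simp add: linear_injective_imp_surjective)
  have shift: "(\<integral>\<^sup>+x. f (T c + x) \<partial>?M) = (\<integral>\<^sup>+x. f x \<partial>?M)"
    if [measurable]: "f \<in> borel_measurable borel" for f and c
  proof -
    have "(\<integral>\<^sup>+x. f (T c + x) \<partial>?M) = (\<integral>\<^sup>+x. f (T (c + x)) \<partial>lborel)"
      using lin by (simp add: nn_integral_distr linear_add)
    also have "\<dots> = (\<integral>\<^sup>+x. f (T x) \<partial>lborel)"
      by (rule nn_integral_lborel_translate) measurable
    finally show ?thesis by (simp add: nn_integral_distr)
  qed
  \<comment> \<open>Invariance is first seen for shifts by vectors \<open>T c\<close>; surjectivity
    makes every vector of this form.\<close>
  have shift': "(\<integral>\<^sup>+x. f (c + x) \<partial>?M) = (\<integral>\<^sup>+x. f x \<partial>?M)"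
    if "f \<in> borel_measurable borel" for f c
    using shift[OF that, of "inv T c"] surj by (simp add: surj_f_inv_f)
  have "sigma_finite_measure ?M"
  proof (rule sigma_finite_measure.intro, intro exI conjI ballI)
    let ?A = "range (\<lambda>n::nat. ball (0::'a) (real n))"
    show "countable ?A" "?A \<subseteq> sets ?M" by auto
    show "\<Union> ?A = space ?M" by (auto intro: reals_Archimedean2)
    have "T -` ball 0 r = ball 0 r" for r by (auto simp: norm)
    then show "a \<in> ?A \<Longrightarrow> emeasure ?M a \<noteq> \<infinity>" for a
      using emeasure_lborel_ball_finite[of "0::'a"] by (auto simp: emeasure_distr less_top[symmetric])
  qed
  then interpret M: sigma_finite_measure ?M .
  interpret P: pair_sigma_finite ?M "lborel :: 'a measure"
    by (simp add: pair_sigma_finite_def M.sigma_finite_measure_axioms lborel.sigma_finite_measure_axioms)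
  \<comment> \<open>Integrate 1_A(x) 1_B(x + y) in both orders: translation invariance of
    \<open>lborel\<close> in y gives the left side, that of \<open>?M\<close> in x, followed by
    integration over y, the right side.\<close>
  have sw: "emeasure ?M A * emeasure lborel B = emeasure ?M B * emeasure lborel (uminus ` A)"
    if [measurable]: "A \<in> sets borel" "B \<in> sets borel" for A B
  proof -
    have "emeasure ?M A * emeasure lborel B = (\<integral>\<^sup>+x. indicator A x * (\<integral>\<^sup>+y. indicator B y \<partial>lborel) \<partial>?M)"
      by (simp add: nn_integral_multc)
    also have "\<dots> = (\<integral>\<^sup>+x. \<integral>\<^sup>+y. indicator A x * indicator B (x + y) \<partial>lborel \<partial>?M)"
      by (simp add: nn_integral_cmult nn_integral_lborel_translate[of "indicator B"])
    also have "\<dots> = (\<integral>\<^sup>+y. \<integral>\<^sup>+x. indicator A x * indicator B (x + y) \<partial>?M \<partial>lborel)"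
      by (rule P.Fubini'[symmetric]) simp
    also have "\<dots> = (\<integral>\<^sup>+y. \<integral>\<^sup>+x. indicator A (- y + x) * indicator B x \<partial>?M \<partial>lborel)"
    proof (rule nn_integral_cong)
      fix y :: 'a
      show "(\<integral>\<^sup>+x. indicator A x * indicator B (x + y) \<partial>?M) = (\<integral>\<^sup>+x. indicator A (- y + x) * indicator B x \<partial>?M)"
        using shift'[of "\<lambda>x. indicator A x * indicator B (x + y)" "- y"] by simp
    qed
    also have "\<dots> = (\<integral>\<^sup>+x. \<integral>\<^sup>+y. indicator A (- y + x) * indicator B x \<partial>lborel \<partial>?M)"
      by (rule P.Fubini') simp
    also have "\<dots> = (\<integral>\<^sup>+x. indicator B x * emeasure lborel (uminus ` A) \<partial>?M)"
    proof (rule nn_integral_cong)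
      fix x :: 'a
      have uA: "indicator (uminus ` A) y = (indicator A (- y) :: ennreal)" for y
        by (auto simp: indicator_def image_iff) (metis minus_minus)
      then have mA: "uminus ` A \<in> sets borel"
        using measurable_compose[of uminus borel borel "indicator A :: 'a \<Rightarrow> ennreal" borel]
        by (simp add: borel_measurable_indicator_iff flip: uA)
      have "(\<integral>\<^sup>+y. indicator A (- y + x) * indicator B x \<partial>lborel)
          = (\<integral>\<^sup>+y. indicator (uminus ` A) (- x + y) \<partial>lborel) * indicator B x"
        by (simp add: nn_integral_multc uA)
      also have "(\<integral>\<^sup>+y. indicator (uminus ` A) (- x + y) \<partial>lborel) = (\<integral>\<^sup>+y. indicator (uminus ` A) y \<partial>lborel)"
        using mA by (intro nn_integral_lborel_translate) simp
      finally show "(\<integral>\<^sup>+y. indicator A (- y + x) * indicator B x \<partial>lborel) = indicator B x * emeasure lborel (uminus ` A)"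
        using mA by (simp add: mult.commute)
    qed
    finally show ?thesis by (simp add: nn_integral_multc)
  qed
  let ?B = "ball (0::'a) 1"
  \<comment> \<open>\<open>T\<close> preserves the unit ball, whose volume is positive and finite,
    so the constant of proportionality contained in \<open>sw\<close> is 1.\<close>
  have TB: "emeasure ?M ?B = emeasure lborel ?B"
  proof -
    have "T -` ?B = ?B" by (auto simp: norm)
    then show ?thesis by (simp add: emeasure_distr)
  qed
  have Bpos: "emeasure lborel ?B \<noteq> 0" "emeasure lborel ?B \<noteq> top"
    using unit_ball_vol_pos[of "real DIM('a)"] by (auto simp: emeasure_ball simp del: unit_ball_vol_pos)
  have neg: "emeasure lborel (uminus ` A) = emeasure lborel (A :: 'a set)" if "A \<in> sets borel" for A
  proof -
    have "distr lborel borel (\<lambda>x. - x :: 'a) = lborel"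
      using lborel_affine[of "-1" "0::'a"] by (simp add: density_1)
    then have "emeasure lborel A = emeasure (distr lborel borel (\<lambda>x. - x)) A" by simp
    also have "\<dots> = emeasure lborel (uminus -` A)" using that by (simp add: emeasure_distr)
    also have "uminus -` A = uminus ` A" by (auto simp: image_iff) (metis minus_minus)
    finally show ?thesis by simp
  qed
  show ?thesis
  proof (rule measure_eqI)
    fix A assume "A \<in> sets ?M"
    then have A: "A \<in> sets borel" by simp
    have "emeasure lborel ?B * emeasure ?M A = emeasure lborel ?B * emeasure lborel A"
      using sw[OF A, of ?B] by (simp add: TB neg[OF A] mult.commute)
    then show "emeasure ?M A = emeasure lborel A"
      using Bpos by (simp add: ennreal_mult_cancel_left)
  qed simp
qed

lemma nn_integral_lborel_isometry:
  fixes T :: "'a::euclidean_space \<Rightarrow> 'a"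
  assumes "linear T" "\<And>x. norm (T x) = norm x" "f \<in> borel_measurable borel"
  shows "(\<integral>\<^sup>+x. f (T x) \<partial>lborel) = (\<integral>\<^sup>+x. f x \<partial>lborel)"
proof -
  have "T \<in> borel_measurable borel" using assms(1) by (rule borel_measurable_linear)
  then show ?thesis
    using assms by (subst (2) lborel_distr_isometry[OF assms(1,2), symmetric]) (simp add: nn_integral_distr)
qed

section \<open>Vectors as product spaces, and the distribution of squared norms\<close>

lemma measurable_vec_lambda:
  "(\<lambda>f. \<chi> i. f i) \<in> (\<Pi>\<^sub>M i\<in>(UNIV::'n::finite set). lborel) \<rightarrow>\<^sub>M (borel :: ('a::euclidean_space^'n) measure)"
proof -
  have *: "(\<lambda>x::'a. axis i x) \<in> borel \<rightarrow>\<^sub>M (borel :: ('a^'n) measure)" for i :: 'n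
    by (intro borel_measurable_linear linearI) (auto simp: axis_def vec_eq_iff)
  have "(\<lambda>f. \<Sum>i\<in>UNIV. axis i (f i)) \<in> (\<Pi>\<^sub>M i\<in>(UNIV::'n set). lborel) \<rightarrow>\<^sub>M (borel :: ('a^'n) measure)"
    using * by measurable
  also have "(\<lambda>f. \<Sum>i\<in>UNIV. axis i (f i)) = (\<lambda>f. (\<chi> i. f i) :: 'a^'n)"
    by (auto simp: fun_eq_iff vec_eq_iff axis_def if_distrib cong: if_cong)
  finally show ?thesis .
qed

text \<open>Lebesgue measure is determined by the volumes of boxes, and since the basis consists of
  the vectors \<open>axis i b\<close>, a box of vectors is a product of boxes. This is the source of
  the independence of matrix entries.\<close>

lemma lborel_vec_eq:
  "(lborel :: ('a::euclidean_space^'n) measure) = distr (\<Pi>\<^sub>M i\<in>UNIV. lborel) borel (\<lambda>f. \<chi> i. f i)"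
proof (rule lborel_eqI)
  interpret product_sigma_finite "\<lambda>_::'n. lborel :: 'a measure" ..
  note measurable_vec_lambda [measurable]
  fix l u :: "'a^'n"
  assume le: "\<And>b. b \<in> Basis \<Longrightarrow> l \<bullet> b \<le> u \<bullet> b"
  have le': "l $ i \<bullet> b \<le> u $ i \<bullet> b" if "b \<in> Basis" for i b
    using le[of "axis i b"] that by (simp add: inner_axis)
  have "emeasure (distr (\<Pi>\<^sub>M i\<in>UNIV. lborel) borel (\<lambda>f. \<chi> i. f i)) (box l u)
      = emeasure (\<Pi>\<^sub>M i\<in>UNIV. lborel) ((\<lambda>f. \<chi> i. f i) -` box l u)"
    by (simp add: emeasure_distr space_PiM)
  also have "(\<lambda>f. \<chi> i. f i) -` box l u = (\<Pi>\<^sub>E i\<in>UNIV. box (l $ i) (u $ i))"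
    by (auto simp: box_def Basis_vec_def inner_axis PiE_iff)
  also have "emeasure (\<Pi>\<^sub>M i\<in>UNIV. lborel) \<dots> = (\<Prod>i\<in>UNIV. ennreal (\<Prod>b\<in>Basis. (u $ i - l $ i) \<bullet> b))"
    using le' by (subst emeasure_PiM) (auto simp: emeasure_lborel_box_eq)
  also have "\<dots> = ennreal (\<Prod>i\<in>UNIV. \<Prod>b\<in>Basis. (u - l) \<bullet> axis i b)"
    using le' by (subst prod_ennreal) (auto intro!: prod_nonneg simp: inner_axis inner_diff_left)
  also have "(\<Prod>i\<in>UNIV. \<Prod>b\<in>Basis. (u - l) \<bullet> axis i b) = (\<Prod>b\<in>Basis. (u - l) \<bullet> b)"
  proof -
    have inj: "inj_on (\<lambda>(i, b). axis i b) (UNIV \<times> (Basis :: 'a set))"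
      by (auto simp: inj_on_def axis_eq_axis)
    have "(\<Prod>b\<in>(Basis::('a^'n) set). (u - l) \<bullet> b) = (\<Prod>b\<in>(\<lambda>(i, b). axis i b) ` (UNIV \<times> (Basis :: 'a set)). (u - l) \<bullet> b)"
      by (rule prod.cong) (auto simp: Basis_vec_def)
    also have "\<dots> = (\<Prod>i\<in>UNIV. \<Prod>b\<in>Basis. (u - l) \<bullet> axis i b)"
      by (subst prod.reindex[OF inj]) (simp add: case_prod_unfold prod.cartesian_product)
    finally show ?thesis by simp
  qed
  finally show "emeasure (distr (\<Pi>\<^sub>M i\<in>UNIV. lborel) borel (\<lambda>f. \<chi> i. f i)) (box l u)
      = ennreal (\<Prod>b\<in>Basis. (u - l) \<bullet> b)" .
qed simp

lemma borel_measurable_vec_nth' [measurable]: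
  "(\<lambda>x::'a::euclidean_space^'n. x $ i) \<in> borel_measurable borel"
  by (intro borel_measurable_continuous_onI continuous_intros)

lemma nn_integral_lborel_vec_prod:
  fixes g :: "'n::finite \<Rightarrow> 'a::euclidean_space \<Rightarrow> ennreal"
  assumes [measurable]: "\<And>i. g i \<in> borel_measurable borel"
  shows "(\<integral>\<^sup>+x. (\<Prod>i\<in>UNIV. g i (x $ i)) \<partial>lborel) = (\<Prod>i\<in>UNIV. \<integral>\<^sup>+z. g i z \<partial>lborel)"
proof -
  interpret product_sigma_finite "\<lambda>_::'n. lborel :: 'a measure" ..
  show ?thesis
    by (subst lborel_vec_eq) (simp add: nn_integral_distr measurable_vec_lambda product_nn_integral_prod)
qed

text \<open>The law of the squared norm under Lebesgue measure, read off from the volumes of balls.\<close>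

lemma nn_integral_norm_square:
  fixes g :: "real \<Rightarrow> ennreal"
  assumes [measurable]: "g \<in> borel_measurable borel" and n: "DIM('a::euclidean_space) = 2 * Suc n"
  shows "(\<integral>\<^sup>+x. g ((norm (x::'a))\<^sup>2) \<partial>lborel)
    = (\<integral>\<^sup>+r. g r * ennreal (pi ^ Suc n / fact n * r ^ n) * indicator {0..} r \<partial>lborel)"
proof -
  let ?D = "\<lambda>r::real. ennreal (pi ^ Suc n / fact n * r ^ n) * indicator {0..} r"
  \<comment> \<open>Half-lines generate the Borel sets. Their preimages are balls of even dimension
    2 (n + 1), of volume pi^(n+1) b^(n+1) / (n+1)! at radius sqrt b; the derivative in b is the
    density.\<close>
  have "distr lborel borel (\<lambda>x::'a. (norm x)\<^sup>2) = density lborel ?D"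
  proof (rule measure_eqI_generator_eq[where E = "range atMost" and \<Omega> = UNIV and A = "\<lambda>n. {..real n}"])
    show "Int_stable (range (atMost :: real \<Rightarrow> _))"
      by (auto simp: Int_stable_def)
    have eq: "emeasure (distr lborel borel (\<lambda>x::'a. (norm x)\<^sup>2)) {..b} = emeasure (density lborel ?D) {..b}" for b :: real
    proof (cases "b \<ge> 0")
      case True
      have "(\<lambda>x::'a. (norm x)\<^sup>2) -` {..b} = cball 0 (sqrt b)"
        using True by (auto simp: real_le_rsqrt) (metis norm_ge_zero real_sqrt_le_iff real_sqrt_unique)
      then have "emeasure (distr lborel borel (\<lambda>x::'a. (norm x)\<^sup>2)) {..b} = emeasure lborel (cball (0::'a) (sqrt b))"
        by (simp add: emeasure_distr)
      also have "\<dots> = ennreal (pi ^ Suc n / fact (Suc n) * b ^ Suc n)"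
      proof -
        have "sqrt b ^ (2 * Suc n) = b ^ Suc n" using True by (simp only: power_mult real_sqrt_pow2)
        then show ?thesis using True unit_ball_vol_even[of "Suc n"] n
          by (simp add: emeasure_cball del: fact_Suc power_Suc mult_Suc_right)
      qed
      also have "\<dots> = (\<integral>\<^sup>+r. ennreal (pi ^ Suc n / fact n * r ^ n) * indicator {0..b} r \<partial>lborel)"
      proof (subst nn_integral_FTC_Icc[where F = "\<lambda>r. pi ^ Suc n / fact (Suc n) * r ^ Suc n"])
        fix r :: real
        have "pi ^ Suc n / fact (Suc n) * (real (Suc n) * r ^ (Suc n - Suc 0)) = pi ^ Suc n / fact n * r ^ n"
          by (simp add: divide_simps del: power_Suc of_nat_Suc)
        moreover have "((\<lambda>r. pi ^ Suc n / fact (Suc n) * r ^ Suc n) has_real_derivative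
            pi ^ Suc n / fact (Suc n) * (real (Suc n) * r ^ (Suc n - Suc 0))) (at r)"
          by (intro DERIV_cmult DERIV_pow)
        ultimately show "((\<lambda>r. pi ^ Suc n / fact (Suc n) * r ^ Suc n) has_real_derivative pi ^ Suc n / fact n * r ^ n) (at r)"
          by (simp only:)
      qed (use True in auto)
      also have "\<dots> = emeasure (density lborel ?D) {..b}"
        by (simp add: emeasure_density, intro nn_integral_cong) (auto split: split_indicator)
      finally show ?thesis .
    next
      case False
      then have "(\<lambda>x::'a. (norm x)\<^sup>2) -` {..b} = {}" by (auto simp: not_le) (meson less_le_trans not_less zero_le_power2)
      moreover have "emeasure (density lborel ?D) {..b} = (\<integral>\<^sup>+r. ?D r * indicator {..b} r \<partial>lborel)"
        by (rule emeasure_density) auto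
      moreover have "\<dots> = (\<integral>\<^sup>+r. 0 \<partial>(lborel::real measure))"
        by (rule nn_integral_cong) (use False in \<open>auto split: split_indicator\<close>)
      ultimately show ?thesis by (simp add: emeasure_distr)
    qed
    show "X \<in> range atMost \<Longrightarrow> emeasure (distr lborel borel (\<lambda>x::'a. (norm x)\<^sup>2)) X = emeasure (density lborel ?D) X" for X
      using eq by auto
    show "sets (distr lborel borel (\<lambda>x::'a. (norm x)\<^sup>2)) = sigma_sets UNIV (range atMost)"
      "sets (density lborel ?D) = sigma_sets UNIV (range atMost)"
      by (simp_all add: borel_eq_atMost)
    show "(\<Union>i. {..real i}) = UNIV" by (auto intro: real_arch_simple)
    show "emeasure (distr lborel borel (\<lambda>x::'a. (norm x)\<^sup>2)) {..real i} \<noteq> \<infinity>" for i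
    proof -
      have "(\<lambda>x::'a. (norm x)\<^sup>2) -` {..real i} \<subseteq> cball 0 (sqrt (real i))"
        by (auto simp: real_le_rsqrt)
      from emeasure_mono[OF this, of lborel] show ?thesis
        using emeasure_lborel_cball_finite[of "0::'a" "sqrt (real i)"] by (auto simp: emeasure_distr less_top)
    qed
  qed auto
  then have "(\<integral>\<^sup>+r. g r \<partial>distr lborel borel (\<lambda>x::'a. (norm x)\<^sup>2)) = (\<integral>\<^sup>+r. g r \<partial>density lborel ?D)" by simp
  then show ?thesis by (simp add: nn_integral_distr nn_integral_density mult_ac)
qed

text \<open>In real dimension 2 the squared modulus has constant density pi on the half-line, so
  both are elementary exponential integrals.\<close>

lemma nn_integral_exp_norm_square_complex:
  assumes "c > 0"
  shows "(\<integral>\<^sup>+z. ennreal (exp (- c * (norm (z::complex))\<^sup>2)) \<partial>lborel) = ennreal (pi / c)"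
    and "(\<integral>\<^sup>+z. ennreal ((norm (z::complex))\<^sup>2 * exp (- c * (norm z)\<^sup>2)) \<partial>lborel) = ennreal (pi / c\<^sup>2)"
proof -
  have "(\<integral>\<^sup>+z. ennreal (exp (- c * (norm (z::complex))\<^sup>2)) \<partial>lborel)
      = (\<integral>\<^sup>+r. ennreal (exp (- c * r)) * ennreal (pi ^ Suc 0 / fact 0 * r ^ 0) * indicator {0..} r \<partial>lborel)"
    by (rule nn_integral_norm_square) auto
  also have "\<dots> = (\<integral>\<^sup>+r. ennreal (pi * exp (- c * r)) * indicator {0..} r \<partial>lborel)"
    by (simp add: mult.commute flip: ennreal_mult)
  also have "\<dots> = ennreal (0 - (- (pi / c) * exp (- c * 0)))"
  proof (rule nn_integral_FTC_atLeast)
    show "((\<lambda>r. - (pi / c) * exp (- c * r)) \<longlongrightarrow> 0) at_top"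
      using assms by real_asymp
    show "((\<lambda>r. - (pi / c) * exp (- c * r)) has_real_derivative pi * exp (- c * x)) (at x)" for x
      using assms by (auto intro!: derivative_eq_intros)
  qed auto
  finally show "(\<integral>\<^sup>+z. ennreal (exp (- c * (norm (z::complex))\<^sup>2)) \<partial>lborel) = ennreal (pi / c)" by simp
  have "(\<integral>\<^sup>+z. ennreal ((norm (z::complex))\<^sup>2 * exp (- c * (norm z)\<^sup>2)) \<partial>lborel)
      = (\<integral>\<^sup>+r. ennreal (r * exp (- c * r)) * ennreal (pi ^ Suc 0 / fact 0 * r ^ 0) * indicator {0..} r \<partial>lborel)"
    by (rule nn_integral_norm_square) auto
  also have "\<dots> = (\<integral>\<^sup>+r. ennreal (pi * (r * exp (- c * r))) * indicator {0..} r \<partial>lborel)"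
    by (intro nn_integral_cong) (auto simp: mult.commute simp flip: ennreal_mult split: split_indicator)
  also have "\<dots> = ennreal (0 - (- (pi / c\<^sup>2) * (c * 0 + 1) * exp (- c * 0)))"
  proof (rule nn_integral_FTC_atLeast)
    show "((\<lambda>r. - (pi / c\<^sup>2) * (c * r + 1) * exp (- c * r)) \<longlongrightarrow> 0) at_top"
      using assms by real_asymp
    show "((\<lambda>r. - (pi / c\<^sup>2) * (c * r + 1) * exp (- c * r)) has_real_derivative pi * (x * exp (- c * x))) (at x)" for x
      using assms by (auto intro!: derivative_eq_intros simp: power2_eq_square field_simps)
  qed auto
  finally show "(\<integral>\<^sup>+z. ennreal ((norm (z::complex))\<^sup>2 * exp (- c * (norm z)\<^sup>2)) \<partial>lborel) = ennreal (pi / c\<^sup>2)"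
    by simp
qed

section \<open>Gaussian integrals over matrices\<close>

lemma borel_measurable_mat_nth [measurable]:
  "(\<lambda>H::'a::euclidean_space^'n^'m. H $ i $ j) \<in> borel_measurable borel"
  by (intro borel_measurable_continuous_onI continuous_intros)

lemma nn_integral_lborel_mat_prod:
  fixes g :: "'m::finite \<Rightarrow> 'n::finite \<Rightarrow> 'a::euclidean_space \<Rightarrow> ennreal"
  assumes [measurable]: "\<And>i j. g i j \<in> borel_measurable borel"
  shows "(\<integral>\<^sup>+H. (\<Prod>i\<in>UNIV. \<Prod>j\<in>UNIV. g i j (H $ i $ j)) \<partial>lborel) = (\<Prod>i\<in>UNIV. \<Prod>j\<in>UNIV. \<integral>\<^sup>+z. g i j z \<partial>lborel)"
proof -
  have "(\<integral>\<^sup>+H. (\<Prod>i\<in>UNIV. \<Prod>j\<in>UNIV. g i j (H $ i $ j)) \<partial>lborel)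
      = (\<Prod>i\<in>UNIV. \<integral>\<^sup>+x. (\<Prod>j\<in>UNIV. g i j (x $ j)) \<partial>lborel)"
    by (rule nn_integral_lborel_vec_prod[where g = "\<lambda>i x. \<Prod>j\<in>UNIV. g i j (x $ j)"]) measurable
  then show ?thesis by (simp add: nn_integral_lborel_vec_prod)
qed

text \<open>The exponent of a Gaussian with independent entries, entry (i, j) having second moment 1
  / c i j. Weights per entry are used because the vector integral will change the variances in a
  single column, row by row.\<close>

definition wnorm :: "('n \<Rightarrow> 'n \<Rightarrow> real) \<Rightarrow> complex^'n^'n \<Rightarrow> real" where
  "wnorm c H = (\<Sum>i\<in>UNIV. \<Sum>j\<in>UNIV. c i j * (norm (H $ i $ j))\<^sup>2)"

lemma norm_mat_square: "(norm (H::complex^'n^'m))\<^sup>2 = (\<Sum>i\<in>UNIV. \<Sum>j\<in>UNIV. (norm (H $ i $ j))\<^sup>2)"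
  by (simp add: norm_vec_def L2_set_def sum_nonneg)

lemma continuous_on_wnorm: "continuous_on S (wnorm c)"
  unfolding wnorm_def by (intro continuous_intros)

lemma borel_measurable_wnorm [measurable]: "wnorm c \<in> borel_measurable borel"
  by (intro borel_measurable_continuous_onI continuous_on_wnorm)

text \<open>\<open>P\<close> marks the entries that occur through their squared modulus. The
  diagonal Leibniz terms are products of this kind, and independence evaluates them entry by
  entry.\<close>

lemma nn_integral_gaussian_moment:
  fixes c :: "'n::finite \<Rightarrow> 'n \<Rightarrow> real"
  assumes c: "\<And>i j. c i j > 0"
  shows "(\<integral>\<^sup>+H. ennreal ((\<Prod>i\<in>UNIV. \<Prod>j\<in>UNIV. if P i j then (norm (H $ i $ j))\<^sup>2 else 1) * exp (- wnorm c H)) \<partial>lborel)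
    = ennreal (\<Prod>i\<in>UNIV. \<Prod>j\<in>UNIV. pi / c i j * (if P i j then 1 / c i j else 1))"
proof -
  let ?g = "\<lambda>i j (z::complex). (if P i j then (norm z)\<^sup>2 else 1) * exp (- c i j * (norm z)\<^sup>2)"
  have e: "exp (- wnorm c H) = (\<Prod>i\<in>UNIV. \<Prod>j\<in>UNIV. exp (- c i j * (norm (H $ i $ j))\<^sup>2))" for H
    by (simp add: wnorm_def sum_negf[symmetric] exp_sum)
  have "(\<integral>\<^sup>+H. ennreal ((\<Prod>i\<in>UNIV. \<Prod>j\<in>UNIV. if P i j then (norm (H $ i $ j))\<^sup>2 else 1) * exp (- wnorm c H)) \<partial>lborel)
     = (\<integral>\<^sup>+H. (\<Prod>i\<in>UNIV. \<Prod>j\<in>UNIV. ennreal (?g i j (H $ i $ j))) \<partial>lborel)"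
    unfolding e prod.distrib[symmetric] by (simp add: prod_ennreal prod_nonneg)
  also have "\<dots> = (\<Prod>i\<in>UNIV. \<Prod>j\<in>UNIV. \<integral>\<^sup>+z. ennreal (?g i j z) \<partial>lborel)"
    by (rule nn_integral_lborel_mat_prod) measurable
  also have "\<dots> = (\<Prod>i\<in>UNIV. \<Prod>j\<in>UNIV. ennreal (pi / c i j * (if P i j then 1 / c i j else 1)))"
    using nn_integral_exp_norm_square_complex[OF c]
    by (intro prod.cong refl) (simp add: power2_eq_square)
  also have "\<dots> = ennreal (\<Prod>i\<in>UNIV. \<Prod>j\<in>UNIV. pi / c i j * (if P i j then 1 / c i j else 1))"
    using c by (simp add: prod_ennreal prod_nonneg less_imp_le)
  finally show ?thesis .
qed

text \<open>The rate s / 2 leaves half of the Gaussian exponent for integrability. The constant is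
  chosen so that 1 + s is at most 2 (n + 1) (1 + (s / 2) / n), whose n-th power the exponential
  controls.\<close>

lemma power_one_plus_le_exp:
  fixes s :: real
  assumes "s \<ge> 0"
  shows "(1 + s) ^ n \<le> (2 * Suc n) ^ n * exp (s / 2)"
proof (cases "n = 0")
  case False
  have "(1 + s) ^ n \<le> (2 * Suc n * (1 + (s / 2) / n)) ^ n"
  proof (rule power_mono)
    have "s \<le> s * (Suc n / n)" using assms False by (simp add: field_simps)
    then show "1 + s \<le> 2 * Suc n * (1 + (s / 2) / n)" using assms False by (simp add: field_simps)
  qed (use assms in auto)
  also have "\<dots> = (2 * Suc n) ^ n * (1 + (s / 2) / n) ^ n" by (simp add: power_mult_distrib)
  also have "\<dots> \<le> (2 * Suc n) ^ n * exp (s / 2)"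
    using exp_ge_one_plus_x_over_n_power_n[of n "s / 2"] assms False by (intro mult_left_mono) auto
  finally show ?thesis .
qed (use assms in auto)

text \<open>Weights at least 1 make the Gaussian at most exp (- |H|^2); half of this exponent
  absorbs the polynomial, and the other half is the integrable dominating function.\<close>

lemma integrable_gaussian_poly_bound:
  fixes F :: "complex^'n^'n \<Rightarrow> complex"
  assumes c: "\<And>i j. c i j \<ge> 1" and cont: "continuous_on UNIV F"
    and bound: "\<And>H. norm (F H) \<le> K * (1 + (norm H)\<^sup>2) ^ n"
  shows "integrable lborel (\<lambda>H. exp (- wnorm c H) *\<^sub>R F H)"
proof (rule Bochner_Integration.integrable_bound)
  let ?G = "\<lambda>H::complex^'n^'n. \<bar>K\<bar> * (2 * Suc n) ^ n * exp (- wnorm (\<lambda>_ _. 1/2) H)"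
  have "(\<integral>\<^sup>+H. ennreal (exp (- wnorm (\<lambda>_ _. 1/2) H)) \<partial>(lborel :: (complex^'n^'n) measure)) < \<infinity>"
    using nn_integral_gaussian_moment[of "\<lambda>(_::'n) (_::'n). 1/2" "\<lambda>_ _. False"] by simp
  then have "integrable lborel (\<lambda>H::complex^'n^'n. exp (- wnorm (\<lambda>_ _. 1/2) H))"
    by (intro integrableI_nonneg) auto
  then show "integrable lborel ?G" by (intro integrable_mult_right)
  have [measurable]: "F \<in> borel_measurable borel"
    using cont by (rule borel_measurable_continuous_onI)
  show "(\<lambda>H. exp (- wnorm c H) *\<^sub>R F H) \<in> borel_measurable lborel" by simp
  show "AE H in lborel. norm (exp (- wnorm c H) *\<^sub>R F H) \<le> norm (?G H)"
  proof (rule AE_I2)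
    fix H :: "complex^'n^'n"
    have "wnorm (\<lambda>_ _. 1) H \<le> wnorm c H"
      unfolding wnorm_def by (intro sum_mono mult_right_mono c) auto
    then have w: "(norm H)\<^sup>2 \<le> wnorm c H" by (simp add: wnorm_def norm_mat_square)
    have h: "wnorm (\<lambda>_ _. 1/2) H = (norm H)\<^sup>2 / 2"
      by (simp add: wnorm_def norm_mat_square sum_divide_distrib)
    have "norm (exp (- wnorm c H) *\<^sub>R F H) = exp (- wnorm c H) * norm (F H)" by simp
    also have "\<dots> \<le> exp (- (norm H)\<^sup>2) * (\<bar>K\<bar> * (1 + (norm H)\<^sup>2) ^ n)"
      using w order_trans[OF bound mult_right_mono[OF abs_ge_self]]
      by (intro mult_mono) auto
    also have "\<dots> \<le> exp (- (norm H)\<^sup>2) * (\<bar>K\<bar> * ((2 * Suc n) ^ n * exp ((norm H)\<^sup>2 / 2)))"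
      using power_one_plus_le_exp[of "(norm H)\<^sup>2" n] by (intro mult_left_mono) auto
    also have "\<dots> = \<bar>K\<bar> * (2 * Suc n) ^ n * (exp (- (norm H)\<^sup>2) * exp ((norm H)\<^sup>2 / 2))" by simp
    also have "exp (- (norm H)\<^sup>2) * exp ((norm H)\<^sup>2 / 2) = exp (- (norm H)\<^sup>2 / 2)"
      by (simp flip: exp_add)
    finally show "norm (exp (- wnorm c H) *\<^sub>R F H) \<le> norm (?G H)" by (simp add: h abs_mult)
  qed
qed

text \<open>Flipping the sign of a single entry preserves the weight, so an odd integrand has integral zero.\<close>

lemma integral_gaussian_odd:
  fixes F :: "complex^'n^'n \<Rightarrow> complex" and i0 k0 :: 'n
  defines "T \<equiv> \<lambda>H::complex^'n^'n. (\<chi> i j. if i = i0 \<and> j = k0 then - H $ i $ j else H $ i $ j)"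
  assumes cont: "continuous_on UNIV F" and odd: "\<And>H. F (T H) = - F H"
  shows "(\<integral>H. exp (- wnorm c H) *\<^sub>R F H \<partial>lborel) = 0"
proof -
  have lin: "linear T"
    by (intro linearI) (auto simp: T_def vec_eq_iff)
  have norm: "norm (T H) = norm H" for H
  proof -
    have "(norm (T H))\<^sup>2 = (norm H)\<^sup>2"
      unfolding norm_mat_square by (intro sum.cong refl) (simp add: T_def)
    then show ?thesis by simp
  qed
  have w: "wnorm c (T H) = wnorm c H" for H
    unfolding wnorm_def by (intro sum.cong refl) (simp add: T_def)
  have [measurable]: "F \<in> borel_measurable borel" "T \<in> borel_measurable borel"
    using cont borel_measurable_linear[OF lin] by (auto intro!: borel_measurable_continuous_onI)
  let ?I = "\<integral>H. exp (- wnorm c H) *\<^sub>R F H \<partial>lborel"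
  have "?I = (\<integral>H. exp (- wnorm c H) *\<^sub>R F H \<partial>distr lborel borel T)"
    by (simp add: lborel_distr_isometry[OF lin norm])
  also have "\<dots> = (\<integral>H. exp (- wnorm c (T H)) *\<^sub>R F (T H) \<partial>lborel)"
    by (rule integral_distr) auto
  also have "\<dots> = - ?I" by (simp add: w odd)
  finally show ?thesis by simp
qed

section \<open>The Gaussian average of a determinant\<close>

text \<open>Expanding each entry of \<open>w I + H\<^sup>* D H\<close> into its shift (\<open>None\<close>) and its \<open>n\<close> products (\<open>Some i\<close>), the determinant
  becomes a sum over maps \<open>\<phi>\<close> from columns to options. Non-injective \<open>\<phi>\<close> cancel by antisymmetry; in the
  remaining terms only the identity permutation survives averaging.\<close>

definition inj_some :: "'m set \<Rightarrow> ('m \<Rightarrow> 'i option) \<Rightarrow> bool" where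
  "inj_some J \<phi> \<longleftrightarrow> (\<forall>m\<in>J. \<forall>l\<in>J. m \<noteq> l \<longrightarrow> \<phi> m = \<phi> l \<longrightarrow> \<phi> m = None)"

definition leib :: "('n \<Rightarrow> real) \<Rightarrow> real \<Rightarrow> complex^'n^'n \<Rightarrow> 'n option \<Rightarrow> 'n \<Rightarrow> 'n \<Rightarrow> complex" where
  "leib a w H s m q = (case s of None \<Rightarrow> if m = q then of_real w else 0
      | Some i \<Rightarrow> of_real (a i) * cnj (H $ i $ m) * H $ i $ q)"

lemma det_swap_rows_zero:
  fixes r :: "'n::finite \<Rightarrow> complex"
  assumes "k \<noteq> l" "\<And>q. y k q = \<alpha> * r q" "\<And>q. y l q = \<beta> * r q"
  shows "det (\<chi> m q. y m q) = 0"
proof -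
  let ?A = "\<chi> m. if m = k then (\<chi> q. r q) else if m = l then (\<chi> q. r q) else (\<chi> q. y m q)"
  have "det (\<chi> m q. y m q) = det (\<chi> m. if m = k then \<alpha> *s (\<chi> q. r q) else (\<chi> q. y m q))"
    by (rule arg_cong[of _ _ det]) (auto simp: vec_eq_iff assms)
  also have "\<dots> = \<alpha> * det (\<chi> m. if m = k then (\<chi> q. r q) else (\<chi> q. y m q))"
    by (rule det_row_mul)
  also have "det (\<chi> m. if m = k then (\<chi> q. r q) else (\<chi> q. y m q))
      = det (\<chi> m. if m = l then \<beta> *s (\<chi> q. r q) else if m = k then (\<chi> q. r q) else (\<chi> q. y m q))"
    using assms(1) by (intro arg_cong[of _ _ det]) (auto simp: vec_eq_iff assms assms(1)[symmetric])
  also have "\<dots> = \<beta> * det (\<chi> m. if m = l then (\<chi> q. r q) else if m = k then (\<chi> q. r q) else (\<chi> q. y m q))"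
    by (rule det_row_mul)
  also have "det (\<chi> m. if m = l then (\<chi> q. r q) else if m = k then (\<chi> q. r q) else (\<chi> q. y m q)) = 0"
    by (rule det_identical_rows[OF assms(1)]) (simp add: row_def vec_eq_iff)
  finally show ?thesis by simp
qed

lemma sum_UNIV_option: "(\<Sum>s\<in>(UNIV::'n::finite option set). g s) = g None + (\<Sum>i\<in>UNIV. g (Some i))"
  by (simp add: UNIV_option_conv sum.reindex)

lemma det_leibniz_option:
  fixes a :: "'n::finite \<Rightarrow> real"
  shows "det (mat (of_real w) + cadj H ** cdiag a ** H)
    = (\<Sum>\<phi>\<in>UNIV. det (\<chi> m q. leib a w H (\<phi> m) m q))"
proof -
  have ent: "(mat (of_real w) + cadj H ** cdiag a ** H) $ m $ q
      = (\<Sum>s\<in>UNIV. leib a w H s m q)" for m q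
    by (simp add: sum_UNIV_option leib_def mat_def matrix_matrix_mult_def diag_mat_def
        if_distrib if_distribR mult_ac cong: if_cong)
  have "det (mat (of_real w) + cadj H ** cdiag a ** H)
    = (\<Sum>p | p permutes UNIV. of_int (sign p) * (\<Prod>m\<in>UNIV. \<Sum>s\<in>UNIV. leib a w H s m (p m)))"
    by (simp only: det_def ent)
  also have "\<dots> = (\<Sum>p | p permutes UNIV. \<Sum>\<phi>\<in>UNIV. of_int (sign p) * (\<Prod>m\<in>UNIV. leib a w H (\<phi> m) m (p m)))"
    by (simp add: prod_sum_PiE PiE_UNIV_domain sum_distrib_left)
  also have "\<dots> = (\<Sum>\<phi>\<in>UNIV. det (\<chi> m q. leib a w H (\<phi> m) m q))"
    by (subst sum.swap) (simp add: det_def)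
  finally show ?thesis .
qed

text \<open>Two columns choosing the same index i produce two rows that are both multiples of row i
  of \<open>H\<close>.\<close>

lemma det_leib_not_inj:
  assumes "\<not> inj_some UNIV \<phi>"
  shows "det (\<chi> m q. leib a w H (\<phi> m) m q) = 0"
proof -
  obtain k l i where kl: "k \<noteq> l" "\<phi> k = Some i" "\<phi> l = Some i"
    using assms by (auto simp: inj_some_def)
  show ?thesis
    by (rule det_swap_rows_zero[where r = "\<lambda>q. H $ i $ q" and k = k and l = l]) (auto simp: kl leib_def)
qed

lemma leib_prod_bound:
  fixes a :: "'n::finite \<Rightarrow> real"
  shows "\<exists>K. \<forall>H. norm (\<Prod>m\<in>UNIV. leib a w H (\<phi> m) m (p m)) \<le> K * (1 + (norm H)\<^sup>2) ^ CARD('n)"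
proof -
  define k where "k m = (case \<phi> m of None \<Rightarrow> \<bar>w\<bar> | Some i \<Rightarrow> \<bar>a i\<bar>)" for m
  have "norm (\<Prod>m\<in>UNIV. leib a w H (\<phi> m) m (p m)) \<le> (\<Prod>m\<in>UNIV. k m) * (1 + (norm H)\<^sup>2) ^ CARD('n)" for H
  proof -
    have e: "norm (H $ i $ j) \<le> norm H" for i j
      using Finite_Cartesian_Product.norm_nth_le[of "H $ i" j] Finite_Cartesian_Product.norm_nth_le[of H i] by linarith
    have "norm (\<Prod>m\<in>UNIV. leib a w H (\<phi> m) m (p m)) = (\<Prod>m\<in>UNIV. norm (leib a w H (\<phi> m) m (p m)))"
      by (simp add: prod_norm)
    also have "\<dots> \<le> (\<Prod>m\<in>UNIV. k m * (1 + (norm H)\<^sup>2))"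
    proof (intro prod_mono conjI)
      fix m
      show "norm (leib a w H (\<phi> m) m (p m)) \<le> k m * (1 + (norm H)\<^sup>2)"
      proof (cases "\<phi> m")
        case None
        then show ?thesis by (auto simp: leib_def k_def mult_le_cancel_left1 intro: order_trans)
      next
        case (Some i)
        have "norm (H $ i $ m) * norm (H $ i $ p m) \<le> norm H * norm H"
          by (intro mult_mono e) auto
        also have "\<dots> \<le> 1 + (norm H)\<^sup>2" by (simp add: power2_eq_square)
        finally show ?thesis by (auto simp: leib_def k_def Some norm_mult mult.assoc intro: mult_left_mono)
      qed
    qed auto
    finally show ?thesis by (simp add: prod.distrib)
  qed
  then show ?thesis by blast
qed

lemma continuous_leib_prod: "continuous_on S (\<lambda>H. \<Prod>m\<in>UNIV. leib a w H (\<phi> m) m (p m))"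
proof -
  have "continuous_on S (\<lambda>H. leib a w H (\<phi> m) m (p m))" for m
    unfolding leib_def by (cases "\<phi> m") (auto intro!: continuous_intros)
  then show ?thesis by (intro continuous_intros)
qed

lemma integrable_leib_prod:
  fixes a :: "'n::finite \<Rightarrow> real"
  assumes c: "\<And>i j. c i j \<ge> 1"
  shows "integrable lborel (\<lambda>H. exp (- wnorm c H) *\<^sub>R (\<Prod>m\<in>UNIV. leib a w H (\<phi> m) m (p m)))"
proof -
  obtain K where "\<And>H. norm (\<Prod>m\<in>UNIV. leib a w H (\<phi> m) m (p m)) \<le> K * (1 + (norm H)\<^sup>2) ^ CARD('n)"
    using leib_prod_bound by metis
  from integrable_gaussian_poly_bound[OF c continuous_leib_prod this] show ?thesis .
qed

text \<open>Let p move k. If k takes the shift, its factor is an off-diagonal entry of a scalar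
  matrix, hence 0. If k takes row i, injectivity keeps row i out of all other factors, and p k
  differs from k, so the entry (i, k) occurs exactly once and the product is odd in it.\<close>

lemma integral_leib_prod_not_id:
  fixes a :: "'n::finite \<Rightarrow> real"
  assumes inj: "inj_some UNIV \<phi>" and p: "p \<noteq> id"
  shows "(\<integral>H. exp (- wnorm c H) *\<^sub>R (\<Prod>m\<in>UNIV. leib a w H (\<phi> m) m (p m)) \<partial>lborel) = 0"
proof -
  obtain k where k: "p k \<noteq> k" using p by (auto simp: fun_eq_iff)
  show ?thesis
  proof (cases "\<phi> k")
    case None
    then have "leib a w H (\<phi> k) k (p k) = 0" for H using k by (auto simp: leib_def)
    then have z: "(\<Prod>m\<in>UNIV. leib a w H (\<phi> m) m (p m)) = 0" for H by (intro prod_zero) auto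
    show ?thesis by (simp only: z) simp
  next
    case (Some i)
    let ?T = "\<lambda>H::complex^'n^'n. (\<chi> i' j. if i' = i \<and> j = k then - H $ i' $ j else H $ i' $ j)"
    have other: "leib a w (?T H) (\<phi> m) m (p m) = leib a w H (\<phi> m) m (p m)" if "m \<noteq> k" for m H
    proof -
      have "\<phi> m \<noteq> Some i" using inj that Some unfolding inj_some_def by (metis UNIV_I option.distinct(1))
      then show ?thesis by (cases "\<phi> m") (auto simp: leib_def)
    qed
    have flip: "leib a w (?T H) (\<phi> k) k (p k) = - leib a w H (\<phi> k) k (p k)" for H
      using k by (simp add: Some leib_def)
    have "(\<Prod>m\<in>UNIV. leib a w (?T H) (\<phi> m) m (p m)) = - (\<Prod>m\<in>UNIV. leib a w H (\<phi> m) m (p m))" for H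
      using other flip by (simp add: prod.remove[of UNIV k])
    then show ?thesis by (intro integral_gaussian_odd continuous_leib_prod)
  qed
qed

lemma integral_leib_prod_id:
  fixes a :: "'n::finite \<Rightarrow> real"
  assumes c: "\<And>i j. c i j \<ge> 1"
  shows "(\<integral>H. exp (- wnorm c H) *\<^sub>R (\<Prod>m\<in>UNIV. leib a w H (\<phi> m) m m) \<partial>lborel)
    = of_real ((\<Prod>i\<in>UNIV. \<Prod>j\<in>UNIV. pi / c i j) * (\<Prod>m\<in>UNIV. case \<phi> m of None \<Rightarrow> w | Some i \<Rightarrow> a i / c i m))"
proof -
  have cp: "c i j > 0" for i j using c[of i j] by simp
  let ?P = "\<lambda>i j. \<phi> j = Some i"
  let ?X = "\<lambda>H::complex^'n^'n. \<Prod>i\<in>UNIV. \<Prod>j\<in>UNIV. if ?P i j then (norm (H $ i $ j))\<^sup>2 else 1"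
  let ?k = "\<Prod>m\<in>UNIV. case \<phi> m of None \<Rightarrow> w | Some i \<Rightarrow> a i"
  \<comment> \<open>Each column marks at most one row, so the product over the rows collapses to a
    single factor.\<close>
  have sw: "(\<Prod>i\<in>UNIV. \<Prod>j\<in>UNIV. if ?P i j then g i j else 1) = (\<Prod>m\<in>UNIV. case \<phi> m of None \<Rightarrow> 1 | Some i \<Rightarrow> g i m)"
    for g :: "'n \<Rightarrow> 'n \<Rightarrow> real"
  proof (subst prod.swap, intro prod.cong refl)
    fix m
    show "(\<Prod>i\<in>UNIV. if \<phi> m = Some i then g i m else 1) = (case \<phi> m of None \<Rightarrow> 1 | Some i \<Rightarrow> g i m)"
      by (cases "\<phi> m") auto
  qed
  have eq: "(\<Prod>m\<in>UNIV. leib a w H (\<phi> m) m m) = of_real (?k * ?X H)" for H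
  proof -
    have "?k * ?X H = (\<Prod>m\<in>UNIV. case \<phi> m of None \<Rightarrow> w | Some i \<Rightarrow> a i * (norm (H $ i $ m))\<^sup>2)"
      unfolding sw by (subst prod.distrib[symmetric], intro prod.cong refl) (auto split: option.split)
    moreover have "leib a w H (\<phi> m) m m = of_real (case \<phi> m of None \<Rightarrow> w | Some i \<Rightarrow> a i * (norm (H $ i $ m))\<^sup>2)" for m
      by (auto simp: leib_def mult_ac complex_norm_square[unfolded of_real_power] split: option.split)
    ultimately show ?thesis by simp
  qed
  have "(\<integral>H. ?X H * exp (- wnorm c H) \<partial>lborel) = enn2real (\<integral>\<^sup>+H. ennreal (?X H * exp (- wnorm c H)) \<partial>lborel)"
    by (rule integral_eq_nn_integral) (auto intro!: AE_I2 prod_nonneg mult_nonneg_nonneg)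
  also have "\<dots> = (\<Prod>i\<in>UNIV. \<Prod>j\<in>UNIV. pi / c i j * (if ?P i j then 1 / c i j else 1))"
    by (subst nn_integral_gaussian_moment[OF cp], rule enn2real_ennreal)
      (use cp in \<open>auto intro!: prod_nonneg mult_nonneg_nonneg divide_nonneg_nonneg simp: less_imp_le\<close>)
  also have "\<dots> = (\<Prod>i\<in>UNIV. \<Prod>j\<in>UNIV. pi / c i j) * (\<Prod>m\<in>UNIV. case \<phi> m of None \<Rightarrow> 1 | Some i \<Rightarrow> 1 / c i m)"
    by (simp only: prod.distrib sw)
  finally have I: "(\<integral>H. ?X H * exp (- wnorm c H) \<partial>lborel)
    = (\<Prod>i\<in>UNIV. \<Prod>j\<in>UNIV. pi / c i j) * (\<Prod>m\<in>UNIV. case \<phi> m of None \<Rightarrow> 1 | Some i \<Rightarrow> 1 / c i m)" .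
  have "(\<integral>H. exp (- wnorm c H) *\<^sub>R (\<Prod>m\<in>UNIV. leib a w H (\<phi> m) m m) \<partial>lborel)
      = (\<integral>H. complex_of_real (?k * (?X H * exp (- wnorm c H))) \<partial>lborel)"
    unfolding eq by (simp add: scaleR_conv_of_real mult_ac)
  also have "\<dots> = of_real (?k * (\<integral>H. ?X H * exp (- wnorm c H) \<partial>lborel))"
    by (simp only: integral_complex_of_real integral_mult_right_zero)
  also have "?k * (\<integral>H. ?X H * exp (- wnorm c H) \<partial>lborel) = (\<Prod>i\<in>UNIV. \<Prod>j\<in>UNIV. pi / c i j) *
      (?k * (\<Prod>m\<in>UNIV. case \<phi> m of None \<Rightarrow> 1 | Some i \<Rightarrow> 1 / c i m))"
    by (simp add: I)
  also have "?k * (\<Prod>m\<in>UNIV. case \<phi> m of None \<Rightarrow> 1 | Some i \<Rightarrow> 1 / c i m)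
      = (\<Prod>m\<in>UNIV. case \<phi> m of None \<Rightarrow> w | Some i \<Rightarrow> a i / c i m)"
    by (subst prod.distrib[symmetric], intro prod.cong refl) (auto split: option.split)
  finally show ?thesis .
qed

text \<open>Only the identity permutation contributes, so all signs are gone and a weighted count of
  partial injections remains, to be evaluated by recursion over columns.\<close>

theorem integral_gaussian_det:
  fixes a :: "'n::finite \<Rightarrow> real"
  assumes c: "\<And>i j. c i j \<ge> 1"
  shows "has_bochner_integral lborel
    (\<lambda>H. exp (- wnorm c H) *\<^sub>R det (mat (of_real w) + cadj H ** cdiag a ** H))
    (of_real ((\<Prod>i\<in>UNIV. \<Prod>j\<in>UNIV. pi / c i j) *
      (\<Sum>\<phi> | inj_some UNIV \<phi>. \<Prod>m\<in>UNIV. case \<phi> m of None \<Rightarrow> w | Some i \<Rightarrow> a i / c i m)))"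
proof -
  let ?Y = "\<lambda>\<phi> p H. \<Prod>m\<in>UNIV. leib a w H (\<phi> m) m (p m)"
  let ?G = "{\<phi>::'n \<Rightarrow> 'n option. inj_some UNIV \<phi>}" and ?P = "{p::'n \<Rightarrow> 'n. p permutes UNIV}"
  let ?k = "\<Prod>i\<in>UNIV. \<Prod>j\<in>UNIV. pi / c i j"
  let ?v = "\<lambda>\<phi>. \<Prod>m\<in>UNIV. case \<phi> m of None \<Rightarrow> w | Some i \<Rightarrow> a i / c i m"
  have exp: "exp (- wnorm c H) *\<^sub>R det (mat (of_real w) + cadj H ** cdiag a ** H)
      = (\<Sum>\<phi>\<in>?G. \<Sum>p\<in>?P. of_int (sign p) * (exp (- wnorm c H) *\<^sub>R ?Y \<phi> p H))" for H
  proof -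
    have "(\<Sum>\<phi>\<in>UNIV. det (\<chi> m q. leib a w H (\<phi> m) m q)) = (\<Sum>\<phi>\<in>?G. det (\<chi> m q. leib a w H (\<phi> m) m q))"
      by (rule sum.mono_neutral_right) (auto simp: det_leib_not_inj)
    then show ?thesis unfolding det_leibniz_option
      by (simp add: det_def scaleR_sum_right)
  qed
  have "has_bochner_integral lborel (\<lambda>H. of_int (sign p) * (exp (- wnorm c H) *\<^sub>R ?Y \<phi> p H))
      (if p = id then of_real (?k * ?v \<phi>) else 0)" if "\<phi> \<in> ?G" for \<phi> p
  proof -
    have "has_bochner_integral lborel (\<lambda>H. of_int (sign p) * (exp (- wnorm c H) *\<^sub>R ?Y \<phi> p H))
       (of_int (sign p) * (\<integral>H. exp (- wnorm c H) *\<^sub>R ?Y \<phi> p H \<partial>lborel))"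
      using integrable_leib_prod[OF c] by (intro has_bochner_integral_mult_right has_bochner_integral_integrable)
    moreover have "of_int (sign p) * (\<integral>H. exp (- wnorm c H) *\<^sub>R ?Y \<phi> p H \<partial>lborel) = (if p = id then of_real (?k * ?v \<phi>) else 0)"
    proof (cases "p = id")
      case True
      then show ?thesis using integral_leib_prod_id[where c = c and \<phi> = \<phi>, OF c] by (simp add: sign_id)
    qed (use integral_leib_prod_not_id that in auto)
    ultimately show ?thesis by simp
  qed
  then have "has_bochner_integral lborel
      (\<lambda>H. \<Sum>\<phi>\<in>?G. \<Sum>p\<in>?P. of_int (sign p) * (exp (- wnorm c H) *\<^sub>R ?Y \<phi> p H))
      (\<Sum>\<phi>\<in>?G. \<Sum>p\<in>?P. if p = id then of_real (?k * ?v \<phi>) else 0)"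
    by (intro has_bochner_integral_sum)
  also have "(\<Sum>\<phi>\<in>?G. \<Sum>p\<in>?P. if p = id then of_real (?k * ?v \<phi>) else 0) = of_real (?k * (\<Sum>\<phi>\<in>?G. ?v \<phi>))"
    by (simp add: permutes_id sum_distrib_left)
  finally show ?thesis unfolding exp .
qed

text \<open>The linear functional sending the monomial \<open>y^m\<close> to the \<open>m\<close>-th derivative of \<open>w^k\<close>.\<close>

definition umbral :: "real \<Rightarrow> nat \<Rightarrow> real poly \<Rightarrow> real" where
  "umbral w k p = (\<Sum>m\<le>k. coeff p m * (fact k / fact (k - m)) * w ^ (k - m))"

text \<open>The product rule D^m (w w^k) = w D^m w^k + m D^(m-1) w^k; the factor m together with the
  lowered order is what \<open>pderiv\<close> does to the coefficients.\<close>

lemma umbral_Suc: "umbral w (Suc k) p = w * umbral w k p + umbral w k (pderiv p)"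
proof -
  have "umbral w (Suc k) p = (\<Sum>m\<le>Suc k. coeff p m * ((real (Suc k - m) * fact k + real m * fact k) / fact (Suc k - m)) * w ^ (Suc k - m))"
    unfolding umbral_def
  proof (intro sum.cong refl)
    fix m assume "m \<in> {..Suc k}"
    then have "real (Suc k - m) + real m = real (Suc k)" by simp
    then have "real (Suc k - m) * fact k + real m * fact k = fact (Suc k)"
      by (metis distrib_right fact_Suc of_nat_fact of_nat_mult)
    then show "coeff p m * (fact (Suc k) / fact (Suc k - m)) * w ^ (Suc k - m)
      = coeff p m * ((real (Suc k - m) * fact k + real m * fact k) / fact (Suc k - m)) * w ^ (Suc k - m)"
      by simp
  qed
  also have "\<dots> = (\<Sum>m\<le>Suc k. coeff p m * (real (Suc k - m) * fact k / fact (Suc k - m)) * w ^ (Suc k - m))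
      + (\<Sum>m\<le>Suc k. coeff p m * (real m * fact k / fact (Suc k - m)) * w ^ (Suc k - m))"
    by (subst sum.distrib[symmetric], intro sum.cong refl) (simp only: add_divide_distrib distrib_left distrib_right)
  also have "(\<Sum>m\<le>Suc k. coeff p m * (real (Suc k - m) * fact k / fact (Suc k - m)) * w ^ (Suc k - m))
      = (\<Sum>m\<le>k. coeff p m * (real (Suc k - m) * fact k / fact (Suc k - m)) * w ^ (Suc k - m))"
    by simp
  also have "\<dots> = w * umbral w k p"
    unfolding umbral_def sum_distrib_left
    by (intro sum.cong refl) (simp add: Suc_diff_le field_simps del: of_nat_Suc)
  also have "(\<Sum>m\<le>Suc k. coeff p m * (real m * fact k / fact (Suc k - m)) * w ^ (Suc k - m)) = umbral w k (pderiv p)"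
    unfolding umbral_def by (subst sum.atMost_Suc_shift) (simp add: coeff_pderiv mult_ac)
  finally show ?thesis .
qed

lemma umbral_add: "umbral w k (p + q) = umbral w k p + umbral w k q"
  by (simp add: umbral_def sum.distrib[symmetric] add_divide_distrib algebra_simps)

lemma umbral_smult: "umbral w k (smult c p) = c * umbral w k p"
  by (simp add: umbral_def sum_distrib_left mult_ac)

lemma umbral_0: "umbral w k 0 = 0" by (simp add: umbral_def)

lemma umbral_sum: "umbral w k (\<Sum>i\<in>I. p i) = (\<Sum>i\<in>I. umbral w k (p i))"
  by (induction I rule: infinite_finite_induct) (auto simp: umbral_add umbral_0)

text \<open>D^(m+1) w^k = k D^m w^(k-1). For k = 0 both sides vanish, so the truncated subtraction
  is harmless.\<close>

lemma umbral_pCons_0: "umbral w k (pCons 0 p) = real k * umbral w (k - 1) p"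
proof (cases k)
  case (Suc l)
  show ?thesis unfolding Suc umbral_def
    by (subst sum.atMost_Suc_shift) (simp add: sum_distrib_left mult_ac algebra_simps)
qed (simp add: umbral_def)

text \<open>The generating polynomial of the elementary symmetric functions of the numbers
  \<open>a i\<close>, i in \<open>R\<close>.\<close>

definition epoly :: "('n \<Rightarrow> real) \<Rightarrow> 'n set \<Rightarrow> real poly" where
  "epoly a R = (\<Prod>i\<in>R. [:1, a i:])"

lemma pderiv_epoly:
  assumes "finite R"
  shows "pderiv (epoly a R) = (\<Sum>i\<in>R. smult (a i) (epoly a (R - {i})))"
  unfolding epoly_def pderiv_prod by (intro sum.cong refl) (simp add: pderiv_pCons)

lemma epoly_remove:
  assumes "finite R" "i \<in> R"
  shows "epoly a R = epoly a (R - {i}) + smult (a i) (pCons 0 (epoly a (R - {i})))"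
  using assms by (simp add: epoly_def prod.remove)

lemma poly_epoly: "poly (epoly a R) x = (\<Prod>i\<in>R. 1 + x * a i)"
  by (simp add: epoly_def poly_prod)

lemma degree_epoly: "degree (epoly a R) \<le> card R"
proof -
  have "degree (epoly a R) \<le> (\<Sum>i\<in>R. degree [:1, a i:])"
    unfolding epoly_def using degree_prod_sum_le[of R "\<lambda>i. [:1, a i:]"]
    by (cases "finite R") (simp_all add: o_def)
  also have "\<dots> \<le> (\<Sum>i\<in>R. 1)" by (intro sum_mono) simp
  finally show ?thesis by simp
qed

text \<open>\<open>J\<close> holds the columns still to be assigned and \<open>X\<close> the rows
  already taken; carrying \<open>X\<close> along is what permits a recursion that removes one column
  at a time.\<close>

definition inj_some_sum :: "('m \<Rightarrow> 'i option \<Rightarrow> real) \<Rightarrow> 'm set \<Rightarrow> 'i set \<Rightarrow> real" where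
  "inj_some_sum v J X = (\<Sum>\<phi>\<in>PiE J (\<lambda>_. UNIV).
     if inj_some J \<phi> \<and> (\<forall>m\<in>J. \<phi> m \<notin> Some ` X) then \<Prod>m\<in>J. v m (\<phi> m) else 0)"

text \<open>Column \<open>k\<close> either takes the shift, which may be repeated, or a free row i,
  which is then forbidden to the remaining columns.\<close>

lemma inj_some_sum_insert:
  fixes v :: "'m \<Rightarrow> 'i::finite option \<Rightarrow> real"
  assumes J: "finite J" "k \<notin> J"
  shows "inj_some_sum v (insert k J) X = v k None * inj_some_sum v J X + (\<Sum>i\<in>-X. v k (Some i) * inj_some_sum v J (insert i X))"
proof -
  let ?F = "PiE J (\<lambda>_. UNIV :: 'i option set)"
  let ?c = "\<lambda>J X \<phi>. inj_some J \<phi> \<and> (\<forall>m\<in>J. \<phi> m \<notin> Some ` X)"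
  have inj: "inj_on (\<lambda>(y, g). g(k := y)) (UNIV \<times> ?F)"
    using J(2) by (auto simp: inj_on_def fun_eq_iff PiE_def extensional_def split: if_splits)
  have "inj_some_sum v (insert k J) X = (\<Sum>(y, g)\<in>UNIV \<times> ?F. if ?c (insert k J) X (g(k := y))
      then \<Prod>m\<in>insert k J. v m ((g(k := y)) m) else 0)"
    unfolding inj_some_sum_def PiE_insert_eq by (subst sum.reindex[OF inj]) (simp add: case_prod_unfold)
  also have "\<dots> = (\<Sum>y\<in>UNIV. \<Sum>g\<in>?F. if ?c (insert k J) X (g(k := y))
      then \<Prod>m\<in>insert k J. v m ((g(k := y)) m) else 0)"
    by (simp add: sum.cartesian_product)
  also have "\<dots> = (\<Sum>y\<in>UNIV. \<Sum>g\<in>?F. if ?c (insert k J) X (g(k := y))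
      then v k y * (\<Prod>m\<in>J. v m (g m)) else 0)"
  proof (intro sum.cong refl)
    fix y g
    have "(\<Prod>m\<in>J. v m (if m = k then y else g m)) = (\<Prod>m\<in>J. v m (g m))"
      using J by (intro prod.cong) auto
    then show "(if ?c (insert k J) X (g(k := y)) then \<Prod>m\<in>insert k J. v m ((g(k := y)) m) else 0)
      = (if ?c (insert k J) X (g(k := y)) then v k y * (\<Prod>m\<in>J. v m (g m)) else 0)"
      using J by simp
  qed
  also have "\<dots> = (\<Sum>g\<in>?F. if ?c (insert k J) X (g(k := None)) then v k None * (\<Prod>m\<in>J. v m (g m)) else 0)
    + (\<Sum>i\<in>UNIV. \<Sum>g\<in>?F. if ?c (insert k J) X (g(k := Some i)) then v k (Some i) * (\<Prod>m\<in>J. v m (g m)) else 0)"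
    by (simp add: sum_UNIV_option)
  also have "(\<Sum>g\<in>?F. if ?c (insert k J) X (g(k := None)) then v k None * (\<Prod>m\<in>J. v m (g m)) else 0) = v k None * inj_some_sum v J X"
  proof -
    have "?c (insert k J) X (g(k := None)) \<longleftrightarrow> ?c J X g" for g
      using J(2) by (auto simp: inj_some_def)
    then show ?thesis unfolding inj_some_sum_def sum_distrib_left by (intro sum.cong) auto
  qed
  also have "(\<Sum>i\<in>UNIV. \<Sum>g\<in>?F. if ?c (insert k J) X (g(k := Some i)) then v k (Some i) * (\<Prod>m\<in>J. v m (g m)) else 0)
      = (\<Sum>i\<in>UNIV. if i \<in> X then 0 else v k (Some i) * inj_some_sum v J (insert i X))"
  proof (intro sum.cong refl)
    fix i
    have "?c (insert k J) X (g(k := Some i)) \<longleftrightarrow> i \<notin> X \<and> ?c J (insert i X) g" for g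
      using J(2) by (auto simp: inj_some_def image_iff)
    then show "(\<Sum>g\<in>?F. if ?c (insert k J) X (g(k := Some i)) then v k (Some i) * (\<Prod>m\<in>J. v m (g m)) else 0)
        = (if i \<in> X then 0 else v k (Some i) * inj_some_sum v J (insert i X))"
      unfolding inj_some_sum_def sum_distrib_left by (auto intro!: sum.cong sum.neutral)
  qed
  also have "\<dots> = (\<Sum>i\<in>-X. v k (Some i) * inj_some_sum v J (insert i X))"
    by (intro sum.mono_neutral_cong_right) auto
  finally show ?thesis .
qed

text \<open>With weights independent of the column, choosing m of k columns and rows for them
  injectively gives k! / (k-m)! times the m-th elementary symmetric function times w^(k-m). The
  proof matches recursions: using up one row acts on the generating polynomial as
  \<open>pderiv\<close>.\<close>

lemma inj_some_sum_const:
  fixes a :: "'i::finite \<Rightarrow> real"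
  assumes "finite J" "\<And>m. m \<in> J \<Longrightarrow> v m = (\<lambda>s. case s of None \<Rightarrow> w | Some i \<Rightarrow> a i)"
  shows "inj_some_sum v J X = umbral w (card J) (epoly a (- X))"
  using assms
proof (induction J arbitrary: X rule: finite_induct)
  case empty
  then show ?case by (simp add: inj_some_sum_def inj_some_def umbral_def coeff_0_prod_list epoly_def poly_prod flip: poly_0_coeff_0)
next
  case (insert k J)
  have "pderiv (epoly a (- X)) = (\<Sum>i\<in>-X. smult (a i) (epoly a (- insert i X)))"
    by (subst pderiv_epoly) (auto intro!: sum.cong arg_cong[of _ _ "epoly a"] arg_cong2[of _ _ _ _ smult])
  then show ?case using insert
    by (simp add: inj_some_sum_insert umbral_Suc umbral_sum umbral_smult)
qed

text \<open>Only column \<open>k\<close> has its own weights, the situation after rotating the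
  vector onto an axis. Peeling off that column leaves constant weights for the others.\<close>

lemma sum_inj_some:
  fixes a b :: "'n::finite \<Rightarrow> real" and k :: 'n
  assumes v: "\<And>m. v m = (\<lambda>s. case s of None \<Rightarrow> w | Some i \<Rightarrow> if m = k then b i else a i)"
  shows "(\<Sum>\<phi> | inj_some UNIV \<phi>. \<Prod>m\<in>UNIV. v m (\<phi> m))
    = w * umbral w (CARD('n) - 1) (epoly a UNIV) + (\<Sum>i\<in>UNIV. b i * umbral w (CARD('n) - 1) (epoly a (- {i})))"
proof -
  have rest: "inj_some_sum v (-{k}) X = umbral w (CARD('n) - 1) (epoly a (- X))" for X
    by (subst inj_some_sum_const[of _ v w a]) (auto simp: v Compl_eq_Diff_UNIV card_Diff_singleton fun_eq_iff split: option.split)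
  have "(\<Sum>\<phi> | inj_some UNIV \<phi>. \<Prod>m\<in>UNIV. v m (\<phi> m)) = inj_some_sum v UNIV {}"
    unfolding inj_some_sum_def PiE_UNIV_domain by (rule sum.mono_neutral_cong_left) auto
  also have "\<dots> = inj_some_sum v (insert k (- {k})) {}"
    by (rule arg_cong[of _ _ "\<lambda>J. inj_some_sum v J {}"]) auto
  also have "\<dots> = v k None * inj_some_sum v (-{k}) {} + (\<Sum>i\<in>UNIV. v k (Some i) * inj_some_sum v (-{k}) {i})"
    by (subst inj_some_sum_insert) auto
  finally show ?thesis by (simp only: rest) (simp add: v)
qed

section \<open>A telescoping identity\<close>

text \<open>The degree-\<open>d\<close> part, in a formal variable \<open>y\<close>, of \<open>exp (w * y) * p y\<close>, evaluated at \<open>y = r\<close>.\<close>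

definition exp_part :: "real \<Rightarrow> real \<Rightarrow> nat \<Rightarrow> real poly \<Rightarrow> real" where
  "exp_part w r d p = r ^ d / fact d * umbral w d p"

lemma exp_part_eq: "exp_part w r d p = (\<Sum>m\<le>d. coeff p m * r ^ m * ((w * r) ^ (d - m) / fact (d - m)))"
  unfolding exp_part_def umbral_def sum_distrib_left
proof (intro sum.cong refl)
  fix m assume "m \<in> {..d}"
  then have "r ^ d = r ^ m * r ^ (d - m)" by (simp flip: power_add)
  then show "r ^ d / fact d * (coeff p m * (fact d / fact (d - m)) * w ^ (d - m))
      = coeff p m * r ^ m * ((w * r) ^ (d - m) / fact (d - m))"
    by (simp add: power_mult_distrib)
qed

text \<open>The derivative of exp (w y) p(y) is w exp (w y) p(y) + exp (w y) p'(y), and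
  differentiation lowers the degree of each homogeneous part by one.\<close>

lemma has_real_derivative_exp_part:
  "((\<lambda>r. exp_part w r (Suc d) p) has_real_derivative (w * exp_part w r d p + exp_part w r d (pderiv p))) (at r)"
proof -
  have "((\<lambda>r. r ^ Suc d / fact (Suc d) * umbral w (Suc d) p) has_real_derivative
      (real (Suc d) * r ^ (Suc d - Suc 0)) / fact (Suc d) * umbral w (Suc d) p) (at r)"
    by (intro DERIV_cmult_right DERIV_cdivide DERIV_pow)
  moreover have "(real (Suc d) * r ^ (Suc d - Suc 0)) / fact (Suc d) * umbral w (Suc d) p
      = w * exp_part w r d p + exp_part w r d (pderiv p)"
    by (simp add: exp_part_def umbral_Suc field_simps del: of_nat_Suc)
  ultimately show ?thesis by (simp only: exp_part_def)
qed

lemma exp_part_0: "exp_part w r 0 p = coeff p 0" by (simp add: exp_part_def umbral_def)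

lemma has_real_derivative_sum_exp_part:
  "((\<lambda>r. \<Sum>d<Suc N. exp_part w r d p) has_real_derivative
    (\<Sum>d<N. w * exp_part w r d p + exp_part w r d (pderiv p))) (at r)"
proof -
  have "(\<lambda>r. \<Sum>d<Suc N. exp_part w r d p) = (\<lambda>r. coeff p 0 + (\<Sum>d<N. exp_part w r (Suc d) p))"
    by (simp add: sum.lessThan_Suc_shift exp_part_0 del: sum.lessThan_Suc)
  moreover have "((\<lambda>r. coeff p 0 + (\<Sum>d<N. exp_part w r (Suc d) p)) has_real_derivative
     (0 + (\<Sum>d<N. w * exp_part w r d p + exp_part w r d (pderiv p)))) (at r)"
    by (intro DERIV_add DERIV_const DERIV_sum has_real_derivative_exp_part)
  ultimately show ?thesis by simp
qed

text \<open>Multiplication by 1 + a y commutes with truncation except at the boundary: the degree-N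
  part of exp (w y) p(y) remains, since its product with a y has degree N + 1 and is cut
  off.\<close>

lemma sum_exp_part_factor:
  "(\<Sum>d<Suc N. exp_part w r d (p + smult a (pCons 0 p))) = (1 + r * a) * (\<Sum>d<N. exp_part w r d p) + exp_part w r N p"
proof (induction N)
  case (Suc N)
  have "exp_part w r (Suc N) (p + smult a (pCons 0 p)) = exp_part w r (Suc N) p + r * a * exp_part w r N p"
    by (simp add: exp_part_def umbral_add umbral_smult umbral_pCons_0 field_simps del: of_nat_Suc)
  with Suc show ?case by (simp add: algebra_simps)
qed (simp add: exp_part_0)

text \<open>This is 1 / det (1 + r A) for A with eigenvalues \<open>a i\<close>: the Gaussian
  average of exp (- sum of a_i |(H x)_i|^2) for a vector x of squared norm r.\<close>

abbreviation char_inv :: "('n::finite \<Rightarrow> real) \<Rightarrow> real \<Rightarrow> real" where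
  "char_inv a r \<equiv> (\<Prod>i\<in>UNIV. inverse (1 + r * a i))"

text \<open>The expected resolvent trace at \<open>w\<close> turns out to be the integral of \<open>rtrans a w\<close> over the half line; the
  Gaussian computation yields it as the integral of \<open>- r * rtrans' r\<close>.\<close>

definition rtrans :: "('n::finite \<Rightarrow> real) \<Rightarrow> real \<Rightarrow> real \<Rightarrow> real" where
  "rtrans a w r = exp (- w * r) * char_inv a r * (\<Sum>d<CARD('n). exp_part w r d (epoly a UNIV))"

text \<open>The Gaussian average of det (w + W) exp (- sum of a_i |(H x)_i|^2) for |x|^2 = r. In the
  bracket, the distinguished column either takes the shift or takes row i, whose entry there has the
  reduced second moment 1 / (1 + r a_i).\<close>

definition det_avg :: "('n::finite \<Rightarrow> real) \<Rightarrow> real \<Rightarrow> real \<Rightarrow> real" where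
  "det_avg a w r = char_inv a r * (w * umbral w (CARD('n) - 1) (epoly a UNIV)
     + (\<Sum>i\<in>UNIV. a i / (1 + r * a i) * umbral w (CARD('n) - 1) (epoly a (- {i}))))"

text \<open>\<open>rtrans\<close> is the truncation of exp (w r) prod (1 + r a_i) to degrees below
  n, divided by the full product. Without truncation it would be constant, so its derivative reduces
  to boundary terms of degree n - 1, and these form \<open>det_avg\<close>.\<close>

lemma has_real_derivative_rtrans:
  fixes a :: "'n::finite \<Rightarrow> real"
  assumes a: "\<And>i. 0 < a i" and r: "0 \<le> r"
  shows "(rtrans a w has_real_derivative
     - (exp (- w * r) * (r ^ (CARD('n) - 1) / fact (CARD('n) - 1)) * det_avg a w r)) (at r)"
proof -
  obtain N where N: "CARD('n) = Suc N" by (metis card_gt_0_iff finite UNIV_not_empty gr0_implies_Suc)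
  have pos: "0 < 1 + r * a i" for i using a r by (simp add: add_pos_nonneg less_imp_le)
  let ?H = "\<lambda>r. \<Prod>i\<in>UNIV. inverse (1 + r * a i)"
  let ?q = "\<lambda>r. \<Sum>d<Suc N. exp_part w r d (epoly a UNIV)"
  let ?q' = "\<Sum>d<N. w * exp_part w r d (epoly a UNIV) + exp_part w r d (pderiv (epoly a UNIV))"
  let ?s = "\<Sum>i\<in>UNIV. a i / (1 + r * a i)"
  have DH: "(?H has_real_derivative - ?H r * ?s) (at r)"
  proof -
    have "(?H has_real_derivative (\<Sum>i\<in>UNIV. (- (a i) / (1 + r * a i)\<^sup>2) * (\<Prod>j\<in>UNIV - {i}. inverse (1 + r * a j)))) (at r)"
    proof (rule has_field_derivative_prod)
      fix i
      show "((\<lambda>r. inverse (1 + r * a i)) has_real_derivative - a i / (1 + r * a i)\<^sup>2) (at r)"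
        using pos[of i] by (auto intro!: derivative_eq_intros simp: power2_eq_square field_simps)
    qed
    also have "(\<Sum>i\<in>UNIV. (- (a i) / (1 + r * a i)\<^sup>2) * (\<Prod>j\<in>UNIV - {i}. inverse (1 + r * a j))) = - ?H r * ?s"
      unfolding sum_distrib_left
    proof (intro sum.cong refl)
      fix i
      show "(- (a i) / (1 + r * a i)\<^sup>2) * (\<Prod>j\<in>UNIV - {i}. inverse (1 + r * a j)) = - ?H r * (a i / (1 + r * a i))"
        using pos[of i] by (subst prod.remove[of UNIV i]) (auto simp: power2_eq_square field_simps)
    qed
    finally show ?thesis .
  qed
  have DE: "((\<lambda>r. exp (- w * r)) has_real_derivative - w * exp (- w * r)) (at r)"
    by (auto intro!: derivative_eq_intros)
  have D: "((\<lambda>r. exp (- w * r) * ?H r * ?q r) has_real_derivative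
     (- w * exp (- w * r) * ?H r + - ?H r * ?s * exp (- w * r)) * ?q r + ?q' * (exp (- w * r) * ?H r)) (at r)"
    by (intro DERIV_mult DE DH has_real_derivative_sum_exp_part)
  have "epoly a UNIV = epoly a (- {i}) + smult (a i) (pCons 0 (epoly a (- {i})))" for i
    using epoly_remove[of UNIV i a] by (simp add: Compl_eq_Diff_UNIV)
  \<comment> \<open>A separate splitting for every i, so that the denominator 1 + r a_i in the
    logarithmic derivative cancels.\<close>
  then have q: "?q r = (1 + r * a i) * (\<Sum>d<N. exp_part w r d (epoly a (- {i}))) + exp_part w r N (epoly a (- {i}))" for i
    using sum_exp_part_factor[where N = N and w = w and r = r and p = "epoly a (- {i})" and a = "a i"] by simp
  have "w * ?q r + ?s * ?q r - ?q' = w * exp_part w r N (epoly a UNIV)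
      + (\<Sum>i\<in>UNIV. a i / (1 + r * a i) * exp_part w r N (epoly a (- {i})))"
  proof -
    have "?q' = w * (\<Sum>d<N. exp_part w r d (epoly a UNIV)) + (\<Sum>d<N. \<Sum>i\<in>UNIV. a i * exp_part w r d (epoly a (- {i})))"
      by (simp add: sum.distrib sum_distrib_left pderiv_epoly Compl_eq_Diff_UNIV exp_part_def umbral_sum umbral_smult mult_ac)
    also have "(\<Sum>d<N. \<Sum>i\<in>UNIV. a i * exp_part w r d (epoly a (- {i})))
        = (\<Sum>i\<in>UNIV. a i * (\<Sum>d<N. exp_part w r d (epoly a (- {i}))))"
      by (subst sum.swap) (simp add: sum_distrib_left)
    finally have q': "?q' = w * (\<Sum>d<N. exp_part w r d (epoly a UNIV)) + (\<Sum>i\<in>UNIV. a i * (\<Sum>d<N. exp_part w r d (epoly a (- {i}))))" .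
    have "?s * ?q r = (\<Sum>i\<in>UNIV. a i * (\<Sum>d<N. exp_part w r d (epoly a (- {i}))) + a i / (1 + r * a i) * exp_part w r N (epoly a (- {i})))"
      unfolding sum_distrib_right
    proof (intro sum.cong refl)
      fix i
      show "a i / (1 + r * a i) * ?q r = a i * (\<Sum>d<N. exp_part w r d (epoly a (- {i}))) + a i / (1 + r * a i) * exp_part w r N (epoly a (- {i}))"
        unfolding q[of i] using pos[of i] by (simp add: distrib_left)
    qed
    then show ?thesis unfolding q' by (simp add: sum.distrib algebra_simps)
  qed
  also have "\<dots> = r ^ N / fact N * (w * umbral w N (epoly a UNIV) + (\<Sum>i\<in>UNIV. a i / (1 + r * a i) * umbral w N (epoly a (- {i}))))"
    by (simp add: exp_part_def distrib_left sum_distrib_left mult_ac)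
  finally have key: "w * ?q r + ?s * ?q r - ?q' = r ^ N / fact N * (w * umbral w N (epoly a UNIV)
      + (\<Sum>i\<in>UNIV. a i / (1 + r * a i) * umbral w N (epoly a (- {i}))))" .
  have "(- w * exp (- w * r) * ?H r + - ?H r * ?s * exp (- w * r)) * ?q r + ?q' * (exp (- w * r) * ?H r)
     = - (exp (- w * r) * ?H r * (w * ?q r + ?s * ?q r - ?q'))" by (simp add: algebra_simps)
  also have "\<dots> = - (exp (- w * r) * (r ^ (CARD('n) - 1) / fact (CARD('n) - 1)) * det_avg a w r)"
    unfolding key det_avg_def by (simp add: N mult_ac)
  finally show ?thesis using D unfolding rtrans_def[abs_def] N by simp
qed

section \<open>The resolvent as a Gaussian integral\<close>

lemma unitary_mat_cadj: "unitary_mat U \<Longrightarrow> unitary_mat (cadj U)"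
  by (simp add: unitary_mat_def)

lemma unitary_cancel:
  assumes "unitary_mat U"
  shows "U ** (cadj U ** X) = X" "cadj U ** (U ** X) = X" "U ** cadj U = mat 1" "cadj U ** U = mat 1"
    "U *v (cadj U *v x) = x" "cadj U *v (U *v x) = x"
  using assms by (simp_all add: unitary_mat_def matrix_mul_assoc matrix_vector_mul_assoc)

lemma norm_unitary_vec: "unitary_mat U \<Longrightarrow> norm (U *v x) = norm (x :: complex^'n)"
  by (simp add: norm_eq_sqrt_inner inner_mult_cadj unitary_cancel)

lemma norm_cadj: "norm (cadj H) = norm (H :: complex^'n^'n)"
proof -
  have "(norm (cadj H))\<^sup>2 = (norm H)\<^sup>2"
    unfolding norm_mat_square by (subst sum.swap) simp
  then show ?thesis by simp
qed

lemma trace_cadj_mult: "trace (cadj H ** H) = complex_of_real ((norm (H :: complex^'n^'n))\<^sup>2)"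
  unfolding norm_mat_square trace_def
  by (subst sum.swap) (simp add: matrix_matrix_mult_def complex_norm_square[unfolded of_real_power] mult.commute)

lemma norm_unitary_mult:
  fixes H :: "complex^'n^'n"
  assumes "unitary_mat U"
  shows "norm (U ** H) = norm H" "norm (H ** U) = norm H"
proof -
  have left: "norm (V ** H) = norm H" if "unitary_mat V" for V and H :: "complex^'n^'n"
  proof -
    have "cadj (V ** H) ** (V ** H) = cadj H ** H"
      by (simp add: cadj_mul matrix_mul_assoc[symmetric] unitary_cancel that)
    from arg_cong[OF this, of trace]
    have "complex_of_real ((norm (V ** H))\<^sup>2) = complex_of_real ((norm H)\<^sup>2)"
      by (simp only: trace_cadj_mult)
    then show ?thesis by (simp only: of_real_eq_iff) simp
  qed
  show "norm (U ** H) = norm H" using left[OF assms] .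
  have "norm (H ** U) = norm (cadj U ** cadj H)" by (simp add: norm_cadj flip: cadj_mul)
  then show "norm (H ** U) = norm H" using left[OF unitary_mat_cadj[OF assms]] by (simp add: norm_cadj)
qed

lemma linear_mat_mult:
  fixes U :: "complex^'n^'n"
  shows "linear (\<lambda>H. U ** H)" "linear (\<lambda>H. H ** U)" "linear (\<lambda>x. U *v x)"
  by (auto intro!: linearI simp: vec_eq_iff matrix_matrix_mult_def matrix_vector_mult_def sum.distrib
      distrib_left distrib_right scaleR_sum_right)

lemma cprod_diag: "cprod x (cdiag b *v x) = of_real (\<Sum>i\<in>UNIV. b i * (norm (x $ i))\<^sup>2)"
  unfolding cprod_def
  by (simp add: diag_mat_def matrix_vector_mult_def if_distrib if_distribR complex_norm_square[unfolded of_real_power]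
      mult_ac cong: if_cong)

section \<open>The random quadratic form, its matrix and its diagonalisation\<close>

abbreviation qform :: "('n::finite \<Rightarrow> real) \<Rightarrow> complex^'n^'n \<Rightarrow> complex^'n \<Rightarrow> real" where
  "qform a H x \<equiv> (\<Sum>i\<in>UNIV. a i * (norm ((H *v x) $ i))\<^sup>2)"

definition gram :: "('n \<Rightarrow> real) \<Rightarrow> complex^'n^'n \<Rightarrow> complex^'n^'n" where
  "gram a H = cadj H ** cdiag a ** H"

lemma cprod_gram: "cprod x (gram a H *v x) = of_real (qform a H x)"
proof -
  have "cprod x (gram a H *v x) = cprod (H *v x) (cdiag a *v (H *v x))"
    by (simp add: gram_def cprod_mult_cadj matrix_vector_mul_assoc matrix_mul_assoc)
  then show ?thesis by (simp only: cprod_diag)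
qed

lemma cadj_diag_real: "cadj (cdiag b) = cdiag b"
  by (auto simp: vec_eq_iff diag_mat_def)

lemma hermitian_gram: "hermitian_mat (gram a H)"
  by (simp add: hermitian_mat_def gram_def cadj_mul cadj_diag_real matrix_mul_assoc)

lemma gram_diagonalize:
  fixes a :: "'n::finite \<Rightarrow> real"
  assumes a: "\<And>i. 0 \<le> a i"
  obtains U b where "unitary_mat U" "gram a H = U ** cdiag b ** cadj U" "\<And>i. 0 \<le> b i"
    "\<And>y. qform a H (U *v y) = (\<Sum>i\<in>UNIV. b i * (norm (y $ i))\<^sup>2)"
proof -
  obtain U b where U: "unitary_mat U" and W: "gram a H = U ** cdiag b ** cadj U"
    by (rule hermitian_spectral[OF hermitian_gram[of a H]])
  have q: "qform a H (U *v y) = (\<Sum>i\<in>UNIV. b i * (norm (y $ i))\<^sup>2)" for y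
  proof -
    have "complex_of_real (qform a H (U *v y)) = cprod (U *v y) (gram a H *v (U *v y))"
      by (simp only: cprod_gram)
    also have "\<dots> = cprod y (cdiag b *v y)"
      using U by (simp add: W cprod_mult_cadj unitary_cancel flip: matrix_vector_mul_assoc)
    also have "\<dots> = of_real (\<Sum>i\<in>UNIV. b i * (norm (y $ i))\<^sup>2)" by (rule cprod_diag)
    finally show ?thesis by (simp only: of_real_eq_iff)
  qed
  have "0 \<le> b k" for k
  proof -
    have "0 \<le> (\<Sum>i\<in>UNIV. b i * (norm ((axis k 1 :: complex^'n) $ i))\<^sup>2)"
      unfolding q[symmetric] by (intro sum_nonneg mult_nonneg_nonneg a) auto
    also have "\<dots> = (\<Sum>i\<in>UNIV. if i = k then b i else 0)"
      by (intro sum.cong) (auto simp: axis_def)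
    finally show ?thesis by simp
  qed
  with U W q that show ?thesis by blast
qed

lemma trace_mat_fun:
  fixes U :: "complex^'n^'n"
  assumes "unitary_mat U" "B = U ** cdiag b ** cadj U"
  shows "trace (mat_fun f B) = of_real (\<Sum>i\<in>UNIV. f (b i))"
proof -
  have "trace (mat_fun f B) = trace (cadj U ** (U ** cdiag (\<lambda>i. f (b i))))"
    unfolding mat_fun_eq[OF assms, of f] by (rule trace_mul_sym)
  also have "\<dots> = trace (cdiag (\<lambda>i. f (b i)) :: complex^'n^'n)"
    using assms(1) by (simp add: unitary_cancel)
  finally show ?thesis by (simp add: trace_def diag_mat_def)
qed

lemma det_unitary_conj:
  assumes "unitary_mat U"
  shows "det (U ** X ** cadj U) = det (X :: complex^'n^'n)"
proof -
  have "det U * det (cadj U) = 1" using unitary_cancel(3)[OF assms] by (simp flip: det_mul add: det_I)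
  then show ?thesis by (simp add: det_mul)
qed

lemma mat_unitary_conj:
  assumes "unitary_mat U"
  shows "mat c + U ** X ** cadj U = U ** (mat c + X) ** cadj (U :: complex^'n^'n)"
proof -
  have "U ** mat c = mat c ** U"
    by (simp add: vec_eq_iff matrix_matrix_mult_def mat_def if_distrib if_distribR mult.commute cong: if_cong)
  then have "U ** mat c ** cadj U = mat c"
    using assms by (simp add: unitary_cancel flip: matrix_mul_assoc)
  moreover have "(X + Y) ** Z = X ** Z + Y ** Z" for X Y Z :: "complex^'n^'n"
    using linear_mat_mult(2)[of Z] by (rule linear_add)
  ultimately show ?thesis by (simp add: matrix_add_ldistrib)
qed

lemma det_shift_diagonalized:
  fixes U :: "complex^'n^'n"
  assumes "unitary_mat U" "B = U ** cdiag b ** cadj U"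
  shows "det (mat (of_real w) + B) = of_real (\<Prod>i\<in>UNIV. w + b i)"
proof -
  have "det (mat (of_real w) + B) = det (mat (of_real w) + cdiag b :: complex^'n^'n)"
    using assms by (simp add: mat_unitary_conj det_unitary_conj)
  also have "\<dots> = (\<Prod>i\<in>UNIV. of_real w + of_real (b i))"
    by (subst det_diagonal) (auto simp: mat_def diag_mat_def)
  finally show ?thesis by simp
qed

lemma Re_det_gram_nonneg:
  fixes a :: "'n::finite \<Rightarrow> real"
  assumes "\<And>i. 0 \<le> a i" "0 \<le> w"
  shows "0 \<le> Re (det (mat (of_real w) + gram a H))"
proof -
  obtain U b where "unitary_mat U" "gram a H = U ** cdiag b ** cadj U" "\<And>i. 0 \<le> b i"
    by (rule gram_diagonalize[where a = a and H = H, OF assms(1)]) blast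
  then show ?thesis using assms(2) by (simp add: det_shift_diagonalized prod_nonneg del: of_real_prod of_real_add)
qed

text \<open>The factor |y|^2 is a sum over coordinates; each summand factorises and contributes one
  extra 1 / b k. This extra sum becomes the resolvent trace, while the product is the reciprocal
  determinant up to powers of pi.\<close>

lemma nn_integral_gaussian_quadratic:
  fixes b :: "'n::finite \<Rightarrow> real"
  assumes b: "\<And>i. 0 < b i"
  shows "(\<integral>\<^sup>+y. ennreal ((norm y)\<^sup>2 * exp (- (\<Sum>i\<in>UNIV. b i * (norm (y $ i))\<^sup>2))) \<partial>(lborel :: (complex^'n) measure))
    = ennreal ((\<Prod>i\<in>UNIV. pi / b i) * (\<Sum>k\<in>UNIV. 1 / b k))"
proof -
  let ?g = "\<lambda>k i (z::complex). (if i = k then (norm z)\<^sup>2 else 1) * exp (- b i * (norm z)\<^sup>2)"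
  have n2: "(norm y)\<^sup>2 = (\<Sum>k\<in>UNIV. (norm (y $ k))\<^sup>2)" for y :: "complex^'n"
    by (simp add: norm_vec_def L2_set_def sum_nonneg)
  have g: "(norm (y $ k))\<^sup>2 * exp (- (\<Sum>i\<in>UNIV. b i * (norm (y $ i))\<^sup>2)) = (\<Prod>i\<in>UNIV. ?g k i (y $ i))" for y :: "complex^'n" and k
  proof -
    have "exp (- (\<Sum>i\<in>UNIV. b i * (norm (y $ i))\<^sup>2)) = (\<Prod>i\<in>UNIV. exp (- b i * (norm (y $ i))\<^sup>2))"
      by (simp add: sum_negf[symmetric] exp_sum)
    moreover have "(\<Prod>i\<in>UNIV. if i = k then (norm (y $ i))\<^sup>2 else 1) = (norm (y $ k))\<^sup>2" by simp
    ultimately show ?thesis by (simp only: prod.distrib)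
  qed
  have "(\<integral>\<^sup>+y. ennreal ((norm y)\<^sup>2 * exp (- (\<Sum>i\<in>UNIV. b i * (norm (y $ i))\<^sup>2))) \<partial>(lborel :: (complex^'n) measure))
      = (\<integral>\<^sup>+y. (\<Sum>k\<in>UNIV. \<Prod>i\<in>UNIV. ennreal (?g k i (y $ i))) \<partial>(lborel :: (complex^'n) measure))"
  proof (rule nn_integral_cong)
    fix y :: "complex^'n"
    have "(norm y)\<^sup>2 * exp (- (\<Sum>i\<in>UNIV. b i * (norm (y $ i))\<^sup>2)) = (\<Sum>k\<in>UNIV. \<Prod>i\<in>UNIV. ?g k i (y $ i))"
      unfolding n2[of y] sum_distrib_right g ..
    also have "ennreal \<dots> = (\<Sum>k\<in>UNIV. \<Prod>i\<in>UNIV. ennreal (?g k i (y $ i)))"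
    proof -
      have p: "(\<Prod>i\<in>UNIV. ennreal (?g k i (y $ i))) = ennreal (\<Prod>i\<in>UNIV. ?g k i (y $ i))" for k
        by (rule prod_ennreal) simp
      show ?thesis unfolding p by (rule sum_ennreal[symmetric]) (rule prod_nonneg, simp)
    qed
    finally show "ennreal ((norm y)\<^sup>2 * exp (- (\<Sum>i\<in>UNIV. b i * (norm (y $ i))\<^sup>2)))
      = (\<Sum>k\<in>UNIV. \<Prod>i\<in>UNIV. ennreal (?g k i (y $ i)))" .
  qed
  also have "\<dots> = (\<Sum>k\<in>UNIV. \<integral>\<^sup>+y. (\<Prod>i\<in>UNIV. ennreal (?g k i (y $ i))) \<partial>(lborel :: (complex^'n) measure))"
    by (rule nn_integral_sum) measurable
  also have "\<dots> = (\<Sum>k\<in>UNIV. \<Prod>i\<in>UNIV. \<integral>\<^sup>+z. ennreal (?g k i z) \<partial>lborel)"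
    by (intro sum.cong refl nn_integral_lborel_vec_prod) measurable
  also have "\<dots> = (\<Sum>k\<in>UNIV. \<Prod>i\<in>UNIV. ennreal (pi / b i * (if i = k then 1 / b i else 1)))"
    using nn_integral_exp_norm_square_complex[OF b]
    by (intro sum.cong prod.cong refl) (simp add: power2_eq_square)
  also have "\<dots> = ennreal (\<Sum>k\<in>UNIV. \<Prod>i\<in>UNIV. pi / b i * (if i = k then 1 / b i else 1))"
  proof -
    have nn: "0 \<le> pi / b i * (if i = k then 1 / b i else 1)" for i k using b[of i] by simp
    have p: "(\<Prod>i\<in>UNIV. ennreal (pi / b i * (if i = k then 1 / b i else 1)))
        = ennreal (\<Prod>i\<in>UNIV. pi / b i * (if i = k then 1 / b i else 1))" for k
      by (rule prod_ennreal) (rule nn)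
    show ?thesis unfolding p by (rule sum_ennreal) (intro prod_nonneg ballI nn)
  qed
  also have "(\<Sum>k\<in>UNIV. \<Prod>i\<in>UNIV. pi / b i * (if i = k then 1 / b i else 1)) = (\<Prod>i\<in>UNIV. pi / b i) * (\<Sum>k\<in>UNIV. 1 / b k)"
    by (simp only: prod.distrib sum_distrib_left) simp
  finally show ?thesis .
qed

text \<open>The trace of the resolvent as a Gaussian integral: this removes the inverse of the random matrix.\<close>

lemma trace_resolvent_gaussian:
  fixes a :: "'n::finite \<Rightarrow> real" and H :: "complex^'n^'n"
  assumes a: "\<And>i. 0 \<le> a i" and w: "0 < w"
  shows "ennreal (pi ^ CARD('n) * Re (trace (mat_fun (\<lambda>t. 1 / (w + t)) (gram a H))))
    = ennreal (Re (det (mat (of_real w) + gram a H))) *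
      (\<integral>\<^sup>+x. ennreal ((norm x)\<^sup>2 * exp (- (w * (norm x)\<^sup>2 + qform a H x))) \<partial>lborel)"
proof -
  obtain U b where U: "unitary_mat U" and W: "gram a H = U ** cdiag b ** cadj U"
    and b: "\<And>i. 0 \<le> b i"
    and q: "\<And>y. qform a H (U *v y) = (\<Sum>i\<in>UNIV. b i * (norm (y $ i))\<^sup>2)"
    by (rule gram_diagonalize[where a = a and H = H, OF a]) blast
  have pos: "0 < w + b i" for i using w b[of i] by simp
  note borel_measurable_linear[OF linear_mat_mult(3), measurable]
  let ?f = "\<lambda>x::complex^'n. ennreal ((norm x)\<^sup>2 * exp (- (w * (norm x)\<^sup>2 + qform a H x)))"
  have "(\<integral>\<^sup>+x. ?f x \<partial>lborel) = (\<integral>\<^sup>+x. ?f (U *v x) \<partial>lborel)"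
    by (rule nn_integral_lborel_isometry[OF linear_mat_mult(3) norm_unitary_vec[OF U], symmetric]) simp
  also have "\<dots> = (\<integral>\<^sup>+y. ennreal ((norm y)\<^sup>2 * exp (- (\<Sum>i\<in>UNIV. (w + b i) * (norm (y $ i))\<^sup>2))) \<partial>(lborel :: (complex^'n) measure))"
  proof (rule nn_integral_cong)
    fix y :: "complex^'n"
    have "w * (norm y)\<^sup>2 = (\<Sum>i\<in>UNIV. w * (norm (y $ i))\<^sup>2)"
      by (simp add: norm_vec_def L2_set_def sum_nonneg sum_distrib_left)
    then show "?f (U *v y) = ennreal ((norm y)\<^sup>2 * exp (- (\<Sum>i\<in>UNIV. (w + b i) * (norm (y $ i))\<^sup>2)))"
      by (simp only: q norm_unitary_vec[OF U] distrib_right sum.distrib)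
  qed
  also have "\<dots> = ennreal ((\<Prod>i\<in>UNIV. pi / (w + b i)) * (\<Sum>k\<in>UNIV. 1 / (w + b k)))"
    by (rule nn_integral_gaussian_quadratic[OF pos])
  finally have I: "(\<integral>\<^sup>+x. ?f x \<partial>lborel) = ennreal ((\<Prod>i\<in>UNIV. pi / (w + b i)) * (\<Sum>k\<in>UNIV. 1 / (w + b k)))" .
  \<comment> \<open>The determinant cancels the normalisation of the vector integral, leaving the
    resolvent trace times a power of pi.\<close>
  have "(\<Prod>i\<in>UNIV. w + b i) * (\<Prod>i\<in>UNIV. pi / (w + b i)) = (\<Prod>i\<in>(UNIV::'n set). pi)"
    unfolding prod.distrib[symmetric] using pos by (intro prod.cong refl) (simp add: less_imp_neq[THEN not_sym])
  then have "(\<Prod>i\<in>UNIV. w + b i) * ((\<Prod>i\<in>UNIV. pi / (w + b i)) * (\<Sum>k\<in>UNIV. 1 / (w + b k)))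
      = pi ^ CARD('n) * (\<Sum>k\<in>UNIV. 1 / (w + b k))" by (simp only: mult.assoc[symmetric]) simp
  moreover have "0 \<le> (\<Prod>i\<in>UNIV. w + b i)" "0 \<le> (\<Prod>i\<in>UNIV. pi / (w + b i)) * (\<Sum>k\<in>UNIV. 1 / (w + b k))"
    using pos by (auto intro!: prod_nonneg sum_nonneg mult_nonneg_nonneg simp: less_imp_le)
  ultimately show ?thesis unfolding I trace_mat_fun[OF U W] det_shift_diagonalized[OF U W] Re_complex_of_real
    by (simp only: ennreal_mult[symmetric])
qed

section \<open>The expected resolvent\<close>

text \<open>The spectral theorem is applied to the rank-one matrix with entries x_i cnj x_j. In its
  eigenbasis this matrix is diagonal with entries y_i cnj y_j, so at most one coordinate of y is
  nonzero.\<close>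

lemma unitary_rank_one:
  fixes x :: "complex^'n"
  obtains V k c where "unitary_mat V" "x = V *v axis k c" "norm c = norm x"
proof (cases "x = 0")
  case True
  have "cadj (mat 1) = (mat 1 :: complex^'n^'n)" by (auto simp: vec_eq_iff mat_def)
  then have "unitary_mat (mat 1 :: complex^'n^'n)" by (simp add: unitary_mat_def matrix_mul_lid)
  moreover have "x = mat 1 *v axis k 0" for k using True by (simp add: vec_eq_iff axis_def)
  ultimately show ?thesis using that[of "mat 1" _ 0] True by simp
next
  case False
  define B :: "complex^'n^'n" where "B = (\<chi> i j. x $ i * cnj (x $ j))"
  have "hermitian_mat B" by (simp add: hermitian_mat_def vec_eq_iff B_def mult.commute)
  then obtain U b where U: "unitary_mat U" and B: "B = U ** cdiag b ** cadj U"
    by (rule hermitian_spectral)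
  define y where "y = cadj U *v x"
  have xy: "x = U *v y" using U by (simp add: y_def unitary_cancel)
  have D: "cadj U ** B ** U = cdiag b"
    unfolding B using U by (simp add: unitary_cancel flip: matrix_mul_assoc)
  have "(cadj U ** B ** U) $ i $ j = y $ i * cnj (y $ j)" for i j
  proof -
    have "(cadj U ** B ** U) $ i $ j = (\<Sum>k\<in>UNIV. (\<Sum>l\<in>UNIV. cnj (U $ l $ i) * (x $ l * cnj (x $ k))) * U $ k $ j)"
      by (simp add: matrix_matrix_mult_def B_def)
    also have "\<dots> = (\<Sum>k\<in>UNIV. (y $ i * cnj (x $ k)) * U $ k $ j)"
      by (simp add: y_def matrix_vector_mult_def sum_distrib_right mult.assoc)
    also have "\<dots> = y $ i * cnj (y $ j)"
      by (simp add: y_def matrix_vector_mult_def sum_distrib_left mult_ac)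
    finally show ?thesis .
  qed
  then have yy: "y $ i * cnj (y $ j) = (if i = j then of_real (b i) else 0)" for i j
    by (simp add: D diag_mat_def)
  have "y \<noteq> 0" using False xy by auto
  then obtain k where k: "y $ k \<noteq> 0" by (auto simp: vec_eq_iff)
  have y0: "y $ j = 0" if "j \<noteq> k" for j using yy[of j k] that k by simp
  then have y: "y = axis k (y $ k)" by (auto simp: vec_eq_iff axis_def)
  have "(\<Sum>j\<in>UNIV. (norm (y $ j))\<^sup>2) = (norm (y $ k))\<^sup>2"
    using y0 by (subst sum.remove[of _ k]) auto
  then have "norm (y $ k) = norm y" by (simp add: norm_vec_def L2_set_def)
  also have "\<dots> = norm x" unfolding xy using U by (simp add: norm_unitary_vec)
  finally show ?thesis using that[OF U, of k "y $ k"] xy y by simp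
qed

lemma borel_measurable_det_gram [measurable]:
  "(\<lambda>H. Re (det (mat (of_real w) + gram a H))) \<in> borel_measurable borel"
proof (rule borel_measurable_continuous_onI)
  have "continuous_on UNIV (gram a)"
    unfolding gram_def[abs_def] matrix_matrix_mult_def cadj_def by (auto intro!: continuous_intros simp: diag_mat_def)
  then show "continuous_on UNIV (\<lambda>H. Re (det (mat (complex_of_real w) + gram a H)))"
    unfolding det_def by (intro continuous_intros)
qed

lemma nn_integral_det_gram:
  fixes a :: "'n::finite \<Rightarrow> real" and k :: 'n
  assumes a: "\<And>i. 0 < a i" and w: "0 < w" and r: "0 \<le> r"
  defines "c \<equiv> \<lambda>i j. if j = k then 1 + r * a i else 1"
  shows "(\<integral>\<^sup>+H. ennreal (exp (- wnorm c H) * Re (det (mat (of_real w) + gram a H))) \<partial>lborel)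
      = ennreal (pi ^ (CARD('n)\<^sup>2) * det_avg a w r)"
    and "0 \<le> det_avg a w r"
proof -
  have c1: "1 \<le> c i j" for i j using a[of i] r by (simp add: c_def)
  define v where "v m s = (case s of None \<Rightarrow> w | Some i \<Rightarrow> a i / c i m)" for m s
  let ?X = "(\<Prod>i\<in>UNIV. \<Prod>j\<in>UNIV. pi / c i j) * (\<Sum>\<phi> | inj_some UNIV \<phi>. \<Prod>m\<in>UNIV. v m (\<phi> m))"
  let ?f = "\<lambda>H. exp (- wnorm c H) * Re (det (mat (of_real w) + gram a H))"
  have "has_bochner_integral lborel (\<lambda>H. exp (- wnorm c H) *\<^sub>R det (mat (of_real w) + gram a H)) (of_real ?X)"
    using integral_gaussian_det[of c w a, OF c1] by (simp only: v_def gram_def)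
  from has_bochner_integral_bounded_linear[OF bounded_linear_Re this]
  have hb: "has_bochner_integral lborel ?f ?X" by (simp del: of_real_mult of_real_prod of_real_sum)
  have nn: "0 \<le> ?f H" for H using Re_det_gram_nonneg[of a w H] a w by (simp add: less_imp_le)
  have "?X = (\<integral>H. ?f H \<partial>lborel)" using has_bochner_integral_integral_eq[OF hb] by (rule sym)
  also have "\<dots> \<ge> 0" by (intro Bochner_Integration.integral_nonneg nn)
  \<comment> \<open>The sign of \<open>det_avg\<close> is inherited from the integrand: a Gaussian
    times the determinant of a positive definite matrix.\<close>
  finally have X0: "0 \<le> ?X" .
  have "(\<Sum>\<phi> | inj_some UNIV \<phi>. \<Prod>m\<in>UNIV. v m (\<phi> m))
      = w * umbral w (CARD('n) - 1) (epoly a UNIV) + (\<Sum>i\<in>UNIV. a i / (1 + r * a i) * umbral w (CARD('n) - 1) (epoly a (- {i})))"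
    by (rule sum_inj_some) (auto simp: v_def c_def fun_eq_iff split: option.split)
  moreover have "(\<Prod>i\<in>UNIV. \<Prod>j\<in>UNIV. pi / c i j) = pi ^ (CARD('n)\<^sup>2) * char_inv a r"
  proof -
    have "(\<Prod>j\<in>UNIV. pi / c i j) = pi ^ CARD('n) * inverse (1 + r * a i)" for i
    proof -
      have "(\<Prod>j\<in>UNIV. pi / c i j) = (\<Prod>j\<in>UNIV. pi * (if j = k then inverse (1 + r * a i) else 1))"
        by (intro prod.cong) (auto simp: c_def divide_inverse)
      then show ?thesis by (simp add: prod.distrib)
    qed
    then show ?thesis by (simp add: prod.distrib power2_eq_square power_mult)
  qed
  ultimately have X: "?X = pi ^ (CARD('n)\<^sup>2) * det_avg a w r" by (simp only: det_avg_def mult.assoc)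
  show "0 \<le> det_avg a w r" using X0 zero_less_power[OF pi_gt_zero, of "CARD('n)\<^sup>2"]
    unfolding X by (auto simp: zero_le_mult_iff not_le)
  have "(\<integral>\<^sup>+H. ennreal (?f H) \<partial>lborel) = ennreal (\<integral>H. ?f H \<partial>lborel)"
    using hb nn by (intro nn_integral_eq_integral) (auto simp: has_bochner_integral_iff)
  then show "(\<integral>\<^sup>+H. ennreal (?f H) \<partial>lborel) = ennreal (pi ^ (CARD('n)\<^sup>2) * det_avg a w r)"
    using hb X by (simp add: has_bochner_integral_iff)
qed

lemma gram_unitary_right: "gram a (H ** V) = cadj V ** gram a H ** V"
  by (simp add: gram_def cadj_mul matrix_mul_assoc)

text \<open>With V rotating an axis onto the direction of x, replace H by \<open>H ** V\<close>:
  norm and determinant are unchanged, and H x becomes a multiple of column k. The exponential then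
  only reweights that column.\<close>

lemma nn_integral_det_gram_vec:
  fixes a :: "'n::finite \<Rightarrow> real" and x :: "complex^'n"
  assumes a: "\<And>i. 0 < a i" and w: "0 < w"
  shows "(\<integral>\<^sup>+H. ennreal (exp (- ((norm H)\<^sup>2 + qform a H x))
       * Re (det (mat (of_real w) + gram a H))) \<partial>lborel)
      = ennreal (pi ^ (CARD('n)\<^sup>2) * det_avg a w ((norm x)\<^sup>2))"
proof -
  obtain V k z where V: "unitary_mat V" and x: "x = V *v axis k z" and z: "norm z = norm x"
    by (rule unitary_rank_one)
  define c where "c = (\<lambda>i j. if j = k then 1 + (norm x)\<^sup>2 * a i else 1)"
  let ?F = "\<lambda>H. ennreal (exp (- wnorm c H) * Re (det (mat (of_real w) + gram a H)))"
  have eq: "ennreal (exp (- ((norm H)\<^sup>2 + qform a H x))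
       * Re (det (mat (of_real w) + gram a H))) = ?F (H ** V)" for H
  proof -
    have "(H *v x) $ i = (H ** V) $ i $ k * z" for i
      unfolding x by (simp add: matrix_vector_mul_assoc) (simp add: matrix_vector_mult_def axis_def if_distrib cong: if_cong)
    then have "qform a H x = (\<Sum>i\<in>UNIV. (norm x)\<^sup>2 * a i * (norm ((H ** V) $ i $ k))\<^sup>2)"
      by (simp add: norm_mult power_mult_distrib z mult_ac)
    moreover have "wnorm c (H ** V) = (norm (H ** V))\<^sup>2 + (\<Sum>i\<in>UNIV. (norm x)\<^sup>2 * a i * (norm ((H ** V) $ i $ k))\<^sup>2)"
    proof -
      have "wnorm c (H ** V) = (\<Sum>i\<in>UNIV. \<Sum>j\<in>UNIV. (norm ((H ** V) $ i $ j))\<^sup>2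
          + (if j = k then (norm x)\<^sup>2 * a i * (norm ((H ** V) $ i $ j))\<^sup>2 else 0))"
        unfolding wnorm_def by (intro sum.cong) (auto simp: c_def algebra_simps)
      then show ?thesis unfolding norm_mat_square by (simp add: sum.distrib)
    qed
    moreover have "det (mat (of_real w) + gram a (H ** V)) = det (mat (of_real w) + gram a H)"
      using mat_unitary_conj[OF unitary_mat_cadj[OF V], of "of_real w" "gram a H"]
        det_unitary_conj[OF unitary_mat_cadj[OF V], of "mat (of_real w) + gram a H"]
      by (simp add: gram_unitary_right)
    ultimately show ?thesis using norm_unitary_mult(2)[OF V, of H] by simp
  qed
  have "(\<integral>\<^sup>+H. ?F (H ** V) \<partial>lborel) = (\<integral>\<^sup>+H. ?F H \<partial>lborel)"
    by (rule nn_integral_lborel_isometry[OF linear_mat_mult(2) norm_unitary_mult(2)[OF V]]) measurable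
  then show ?thesis unfolding eq
    using nn_integral_det_gram(1)[OF a w, of "(norm x)\<^sup>2" k] by (simp add: c_def)
qed

section \<open>Decay and integration by parts in the radial variable\<close>

lemma tendsto_rtrans:
  fixes a :: "'n::finite \<Rightarrow> real"
  assumes a: "\<And>i. 0 < a i" and w: "0 < w"
  shows "(rtrans a w \<longlongrightarrow> 0) at_top"
proof (rule Lim_null_comparison)
  let ?g = "\<lambda>r. \<Sum>d<CARD('n). exp (- w * r) * r ^ d * (\<bar>umbral w d (epoly a UNIV)\<bar> / fact d)"
  have "((\<lambda>r. exp (- w * r) * r ^ d) \<longlongrightarrow> 0) at_top" for d :: nat
    using w by real_asymp
  then have "(?g \<longlongrightarrow> (\<Sum>d<CARD('n). 0)) at_top"
    by (intro tendsto_sum tendsto_mult_left_zero)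
  then show "(?g \<longlongrightarrow> 0) at_top" by simp
  show "\<forall>\<^sub>F r in at_top. norm (rtrans a w r) \<le> ?g r"
    using eventually_ge_at_top[of 0]
  proof eventually_elim
    case (elim r)
    have "\<bar>\<Prod>i\<in>UNIV. inverse (1 + r * a i)\<bar> \<le> 1"
      using a elim by (auto simp: abs_prod intro!: prod_le_1 simp: less_imp_le inverse_le_1_iff)
    then have "\<bar>\<Prod>i\<in>UNIV. inverse (1 + r * a i)\<bar> * \<bar>\<Sum>d<CARD('n). exp_part w r d (epoly a UNIV)\<bar>
        \<le> 1 * (\<Sum>d<CARD('n). \<bar>exp_part w r d (epoly a UNIV)\<bar>)"
      by (intro mult_mono sum_abs) auto
    then have "norm (rtrans a w r) \<le> exp (- w * r) * (1 * (\<Sum>d<CARD('n). \<bar>exp_part w r d (epoly a UNIV)\<bar>))"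
      by (simp add: rtrans_def abs_mult mult.assoc)
    also have "\<dots> = ?g r" using elim by (simp add: sum_distrib_left exp_part_def abs_mult mult_ac)
    finally show ?case .
  qed
qed

text \<open>Decay at infinity makes T(r) the tail integral of D, so both sides are the integral of
  D(s) over the triangle 0 \<le> r \<le> s, taken in the two orders.\<close>

lemma nn_integral_by_parts_zero:
  fixes T D :: "real \<Rightarrow> real"
  assumes D [measurable]: "D \<in> borel_measurable borel"
    and deriv: "\<And>r. 0 \<le> r \<Longrightarrow> (T has_real_derivative - D r) (at r)"
    and nonneg: "\<And>r. 0 \<le> r \<Longrightarrow> 0 \<le> D r" and lim: "(T \<longlongrightarrow> 0) at_top"
  shows "(\<integral>\<^sup>+r. ennreal (r * D r) * indicator {0..} r \<partial>lborel) = (\<integral>\<^sup>+r. ennreal (T r) * indicator {0..} r \<partial>lborel)"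
proof -
  have T: "(\<integral>\<^sup>+s. ennreal (D s) * indicator {r..} s \<partial>lborel) = ennreal (T r)" if "0 \<le> r" for r
  proof -
    have "(\<integral>\<^sup>+s. ennreal (D s) * indicator {r..} s \<partial>lborel) = ennreal (0 - (- T r))"
    proof (rule nn_integral_FTC_atLeast[where F = "\<lambda>s. - T s"])
      show "((\<lambda>s. - T s) \<longlongrightarrow> 0) at_top" using tendsto_minus[OF lim] by simp
      show "((\<lambda>s. - T s) has_real_derivative D s) (at s)" if "r \<le> s" for s
        using DERIV_minus[OF deriv[of s]] that \<open>0 \<le> r\<close> by simp
    qed (use nonneg that in auto)
    then show ?thesis by simp
  qed
  have "(\<integral>\<^sup>+r. ennreal (T r) * indicator {0..} r \<partial>lborel)
      = (\<integral>\<^sup>+r. \<integral>\<^sup>+s. ennreal (D s) * indicator {r..} s * indicator {0..} r \<partial>lborel \<partial>lborel)"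
  proof (rule nn_integral_cong)
    fix r :: real
    show "ennreal (T r) * indicator {0..} r = (\<integral>\<^sup>+s. ennreal (D s) * indicator {r..} s * indicator {0..} r \<partial>lborel)"
      using T[of r] by (subst nn_integral_multc) (auto split: split_indicator)
  qed
  also have "\<dots> = (\<integral>\<^sup>+r. \<integral>\<^sup>+s. ennreal (D s) * indicator {(r, s). 0 \<le> r \<and> r \<le> s} (r, s) \<partial>lborel \<partial>lborel)"
    by (intro nn_integral_cong) (auto split: split_indicator)
  also have "\<dots> = (\<integral>\<^sup>+s. \<integral>\<^sup>+r. ennreal (D s) * indicator {(r, s). 0 \<le> r \<and> r \<le> s} (r, s) \<partial>lborel \<partial>lborel)"
    by (rule lborel_pair.Fubini'[symmetric]) measurable
  also have "\<dots> = (\<integral>\<^sup>+s. ennreal (s * D s) * indicator {0..} s \<partial>lborel)"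
  proof (rule nn_integral_cong)
    fix s :: real
    have "(\<integral>\<^sup>+r. ennreal (D s) * indicator {(r, s). 0 \<le> r \<and> r \<le> s} (r, s) \<partial>lborel)
        = (\<integral>\<^sup>+r. ennreal (D s) * indicator {0..s} r \<partial>lborel)"
      by (intro nn_integral_cong) (auto split: split_indicator)
    also have "\<dots> = ennreal (D s) * emeasure lborel {0..s}"
      by (rule nn_integral_cmult_indicator) auto
    also have "\<dots> = ennreal (s * D s) * indicator {0..} s"
      using nonneg[of s] by (cases "0 \<le> s") (auto simp: ennreal_mult' mult.commute)
    finally show "(\<integral>\<^sup>+r. ennreal (D s) * indicator {(r, s). 0 \<le> r \<and> r \<le> s} (r, s) \<partial>lborel)
      = ennreal (s * D s) * indicator {0..} s" .
  qed
  finally show ?thesis by simp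
qed

definition resolvent_trace :: "('n \<Rightarrow> real) \<Rightarrow> real \<Rightarrow> complex^'n^'n \<Rightarrow> real" where
  "resolvent_trace a w H = Re (trace (mat_fun (\<lambda>t. 1 / (w + t)) (gram a H)))"

lemma resolvent_trace_nonneg:
  fixes a :: "'n::finite \<Rightarrow> real"
  assumes "\<And>i. 0 < a i" "0 < w"
  shows "0 \<le> resolvent_trace a w H"
proof -
  obtain U b where U: "unitary_mat U" "gram a H = U ** cdiag b ** cadj U" "\<And>i. 0 \<le> b i"
    by (rule gram_diagonalize[where a = a and H = H]) (use assms in \<open>auto simp: less_imp_le\<close>)
  then show ?thesis
    using assms(2) unfolding resolvent_trace_def trace_mat_fun[OF U(1,2)] Re_complex_of_real
    by (intro sum_nonneg) (simp add: add_nonneg_nonneg less_imp_le)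
qed

text \<open>The identity \<open>eq\<close> also settles measurability: its right-hand side is a
  continuous function times an integral with parameter, whereas \<open>mat_fun\<close> itself is
  defined by choice.\<close>

theorem nn_integral_resolvent_trace:
  fixes a :: "'n::finite \<Rightarrow> real"
  assumes a: "\<And>i. 0 < a i" and w: "0 < w"
  shows "resolvent_trace a w \<in> borel_measurable borel"
    and "(\<integral>\<^sup>+H. ennreal (resolvent_trace a w H) \<partial>gauss_mat_measure)
      = (\<integral>\<^sup>+r. ennreal (rtrans a w r) * indicator {0..} r \<partial>lborel)"
proof -
  let ?n = "CARD('n)"
  let ?S = "\<lambda>H (x::complex^'n). \<Sum>i\<in>UNIV. a i * (norm ((H *v x) $ i))\<^sup>2"
  let ?d = "\<lambda>H. Re (det (mat (of_real w) + gram a H))"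
  let ?I = "\<lambda>H. \<integral>\<^sup>+x. ennreal ((norm x)\<^sup>2 * exp (- (w * (norm x)\<^sup>2 + ?S H x))) \<partial>lborel"
  have d0: "0 \<le> ?d H" for H using Re_det_gram_nonneg[of a w H] a w by (simp add: less_imp_le)
  have S [measurable]: "(\<lambda>(H, x). ?S H x) \<in> borel_measurable (borel \<Otimes>\<^sub>M borel)"
    unfolding borel_prod case_prod_unfold
    by (intro borel_measurable_continuous_onI) (auto simp: matrix_vector_mult_def intro!: continuous_intros)
  have S' [measurable]: "(\<lambda>(x, H). ?S H x) \<in> borel_measurable (borel \<Otimes>\<^sub>M borel)"
    unfolding borel_prod case_prod_unfold
    by (intro borel_measurable_continuous_onI) (auto simp: matrix_vector_mult_def intro!: continuous_intros)
  have eq: "ennreal (pi ^ ?n * resolvent_trace a w H) = ennreal (?d H) * ?I H" for H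
    unfolding resolvent_trace_def
    using trace_resolvent_gaussian[of a w H] a w by (simp add: less_imp_le)
  have "(\<lambda>H. ennreal (?d H) * ?I H) \<in> borel_measurable borel"
    by measurable
  then have "(\<lambda>H. enn2real (ennreal (?d H) * ?I H) / pi ^ ?n) \<in> borel_measurable borel"
    by measurable
  also have "(\<lambda>H. enn2real (ennreal (?d H) * ?I H) / pi ^ ?n) = resolvent_trace a w"
    unfolding eq[symmetric] using resolvent_trace_nonneg[where a = a, OF a w] by (simp add: fun_eq_iff)
  finally show meas [measurable]: "resolvent_trace a w \<in> borel_measurable borel" .
  \<comment> \<open>The power and the factorial come from the density of |x|^2 in real dimension 2
    n. The further factor r, from the |x|^2 in the Gaussian formula for the trace, stays outside for
    the integration by parts.\<close>
  let ?D = "\<lambda>r. exp (- w * r) * (r ^ (?n - 1) / fact (?n - 1)) * det_avg a w r"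
  have [measurable]: "det_avg a w \<in> borel_measurable borel" unfolding det_avg_def[abs_def] by measurable
  have N0: "0 \<le> det_avg a w r" if "0 \<le> r" for r using nn_integral_det_gram(2)[where a = a, OF a w that] .
  have scale: "ennreal (pi ^ ?n * R) = ennreal (pi ^ ?n) * ennreal R" for R
    by (simp add: ennreal_mult')
  have "ennreal (pi ^ ?n) * (\<integral>\<^sup>+H. ennreal (exp (- (norm H)\<^sup>2)) * ennreal (resolvent_trace a w H) \<partial>lborel)
     = (\<integral>\<^sup>+H. ennreal (pi ^ ?n) * (ennreal (exp (- (norm H)\<^sup>2)) * ennreal (resolvent_trace a w H)) \<partial>lborel)"
    by (rule nn_integral_cmult[symmetric]) measurable
  also have "\<dots> = (\<integral>\<^sup>+H. ennreal (exp (- (norm H)\<^sup>2)) * ennreal (pi ^ ?n * resolvent_trace a w H) \<partial>lborel)"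
    by (simp only: scale mult.left_commute)
  also have "\<dots> = (\<integral>\<^sup>+H. \<integral>\<^sup>+x. ennreal ((norm x)\<^sup>2 * exp (- w * (norm x)\<^sup>2)) *
      ennreal (exp (- ((norm H)\<^sup>2 + ?S H x)) * ?d H) \<partial>lborel \<partial>lborel)"
  proof (rule nn_integral_cong)
    fix H :: "complex^'n^'n"
    have "ennreal (exp (- (norm H)\<^sup>2)) * ennreal (pi ^ ?n * resolvent_trace a w H)
       = (\<integral>\<^sup>+x. ennreal (exp (- (norm H)\<^sup>2)) * (ennreal (?d H) * ennreal ((norm x)\<^sup>2 * exp (- (w * (norm x)\<^sup>2 + ?S H x)))) \<partial>lborel)"
      unfolding eq by (simp add: nn_integral_cmult)
    also have "\<dots> = (\<integral>\<^sup>+x. ennreal ((norm x)\<^sup>2 * exp (- w * (norm x)\<^sup>2)) *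
      ennreal (exp (- ((norm H)\<^sup>2 + ?S H x)) * ?d H) \<partial>lborel)"
      using d0[of H]
      by (intro nn_integral_cong) (simp add: exp_add exp_diff exp_minus divide_inverse mult_ac flip: ennreal_mult)
    finally show "ennreal (exp (- (norm H)\<^sup>2)) * ennreal (pi ^ ?n * resolvent_trace a w H)
       = (\<integral>\<^sup>+x. ennreal ((norm x)\<^sup>2 * exp (- w * (norm x)\<^sup>2)) *
      ennreal (exp (- ((norm H)\<^sup>2 + ?S H x)) * ?d H) \<partial>lborel)" .
  qed
  also have "\<dots> = (\<integral>\<^sup>+x. \<integral>\<^sup>+H. ennreal ((norm x)\<^sup>2 * exp (- w * (norm x)\<^sup>2)) *
      ennreal (exp (- ((norm H)\<^sup>2 + ?S H x)) * ?d H) \<partial>lborel \<partial>lborel)"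
    by (rule lborel_pair.Fubini') measurable
  also have "\<dots> = (\<integral>\<^sup>+x. ennreal ((norm x)\<^sup>2 * exp (- w * (norm x)\<^sup>2)) *
      ennreal (pi ^ (?n\<^sup>2) * det_avg a w ((norm x)\<^sup>2)) \<partial>(lborel :: (complex^'n) measure))"
  proof (rule nn_integral_cong)
    fix x :: "complex^'n"
    show "(\<integral>\<^sup>+H. ennreal ((norm x)\<^sup>2 * exp (- w * (norm x)\<^sup>2)) *
        ennreal (exp (- ((norm H)\<^sup>2 + ?S H x)) * ?d H) \<partial>lborel)
      = ennreal ((norm x)\<^sup>2 * exp (- w * (norm x)\<^sup>2)) * ennreal (pi ^ (?n\<^sup>2) * det_avg a w ((norm x)\<^sup>2))"
      unfolding nn_integral_det_gram_vec[where a = a and x = x, OF a w, symmetric]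
      by (rule nn_integral_cmult) measurable
  qed
  also have "\<dots> = (\<integral>\<^sup>+r. (ennreal (r * exp (- w * r)) * ennreal (pi ^ (?n\<^sup>2) * det_avg a w r)) *
      ennreal (pi ^ Suc (?n - 1) / fact (?n - 1) * r ^ (?n - 1)) * indicator {0..} r \<partial>lborel)"
    by (rule nn_integral_norm_square[where g = "\<lambda>r. ennreal (r * exp (- w * r)) * ennreal (pi ^ (?n\<^sup>2) * det_avg a w r)"]) auto
  also have "\<dots> = (\<integral>\<^sup>+r. ennreal (pi ^ ?n * pi ^ (?n\<^sup>2)) * (ennreal (r * ?D r) * indicator {0..} r) \<partial>lborel)"
  proof (rule nn_integral_cong)
    fix r :: real
    show "(ennreal (r * exp (- w * r)) * ennreal (pi ^ (?n\<^sup>2) * det_avg a w r)) *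
      ennreal (pi ^ Suc (?n - 1) / fact (?n - 1) * r ^ (?n - 1)) * indicator {0..} r
      = ennreal (pi ^ ?n * pi ^ (?n\<^sup>2)) * (ennreal (r * ?D r) * indicator {0..} r)"
    proof (cases "0 \<le> r")
      case True
      have "Suc (?n - 1) = ?n" by simp
      then show ?thesis using True N0[OF True]
        by (simp add: mult_ac flip: ennreal_mult del: power_Suc)
    qed simp
  qed
  also have "\<dots> = ennreal (pi ^ ?n * pi ^ (?n\<^sup>2)) * (\<integral>\<^sup>+r. ennreal (r * ?D r) * indicator {0..} r \<partial>lborel)"
    by (rule nn_integral_cmult) measurable
  also have "(\<integral>\<^sup>+r. ennreal (r * ?D r) * indicator {0..} r \<partial>lborel) = (\<integral>\<^sup>+r. ennreal (rtrans a w r) * indicator {0..} r \<partial>lborel)"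
  proof (rule nn_integral_by_parts_zero)
    show "(rtrans a w has_real_derivative - ?D r) (at r)" if "0 \<le> r" for r
      by (rule has_real_derivative_rtrans[OF a that])
    show "0 \<le> ?D r" if "0 \<le> r" for r using that N0[OF that] by simp
    show "(rtrans a w \<longlongrightarrow> 0) at_top" by (rule tendsto_rtrans[where a = a, OF a w])
  qed measurable
  finally have main: "ennreal (pi ^ ?n) * (\<integral>\<^sup>+H. ennreal (exp (- (norm H)\<^sup>2)) * ennreal (resolvent_trace a w H) \<partial>lborel)
     = ennreal (pi ^ ?n * pi ^ (?n\<^sup>2)) * (\<integral>\<^sup>+r. ennreal (rtrans a w r) * indicator {0..} r \<partial>lborel)" .
  let ?T = "\<integral>\<^sup>+r. ennreal (rtrans a w r) * indicator {0..} r \<partial>lborel"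
  let ?J = "\<integral>\<^sup>+H. ennreal (exp (- (norm H)\<^sup>2)) * ennreal (resolvent_trace a w H) \<partial>lborel"
  have J: "?J = ennreal (pi ^ (?n\<^sup>2)) * ?T"
  proof -
    have "ennreal (pi ^ ?n) * ?J = ennreal (pi ^ ?n) * (ennreal (pi ^ (?n\<^sup>2)) * ?T)"
      unfolding main by (simp add: ennreal_mult mult.assoc)
    then show ?thesis by (simp add: ennreal_mult_cancel_left)
  qed
  have "(\<integral>\<^sup>+H. ennreal (resolvent_trace a w H) \<partial>gauss_mat_measure)
      = (\<integral>\<^sup>+H. ennreal (exp (- (norm H)\<^sup>2) / pi ^ (?n\<^sup>2)) * ennreal (resolvent_trace a w H) \<partial>lborel)"
    unfolding gauss_mat_measure_def trace_cadj_mult Re_complex_of_real by (rule nn_integral_density) measurable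
  also have "\<dots> = (\<integral>\<^sup>+H. ennreal (1 / pi ^ (?n\<^sup>2)) * (ennreal (exp (- (norm H)\<^sup>2)) * ennreal (resolvent_trace a w H)) \<partial>lborel)"
    by (intro nn_integral_cong) (simp add: resolvent_trace_nonneg[where a = a, OF a w] flip: ennreal_mult)
  also have "\<dots> = ennreal (1 / pi ^ (?n\<^sup>2)) * ?J" by (rule nn_integral_cmult) measurable
  also have "\<dots> = ennreal (1 / pi ^ (?n\<^sup>2) * pi ^ (?n\<^sup>2)) * ?T"
    unfolding J by (simp only: mult.assoc[symmetric]) (simp flip: ennreal_mult)
  finally show "(\<integral>\<^sup>+H. ennreal (resolvent_trace a w H) \<partial>gauss_mat_measure) = ?T" by simp
qed

section \<open>Resolvent traces determine all linear statistics\<close>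

text \<open>Up to the factor -1 / m these are difference quotients of x^(-m). Bernoulli's inequality
  for (1 - h / (x + h))^m bounds them uniformly in h, as dominated convergence requires.\<close>

lemma inverse_power_difference:
  fixes x h :: real
  assumes x: "0 < x" and h: "0 < h" and m: "0 < m"
  shows "0 \<le> (inverse x ^ m - inverse (x + h) ^ m) / (m * h)"
    and "(inverse x ^ m - inverse (x + h) ^ m) / (m * h) \<le> inverse x ^ Suc m"
proof -
  define y where "y = x + h"
  have y: "0 < y" "y - h = x" using x h by (auto simp: y_def)
  have le: "inverse y ^ m \<le> inverse x ^ m" using x h by (intro power_mono le_imp_inverse_le) (auto simp: y_def)
  have "1 + real m * (- (h / y)) \<le> (1 + (- (h / y))) ^ m"
    using y x by (intro Bernoulli_inequality) (simp add: divide_le_eq)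
  also have "1 + (- (h / y)) = x / y"
  proof -
    have "x / y = (y - h) / y" by (simp only: y(2))
    also have "\<dots> = 1 + (- (h / y))" using y(1) by (simp add: diff_divide_distrib)
    finally show ?thesis by simp
  qed
  finally have "1 - (x / y) ^ m \<le> real m * (h / y)" by linarith
  then have "inverse x ^ m * (1 - (x / y) ^ m) \<le> inverse x ^ m * (real m * (h / y))"
    using x by (intro mult_left_mono) auto
  also have "inverse x ^ m * (1 - (x / y) ^ m) = inverse x ^ m - inverse y ^ m"
  proof -
    have "inverse x * (x / y) = inverse y" using x(1) by (simp add: divide_inverse mult.assoc[symmetric])
    then have "inverse x ^ m * (x / y) ^ m = inverse y ^ m" by (simp only: power_mult_distrib[symmetric])
    then show ?thesis by (simp only: right_diff_distrib mult_1_right)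
  qed
  also have "inverse x ^ m * (real m * (h / y)) \<le> inverse x ^ m * (real m * (h / x))"
    using x y h by (intro mult_left_mono divide_left_mono mult_pos_pos) (auto simp: y_def)
  also have "inverse x ^ m * (real m * (h / x)) = inverse x ^ Suc m * (m * h)"
    by (simp only: power_Suc divide_inverse mult_ac)
  finally have "inverse x ^ m - inverse y ^ m \<le> inverse x ^ Suc m * (m * h)" .
  moreover have "0 < m * h" using m h by simp
  ultimately show "(inverse x ^ m - inverse (x + h) ^ m) / (m * h) \<le> inverse x ^ Suc m"
    by (simp only: pos_divide_le_eq y_def)
  show "0 \<le> (inverse x ^ m - inverse (x + h) ^ m) / (m * h)"
    using le \<open>0 < m * h\<close> by (intro divide_nonneg_pos) (auto simp: y_def)
qed

lemma inverse_power_difference_tendsto: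
  fixes x :: real
  assumes x: "0 < x" and m: "0 < m"
  shows "(\<lambda>N. (inverse x ^ m - inverse (x + inverse (real (Suc N))) ^ m) / (m * inverse (real (Suc N))))
    \<longlonglongrightarrow> inverse x ^ Suc m"
proof -
  let ?h = "\<lambda>N. inverse (real (Suc N))"
  obtain l where l: "m = Suc l" using m by (cases m) auto
  have "(inverse has_real_derivative - (inverse x * 1 * inverse x)) (at x)"
    using x by (intro DERIV_inverse' DERIV_ident) auto
  from DERIV_power[OF this, of m]
  have "((\<lambda>x. inverse x ^ m) has_real_derivative real m * (- (inverse x * 1 * inverse x) * inverse x ^ (m - Suc 0))) (at x)" .
  also have "real m * (- (inverse x * 1 * inverse x) * inverse x ^ (m - Suc 0)) = - (m * inverse x ^ Suc m)"
    by (simp add: l)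
  finally have "((\<lambda>h. (inverse (x + h) ^ m - inverse x ^ m) / h) \<longlongrightarrow> - (m * inverse x ^ Suc m)) (at 0)"
    by (simp only: DERIV_def)
  moreover have "filterlim ?h (at 0) sequentially"
    using LIMSEQ_inverse_real_of_nat by (auto simp: filterlim_at)
  ultimately have "(\<lambda>N. (inverse (x + ?h N) ^ m - inverse x ^ m) / ?h N) \<longlonglongrightarrow> - (m * inverse x ^ Suc m)"
    by (rule filterlim_compose)
  then have "(\<lambda>N. (inverse (x + ?h N) ^ m - inverse x ^ m) / ?h N * (- 1 / m)) \<longlonglongrightarrow> - (m * inverse x ^ Suc m) * (- 1 / m)"
    by (intro tendsto_mult_right)
  moreover have "(A - B) / h * (- 1 / m) = (B - A) / (m * h)" for A B h :: real
    by (simp add: divide_inverse algebra_simps)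
  moreover have "- (m * A) * (- 1 / m) = A" for A :: real using m by simp
  ultimately show ?thesis by (simp only:)
qed

abbreviation bern :: "(real \<Rightarrow> real) \<Rightarrow> nat \<Rightarrow> real \<Rightarrow> real" where
  "bern g n x \<equiv> (\<Sum>k\<le>n. g (k / n) * Bernstein n k x)"

abbreviation ray :: "real \<Rightarrow> real" where "ray \<equiv> indicator {0..}"

text \<open>The values \<open>\<beta> x i\<close> stand for eigenvalues chosen pointwise, so
  measurability is asked of their symmetric sums only. \<open>W\<close> is a density whose sign is
  left open, hence the domination by its absolute value below.\<close>

locale resolvent_determined = finite_measure \<nu> for \<nu> :: "'x measure" +
  fixes \<beta> :: "'x \<Rightarrow> 'i::finite \<Rightarrow> real" and W :: "real \<Rightarrow> real"
  assumes \<beta>_nonneg: "0 \<le> \<beta> x i"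
    and W_integrable: "integrable lborel (\<lambda>s. ray s * W s)"
    and resolvent_measurable: "0 < w \<Longrightarrow> (\<lambda>x. \<Sum>i\<in>UNIV. 1 / (w + \<beta> x i)) \<in> borel_measurable \<nu>"
    and resolvent_integral: "0 < w \<Longrightarrow> (\<integral>x. (\<Sum>i\<in>UNIV. 1 / (w + \<beta> x i)) \<partial>\<nu>) = (\<integral>s. ray s * W s * (1 / (w + s)) \<partial>lborel)"
begin

definition lsum :: "(real \<Rightarrow> real) \<Rightarrow> 'x \<Rightarrow> real" where
  "lsum f x = (\<Sum>i\<in>UNIV. f (\<beta> x i))"

text \<open>Boundedness is included so that both integrals converge absolutely, which linear
  combinations use; measurability is included because it has to be propagated from resolvents to
  limits.\<close>

definition matched :: "(real \<Rightarrow> real) \<Rightarrow> bool" where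
  "matched f \<longleftrightarrow> continuous_on {0..} f \<and> (\<exists>C. \<forall>s\<ge>0. \<bar>f s\<bar> \<le> C) \<and> lsum f \<in> borel_measurable \<nu>
    \<and> (\<integral>x. lsum f x \<partial>\<nu>) = (\<integral>s. ray s * W s * f s \<partial>lborel)"

lemma measurable_weighted:
  assumes "continuous_on {0..} f"
  shows "(\<lambda>s. ray s * W s * f s) \<in> borel_measurable lborel"
proof -
  have "(\<lambda>s. ray s *\<^sub>R f s) \<in> borel_measurable borel"
    using assms by (intro borel_measurable_continuous_on_indicator) auto
  then have [measurable]: "(\<lambda>s. ray s *\<^sub>R f s) \<in> borel_measurable lborel" by simp
  have [measurable]: "(\<lambda>s. ray s * W s) \<in> borel_measurable lborel"
    using W_integrable by (rule borel_measurable_integrable)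
  have "(\<lambda>s. (ray s * W s) * (ray s *\<^sub>R f s)) \<in> borel_measurable lborel"
    by (rule borel_measurable_times) measurable
  also have "(\<lambda>s. (ray s * W s) * (ray s *\<^sub>R f s)) = (\<lambda>s. ray s * W s * f s)"
    by (auto simp: fun_eq_iff split: split_indicator)
  finally show ?thesis .
qed

lemma integrable_weighted:
  assumes "continuous_on {0..} f" "\<And>s. 0 \<le> s \<Longrightarrow> \<bar>f s\<bar> \<le> C"
  shows "integrable lborel (\<lambda>s. ray s * W s * f s)"
proof (rule Bochner_Integration.integrable_bound)
  show "integrable lborel (\<lambda>s. C * \<bar>ray s * W s\<bar>)"
    using W_integrable by (intro integrable_mult_right integrable_abs)
  show "AE s in lborel. norm (ray s * W s * f s) \<le> norm (C * \<bar>ray s * W s\<bar>)"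
  proof (rule AE_I2)
    fix s :: real
    have "\<bar>f s\<bar> \<le> \<bar>C\<bar>" if "0 \<le> s" using assms(2)[OF that] by linarith
    then show "norm (ray s * W s * f s) \<le> norm (C * \<bar>ray s * W s\<bar>)"
      by (auto simp: abs_mult mult.commute[of "\<bar>W s\<bar>"] intro: mult_right_mono split: split_indicator)
  qed
qed (rule measurable_weighted[OF assms(1)])

lemma lsum_bound:
  assumes "\<And>s. 0 \<le> s \<Longrightarrow> \<bar>f s\<bar> \<le> C"
  shows "\<bar>lsum f x\<bar> \<le> real CARD('i) * C"
proof -
  have "\<bar>lsum f x\<bar> \<le> (\<Sum>i\<in>(UNIV::'i set). C)"
    unfolding lsum_def by (rule order_trans[OF sum_abs]) (intro sum_mono assms \<beta>_nonneg)
  then show ?thesis by simp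
qed

lemma integrable_lsum:
  assumes "lsum f \<in> borel_measurable \<nu>" "\<And>s. 0 \<le> s \<Longrightarrow> \<bar>f s\<bar> \<le> C"
  shows "integrable \<nu> (lsum f)"
  by (rule integrable_const_bound[where B = "real CARD('i) * C"]) (use assms(1) lsum_bound[OF assms(2)] in auto)

text \<open>Dominated convergence on both sides: a constant dominates on the finite measure, a
  multiple of |W| on the half-line.\<close>

lemma matched_limit:
  assumes F: "\<And>n::nat. matched (F n)" and bound: "\<And>n s. 0 \<le> s \<Longrightarrow> \<bar>F n s\<bar> \<le> C"
    and lim: "\<And>s. 0 \<le> s \<Longrightarrow> (\<lambda>n. F n s) \<longlonglongrightarrow> f s" and cont: "continuous_on {0..} f"
  shows "matched f"
proof -
  have bf: "\<bar>f s\<bar> \<le> C" if "0 \<le> s" for s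
    using tendsto_rabs[OF lim[OF that]] bound[OF that] by (intro Lim_bounded[where M = 0]) auto
  have meas: "lsum (F n) \<in> borel_measurable \<nu>" for n using F by (auto simp: matched_def)
  have lim': "(\<lambda>n. lsum (F n) x) \<longlonglongrightarrow> lsum f x" for x
    unfolding lsum_def by (intro tendsto_sum lim \<beta>_nonneg)
  have measf: "lsum f \<in> borel_measurable \<nu>"
    by (rule borel_measurable_LIMSEQ_real[OF lim' meas])
  have "(\<lambda>n. \<integral>x. lsum (F n) x \<partial>\<nu>) \<longlonglongrightarrow> (\<integral>x. lsum f x \<partial>\<nu>)"
  proof (rule integral_dominated_convergence[where w = "\<lambda>_. real CARD('i) * C"])
    show "AE x in \<nu>. norm (lsum (F n) x) \<le> real CARD('i) * C" for n
      using lsum_bound[of "F n" C] bound by auto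
  qed (use meas measf lim' in auto)
  moreover have "(\<lambda>n. \<integral>s. ray s * W s * F n s \<partial>lborel) \<longlonglongrightarrow> (\<integral>s. ray s * W s * f s \<partial>lborel)"
  proof (rule integral_dominated_convergence[where w = "\<lambda>s. C * \<bar>ray s * W s\<bar>"])
    show "integrable lborel (\<lambda>s. C * \<bar>ray s * W s\<bar>)"
      using W_integrable by (intro integrable_mult_right integrable_abs)
    show "AE s in lborel. (\<lambda>n. ray s * W s * F n s) \<longlonglongrightarrow> ray s * W s * f s"
      using lim by (auto intro!: AE_I2 tendsto_mult_left split: split_indicator)
    show "AE s in lborel. norm (ray s * W s * F n s) \<le> C * \<bar>ray s * W s\<bar>" for n
      using bound[of _ n] by (auto intro!: AE_I2 mult_right_mono simp: abs_mult mult.commute[of "\<bar>W _\<bar>"] split: split_indicator)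
    show "(\<lambda>s. ray s * W s * f s) \<in> borel_measurable lborel" by (rule measurable_weighted[OF cont])
    show "(\<lambda>s. ray s * W s * F n s) \<in> borel_measurable lborel" for n
      using F by (intro measurable_weighted) (auto simp: matched_def)
  qed
  moreover have "(\<integral>x. lsum (F n) x \<partial>\<nu>) = (\<integral>s. ray s * W s * F n s \<partial>lborel)" for n
    using F by (auto simp: matched_def)
  ultimately have "(\<integral>x. lsum f x \<partial>\<nu>) = (\<integral>s. ray s * W s * f s \<partial>lborel)"
    using LIMSEQ_unique by auto
  then show ?thesis using cont bf measf by (auto simp: matched_def)
qed

lemma matched_linear:
  assumes f: "matched f" and g: "matched g"
  shows "matched (\<lambda>s. a * f s + b * g s)"
proof -
  obtain C D where C: "\<And>s. 0 \<le> s \<Longrightarrow> \<bar>f s\<bar> \<le> C" and D: "\<And>s. 0 \<le> s \<Longrightarrow> \<bar>g s\<bar> \<le> D"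
    using f g by (auto simp: matched_def)
  have bound: "\<bar>a * f s + b * g s\<bar> \<le> \<bar>a\<bar> * C + \<bar>b\<bar> * D" if "0 \<le> s" for s
  proof -
    have "\<bar>a * f s + b * g s\<bar> \<le> \<bar>a\<bar> * \<bar>f s\<bar> + \<bar>b\<bar> * \<bar>g s\<bar>" by (metis abs_mult abs_triangle_ineq)
    also have "\<dots> \<le> \<bar>a\<bar> * C + \<bar>b\<bar> * D" by (intro add_mono mult_left_mono C D that) auto
    finally show ?thesis .
  qed
  have l: "lsum (\<lambda>s. a * f s + b * g s) = (\<lambda>x. a * lsum f x + b * lsum g x)"
    by (simp add: lsum_def fun_eq_iff sum.distrib sum_distrib_left)
  have cf: "continuous_on {0..} f" "continuous_on {0..} g"
    and m: "lsum f \<in> borel_measurable \<nu>" "lsum g \<in> borel_measurable \<nu>" using f g by (auto simp: matched_def)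
  have i: "integrable \<nu> (lsum f)" "integrable \<nu> (lsum g)"
    using integrable_lsum[OF m(1) C] integrable_lsum[OF m(2) D] by auto
  have w: "(\<lambda>s. ray s * W s * (a * f s + b * g s))
      = (\<lambda>s. a * (ray s * W s * f s) + b * (ray s * W s * g s))"
    by (simp add: fun_eq_iff algebra_simps)
  have "(\<integral>x. lsum (\<lambda>s. a * f s + b * g s) x \<partial>\<nu>) = a * (\<integral>x. lsum f x \<partial>\<nu>) + b * (\<integral>x. lsum g x \<partial>\<nu>)"
    unfolding l using i by simp
  also have "\<dots> = (\<integral>s. ray s * W s * (a * f s + b * g s) \<partial>lborel)"
    unfolding w using f g integrable_weighted[OF cf(1) C] integrable_weighted[OF cf(2) D]
    by (simp add: matched_def)
  finally show ?thesis unfolding matched_def l[symmetric] using cf m bound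
    by (auto simp: l intro!: continuous_intros exI[of _ "\<bar>a\<bar> * C + \<bar>b\<bar> * D"])
qed

lemma matched_zero: "matched (\<lambda>s. 0)"
proof -
  have "lsum (\<lambda>s. 0) = (\<lambda>x. 0)" by (simp add: lsum_def fun_eq_iff)
  then show ?thesis by (auto simp: matched_def)
qed

lemma matched_sum:
  assumes "\<And>k. k \<in> K \<Longrightarrow> matched (f k)"
  shows "matched (\<lambda>s. \<Sum>k\<in>K. c k * f k s)"
  using assms
proof (induction K rule: infinite_finite_induct)
  case (insert k K)
  then show ?case using matched_linear[of "f k" "\<lambda>s. \<Sum>k\<in>K. c k * f k s" "c k" 1] by simp
qed (auto simp: matched_zero)

text \<open>Higher powers are derivatives of resolvents in w. The difference quotients are linear
  combinations of matched functions, so the hypothesis at all w carries one power to the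
  next.\<close>

lemma matched_resolvent_power:
  assumes "0 < w"
  shows "matched (\<lambda>s. inverse (w + s) ^ Suc k)"
  using assms
proof (induction k arbitrary: w)
  case 0
  have "lsum (\<lambda>s. inverse (w + s) ^ Suc 0) = (\<lambda>x. \<Sum>i\<in>UNIV. 1 / (w + \<beta> x i))"
    by (simp add: lsum_def fun_eq_iff divide_inverse)
  moreover have "\<bar>inverse (w + s) ^ Suc 0\<bar> \<le> inverse w" if "0 \<le> s" for s using 0 that by simp
  moreover have "continuous_on {0..} (\<lambda>s. inverse (w + s) ^ Suc 0)"
    using 0 by (auto intro!: continuous_intros)
  ultimately show ?case unfolding matched_def
    using resolvent_measurable[OF 0] resolvent_integral[OF 0] by (auto simp: divide_inverse)
next
  case (Suc k)
  define m where "m = Suc k"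
  have m: "0 < m" by (simp add: m_def)
  define h where "h N = inverse (real (Suc N))" for N
  have h: "0 < h N" for N by (simp add: h_def)
  define F where "F N s = (1 / (m * h N)) * inverse (w + s) ^ m + (- 1 / (m * h N)) * inverse ((w + h N) + s) ^ m" for N s
  have F: "F N s = (inverse (w + s) ^ m - inverse (w + s + h N) ^ m) / (m * h N)" for N s
  proof -
    have "(1 / d) * A + (- 1 / d) * B = (A - B) / d" for A B d :: real by (simp add: diff_divide_distrib)
    moreover have "w + h N + s = w + s + h N" by simp
    ultimately show ?thesis by (simp only: F_def)
  qed
  have "matched (\<lambda>s. inverse (w + s) ^ Suc m)"
  proof (rule matched_limit[where F = F and C = "inverse w ^ Suc m"])
    show "matched (F N)" for N
      unfolding F_def m_def using Suc.prems h[of N] by (intro matched_linear Suc.IH) auto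
    show "\<bar>F N s\<bar> \<le> inverse w ^ Suc m" if s: "0 \<le> s" for N s
    proof -
      have ws: "0 < w + s" using Suc.prems s by simp
      have "inverse (w + s) ^ Suc m \<le> inverse w ^ Suc m"
        using Suc.prems s by (intro power_mono le_imp_inverse_le) auto
      then show ?thesis unfolding F using inverse_power_difference[OF ws h[of N] m] by linarith
    qed
    show "(\<lambda>N. F N s) \<longlonglongrightarrow> inverse (w + s) ^ Suc m" if s: "0 \<le> s" for s
      unfolding F h_def using Suc.prems s by (intro inverse_power_difference_tendsto m) auto
    show "continuous_on {0..} (\<lambda>s. inverse (w + s) ^ Suc m)"
      using Suc.prems by (intro continuous_intros) auto
  qed
  then show ?case by (simp only: m_def)
qed

text \<open>With u = 1 / (1 + s), factors 1 - u are multiplied out one at a time. At least one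
  factor u is kept throughout, since constants are not among the resolvent powers.\<close>

lemma matched_bernstein_monomial:
  "matched (\<lambda>s. inverse (1 + s) ^ Suc k * (1 - inverse (1 + s)) ^ m)"
proof (induction m arbitrary: k)
  case 0
  show ?case using matched_resolvent_power[of 1 k] by (simp only: power_0 mult_1_right zero_less_one)
next
  case (Suc m)
  have "matched (\<lambda>s. 1 * (inverse (1 + s) ^ Suc k * (1 - inverse (1 + s)) ^ m)
      + (- 1) * (inverse (1 + s) ^ Suc (Suc k) * (1 - inverse (1 + s)) ^ m))"
    by (rule matched_linear[OF Suc.IH[of k] Suc.IH[of "Suc k"]])
  also have "(\<lambda>s. 1 * (inverse (1 + s) ^ Suc k * (1 - inverse (1 + s)) ^ m)
      + (- 1) * (inverse (1 + s) ^ Suc (Suc k) * (1 - inverse (1 + s)) ^ m))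
      = (\<lambda>s::real. inverse (1 + s) ^ Suc k * (1 - inverse (1 + s)) ^ Suc m)"
  proof -
    have "1 * ((u * p) * q) + (- 1) * ((u * (u * p)) * q) = (u * p) * ((1 - u) * q)" for p q u :: real
      by (simp add: algebra_simps)
    then show ?thesis by (simp only: power_Suc)
  qed
  finally show ?case .
qed

text \<open>Bernstein polynomials of g approximate uniformly, and g 0 = 0 removes the only term
  without a factor u, so all remaining terms are covered by
  \<open>matched_bernstein_monomial\<close>.\<close>

lemma matched_compose_inverse:
  assumes g: "continuous_on {0..1} g" "g 0 = 0"
  shows "matched (\<lambda>s. g (inverse (1 + s)))"
proof -
  have "\<exists>n. \<forall>x\<in>{0..1}. \<bar>g x - bern g n x\<bar> < inverse (real (Suc N))" for N
  proof -
    have "0 < inverse (real (Suc N))" by simp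
    from Bernstein_Weierstrass[OF g(1) this] obtain M where
      "\<forall>n x. M \<le> n \<and> x \<in> {0..1} \<longrightarrow> \<bar>g x - bern g n x\<bar> < inverse (real (Suc N))" ..
    then show ?thesis by (intro exI[of _ M]) blast
  qed
  then obtain n where n: "\<And>N x. x \<in> {0..1} \<Longrightarrow> \<bar>g x - bern g (n N) x\<bar> < inverse (real (Suc N))"
    by metis
  have "compact (g ` {0..1})" by (intro compact_continuous_image g) auto
  then obtain C where "\<forall>y\<in>g ` {0..1}. norm y \<le> C"
    using compact_imp_bounded bounded_iff by blast
  then have C: "\<And>x. x \<in> {0..1} \<Longrightarrow> \<bar>g x\<bar> \<le> C" by auto
  have u: "inverse (1 + s) \<in> {0..1}" if "0 \<le> s" for s :: real
    using that by (auto simp: inverse_le_1_iff)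
  show ?thesis
  proof (rule matched_limit[where F = "\<lambda>N s. bern g (n N) (inverse (1 + s))" and C = "C + 1"])
    fix N :: nat
    have "matched (\<lambda>s. \<Sum>k\<in>{1..n N}. (g (k / n N) * (n N choose k)) * (inverse (1 + s) ^ k * (1 - inverse (1 + s)) ^ (n N - k)))"
    proof (rule matched_sum)
      fix k assume "k \<in> {1..n N}"
      then obtain l where "k = Suc l" by (cases k) auto
      then show "matched (\<lambda>s. inverse (1 + s) ^ k * (1 - inverse (1 + s)) ^ (n N - k))"
        using matched_bernstein_monomial[of l "n N - k"] by simp
    qed
    also have "(\<lambda>s. \<Sum>k\<in>{1..n N}. (g (k / n N) * (n N choose k)) * (inverse (1 + s) ^ k * (1 - inverse (1 + s)) ^ (n N - k)))
       = (\<lambda>s. bern g (n N) (inverse (1 + s)))"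
    proof
      fix s :: real
      have "bern g (n N) (inverse (1 + s))
          = (\<Sum>k\<in>{1..n N}. g (k / n N) * Bernstein (n N) k (inverse (1 + s)))"
      \<comment> \<open>The omitted index is k = 0, where the value is g 0; this includes degree 0,
        as 0 / 0 evaluates to 0.\<close>
      proof (rule sum.mono_neutral_right)
        show "\<forall>k\<in>{..n N} - {1..n N}. g (real k / real (n N)) * Bernstein (n N) k (inverse (1 + s)) = 0"
          using g(2) by (auto simp: not_less_eq_eq)
      qed auto
      then show "(\<Sum>k\<in>{1..n N}. (g (k / n N) * (n N choose k)) * (inverse (1 + s) ^ k * (1 - inverse (1 + s)) ^ (n N - k)))
        = bern g (n N) (inverse (1 + s))"
        by (simp add: Bernstein_def mult.assoc)
    qed
    finally show "matched (\<lambda>s. bern g (n N) (inverse (1 + s)))" .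
  next
    fix N :: nat and s :: real assume s: "0 \<le> s"
    have "inverse (real (Suc N)) \<le> 1" by (simp add: inverse_le_1_iff)
    then show "\<bar>bern g (n N) (inverse (1 + s))\<bar> \<le> C + 1"
      using n[OF u[OF s], of N] C[OF u[OF s]] by linarith
  next
    fix s :: real assume s: "0 \<le> s"
    show "(\<lambda>N. bern g (n N) (inverse (1 + s))) \<longlonglongrightarrow> g (inverse (1 + s))"
    proof (rule LIMSEQ_I)
      fix e :: real assume "0 < e"
      then obtain M where M: "inverse (real (Suc M)) < e" using reals_Archimedean by blast
      have "norm (bern g (n N) (inverse (1 + s)) - g (inverse (1 + s))) < e" if "M \<le> N" for N
      proof -
        have "inverse (real (Suc N)) \<le> inverse (real (Suc M))" using that by simp
        then show ?thesis using n[OF u[OF s], of N] M unfolding real_norm_def by (subst abs_minus_commute) linarith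
      qed
      then show "\<exists>M. \<forall>N\<ge>M. norm (bern g (n N) (inverse (1 + s)) - g (inverse (1 + s))) < e"
        by blast
    qed
  next
    show "continuous_on {0..} (\<lambda>s. g (inverse (1 + s)))"
      by (rule continuous_on_compose2[OF g(1)]) (use u in \<open>auto intro!: continuous_intros\<close>)
  qed
qed

text \<open>The substitution u = 1 / (1 + s) maps the half-line onto the interval from 0 (excluded)
  to 1. A function vanishing beyond K corresponds to one vanishing for u up to 1 / (1 + K), and
  extends continuously by 0 to u = 0.\<close>

lemma matched_compact_support:
  assumes f: "continuous_on {0..} f" and K: "0 < K" "\<And>s. K \<le> s \<Longrightarrow> f s = 0"
  shows "matched f"
proof -
  define g where "g u = (if u \<le> inverse (1 + K) then 0 else f (inverse u - 1))" for u
  have pos: "0 < u" if "inverse (1 + K) \<le> u" for u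
  proof -
    have "0 < 1 + K" using K(1) by linarith
    then show ?thesis using that by (metis inverse_positive_iff_positive less_le_trans)
  qed
  have K0: "0 < 1 + K" "1 < 1 + K" using K(1) by linarith+
  then have K1: "0 < inverse (1 + K)" "inverse (1 + K) < 1"
    by (metis inverse_positive_iff_positive, metis inverse_less_1_iff)
  have "continuous_on ({0..inverse (1 + K)} \<union> {inverse (1 + K)..1}) g"
    unfolding g_def
  proof (rule continuous_on_If)
    show "continuous_on {inverse (1 + K)..1} (\<lambda>u. f (inverse u - 1))"
    proof (rule continuous_on_compose2[OF f])
      show "continuous_on {inverse (1 + K)..1} (\<lambda>u. inverse u - 1)"
        using pos by (intro continuous_intros) (metis atLeastAtMost_iff less_irrefl)
      show "(\<lambda>u. inverse u - 1) ` {inverse (1 + K)..1} \<subseteq> {0..}"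
        using pos by (auto simp: one_le_inverse_iff)
    qed
    show "\<And>x. x \<in> {0..inverse (1 + K)} \<Longrightarrow> \<not> x \<le> inverse (1 + K) \<Longrightarrow> 0 = f (inverse x - 1)" by auto
    fix x assume "x \<in> {inverse (1 + K)..1}" "x \<le> inverse (1 + K)"
    then have "x = inverse (1 + K)" by auto
    then show "0 = f (inverse x - 1)" using K by simp
  qed auto
  also have "{0..inverse (1 + K)} \<union> {inverse (1 + K)..1} = {0..1}"
    by (rule ivl_disj_un_two_touch) (use K1 in linarith)+
  finally have "matched (\<lambda>s. g (inverse (1 + s)))"
    using K1 by (intro matched_compose_inverse) (auto simp: g_def)
  moreover have gf: "g (inverse (1 + s)) = f s" if "0 \<le> s" for s
    using that K by (auto simp: g_def)
  moreover have "lsum (\<lambda>s. g (inverse (1 + s))) = lsum f"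
    using gf \<beta>_nonneg by (auto simp: lsum_def fun_eq_iff intro!: sum.cong)
  moreover have "(\<lambda>s. ray s * W s * g (inverse (1 + s))) = (\<lambda>s. ray s * W s * f s)"
    using gf by (auto simp: fun_eq_iff split: split_indicator)
  ultimately show ?thesis using f unfolding matched_def by auto
qed

section \<open>From compact support to functions integrable against the density\<close>

definition cutoff :: "nat \<Rightarrow> real \<Rightarrow> real" where
  "cutoff N s = max 0 (min 1 (real N + 1 - s))"

lemma cutoff: "0 \<le> cutoff N s" "cutoff N s \<le> 1" "mono (\<lambda>N. cutoff N s)" "(\<lambda>N. cutoff N s) \<longlonglongrightarrow> 1"
proof -
  show "0 \<le> cutoff N s" "cutoff N s \<le> 1" by (auto simp: cutoff_def)
  show "mono (\<lambda>N. cutoff N s)" by (auto simp: mono_def cutoff_def)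
  obtain M :: nat where "s \<le> real M" using real_arch_simple by blast
  then have "\<forall>\<^sub>F N in sequentially. cutoff N s = 1"
    unfolding eventually_sequentially by (intro exI[of _ M]) (auto simp: cutoff_def)
  then show "(\<lambda>N. cutoff N s) \<longlonglongrightarrow> 1" by (rule tendsto_eventually)
qed

lemma matched_cutoff:
  assumes "continuous_on {0..} f"
  shows "matched (\<lambda>s. f s * cutoff N s)"
  by (rule matched_compact_support[where K = "real N + 1"])
    (use assms in \<open>auto intro!: continuous_intros simp: cutoff_def\<close>)

lemma integrable_lsum_cutoff:
  assumes "continuous_on {0..} f"
  shows "integrable \<nu> (lsum (\<lambda>s. f s * cutoff N s))"
proof -
  have "matched (\<lambda>s. f s * cutoff N s)" by (rule matched_cutoff[OF assms])
  then obtain C where "lsum (\<lambda>s. f s * cutoff N s) \<in> borel_measurable \<nu>" "\<And>s. 0 \<le> s \<Longrightarrow> \<bar>f s * cutoff N s\<bar> \<le> C"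
    by (auto simp: matched_def)
  then show ?thesis by (rule integrable_lsum)
qed

lemma weighted_cutoff_tendsto:
  assumes f: "continuous_on {0..} f" and int: "integrable lborel (\<lambda>s. ray s * W s * f s)"
  shows "(\<lambda>N. \<integral>x. lsum (\<lambda>s. f s * cutoff N s) x \<partial>\<nu>) \<longlonglongrightarrow> (\<integral>s. ray s * W s * f s \<partial>lborel)"
proof -
  have "(\<integral>x. lsum (\<lambda>s. f s * cutoff N s) x \<partial>\<nu>) = (\<integral>s. ray s * W s * (f s * cutoff N s) \<partial>lborel)" for N
    using matched_cutoff[OF f] by (auto simp: matched_def)
  moreover have "(\<lambda>N. \<integral>s. ray s * W s * (f s * cutoff N s) \<partial>lborel) \<longlonglongrightarrow> (\<integral>s. ray s * W s * f s \<partial>lborel)"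
  proof (rule integral_dominated_convergence[where w = "\<lambda>s. \<bar>ray s * W s * f s\<bar>"])
    show "integrable lborel (\<lambda>s. \<bar>ray s * W s * f s\<bar>)" using int by (rule integrable_abs)
    show "AE s in lborel. (\<lambda>N. ray s * W s * (f s * cutoff N s)) \<longlonglongrightarrow> ray s * W s * f s"
    proof (rule AE_I2)
      fix s
      have "(\<lambda>N. ray s * W s * (f s * cutoff N s)) \<longlonglongrightarrow> ray s * W s * (f s * 1)"
        by (intro tendsto_mult_left cutoff)
      then show "(\<lambda>N. ray s * W s * (f s * cutoff N s)) \<longlonglongrightarrow> ray s * W s * f s" by simp
    qed
    show "AE s in lborel. norm (ray s * W s * (f s * cutoff N s)) \<le> \<bar>ray s * W s * f s\<bar>" for N
      using cutoff(1,2)[of N] by (auto intro!: AE_I2 mult_left_le simp: abs_mult mult.assoc[symmetric])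
    show "(\<lambda>s. ray s * W s * (f s * cutoff N s)) \<in> borel_measurable lborel" for N
      using matched_cutoff[OF f, of N] by (intro measurable_weighted) (auto simp: matched_def)
  qed (use int in auto)
  ultimately show ?thesis by simp
qed

lemma lsum_cutoff_tendsto: "(\<lambda>N. lsum (\<lambda>s. f s * cutoff N s) x) \<longlonglongrightarrow> lsum f x"
proof -
  have "(\<lambda>N. lsum (\<lambda>s. f s * cutoff N s) x) \<longlonglongrightarrow> (\<Sum>i\<in>UNIV. f (\<beta> x i) * 1)"
    unfolding lsum_def by (intro tendsto_sum tendsto_mult_left cutoff)
  then show ?thesis by (simp add: lsum_def)
qed

text \<open>The cutoffs increase to 1, so monotone convergence for |f|, whose cut-off integrals
  converge by domination on the density side, first gives integrability. The sum for |f| then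
  dominates the cut-off sums for \<open>f\<close>.\<close>

theorem resolvent_determines:
  assumes f: "continuous_on {0..} f" and int: "integrable lborel (\<lambda>s. ray s * W s * f s)"
  shows "integrable \<nu> (\<lambda>x. \<Sum>i\<in>UNIV. f (\<beta> x i))"
    and "(\<integral>x. (\<Sum>i\<in>UNIV. f (\<beta> x i)) \<partial>\<nu>) = (\<integral>s. ray s * W s * f s \<partial>lborel)"
proof -
  have meas: "lsum f \<in> borel_measurable \<nu>"
    by (rule borel_measurable_LIMSEQ_real[OF lsum_cutoff_tendsto borel_measurable_integrable[OF integrable_lsum_cutoff[OF f]]])
  let ?g = "\<lambda>s. \<bar>f s\<bar>"
  have g: "continuous_on {0..} ?g" using f by (intro continuous_intros)
  have "integrable lborel (\<lambda>s. ray s * W s * ?g s)"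
  proof (rule Bochner_Integration.integrable_bound[OF int])
    show "(\<lambda>s. ray s * W s * ?g s) \<in> borel_measurable lborel" by (rule measurable_weighted[OF g])
    show "AE s in lborel. norm (ray s * W s * ?g s) \<le> norm (ray s * W s * f s)"
      by (rule AE_I2) (simp add: abs_mult)
  qed
  note gint = this
  have "integrable \<nu> (lsum ?g)"
  proof (rule integrable_monotone_convergence[OF integrable_lsum_cutoff[OF g]])
    show "AE x in \<nu>. mono (\<lambda>N. lsum (\<lambda>s. ?g s * cutoff N s) x)"
      by (rule AE_I2, unfold mono_def lsum_def, intro allI impI sum_mono mult_left_mono monoD[OF cutoff(3)] abs_ge_zero)
    show "AE x in \<nu>. (\<lambda>N. lsum (\<lambda>s. ?g s * cutoff N s) x) \<longlonglongrightarrow> lsum ?g x"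
      by (rule AE_I2) (rule lsum_cutoff_tendsto)
    show "(\<lambda>N. \<integral>x. lsum (\<lambda>s. ?g s * cutoff N s) x \<partial>\<nu>) \<longlonglongrightarrow> (\<integral>s. ray s * W s * ?g s \<partial>lborel)"
      by (rule weighted_cutoff_tendsto[OF g gint])
    show "lsum ?g \<in> borel_measurable \<nu>"
      by (rule borel_measurable_LIMSEQ_real[OF lsum_cutoff_tendsto borel_measurable_integrable[OF integrable_lsum_cutoff[OF g]]])
  qed
  note ig = this
  have bound: "\<bar>lsum (\<lambda>s. f s * cutoff N s) x\<bar> \<le> lsum ?g x" for N x
    unfolding lsum_def using cutoff(1,2)[of N]
    by (intro order_trans[OF sum_abs] sum_mono) (auto simp: abs_mult intro!: mult_left_le)
  have bound': "\<bar>lsum f x\<bar> \<le> lsum ?g x" for x unfolding lsum_def by (rule sum_abs)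
  have "integrable \<nu> (lsum f)"
  proof (rule Bochner_Integration.integrable_bound[OF ig meas], rule AE_I2)
    fix x
    show "norm (lsum f x) \<le> norm (lsum ?g x)"
      unfolding real_norm_def using bound'[of x] by (rule order_trans[OF _ abs_ge_self])
  qed
  then show "integrable \<nu> (\<lambda>x. \<Sum>i\<in>UNIV. f (\<beta> x i))" by (simp add: lsum_def[abs_def])
  have "(\<lambda>N. \<integral>x. lsum (\<lambda>s. f s * cutoff N s) x \<partial>\<nu>) \<longlonglongrightarrow> (\<integral>x. lsum f x \<partial>\<nu>)"
  proof (rule integral_dominated_convergence[where w = "lsum ?g", OF meas _ ig])
    show "lsum (\<lambda>s. f s * cutoff N s) \<in> borel_measurable \<nu>" for N
      by (rule borel_measurable_integrable[OF integrable_lsum_cutoff[OF f]])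
    show "AE x in \<nu>. (\<lambda>N. lsum (\<lambda>s. f s * cutoff N s) x) \<longlonglongrightarrow> lsum f x"
      by (rule AE_I2) (rule lsum_cutoff_tendsto)
    show "AE x in \<nu>. norm (lsum (\<lambda>s. f s * cutoff N s) x) \<le> lsum ?g x" for N
      by (rule AE_I2) (simp only: real_norm_def bound)
  qed
  with weighted_cutoff_tendsto[OF f int] have "(\<integral>x. lsum f x \<partial>\<nu>) = (\<integral>s. ray s * W s * f s \<partial>lborel)"
    using LIMSEQ_unique by blast
  then show "(\<integral>x. (\<Sum>i\<in>UNIV. f (\<beta> x i)) \<partial>\<nu>) = (\<integral>s. ray s * W s * f s \<partial>lborel)"
    by (simp add: lsum_def)
qed

end

section \<open>Lagrange coefficients and Cramer's rule\<close>

text \<open>The coefficient of \<open>x^j\<close> in the Lagrange basis polynomial of the node \<open>a i\<close>, written through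
  elementary symmetric functions of the other nodes.\<close>

definition lcoeff :: "('n::finite \<Rightarrow> real) \<Rightarrow> 'n \<Rightarrow> nat \<Rightarrow> real" where
  "lcoeff a i j = (- 1) ^ (CARD('n) - 1 - j) * coeff (epoly a (- {i})) (CARD('n) - 1 - j) / (\<Prod>l\<in>-{i}. a i - a l)"

lemma poly_as_sum_bound:
  fixes p :: "real poly"
  assumes "degree p < n"
  shows "poly p x = (\<Sum>m<n. coeff p m * x ^ m)"
  unfolding poly_altdef
  by (rule sum.mono_neutral_left) (use assms in \<open>auto simp: not_le intro: coeff_eq_0\<close>)

lemma degree_epoly_remove: "degree (epoly a (- {i})) < CARD('n)" for i :: "'n::finite"
proof -
  have "card (- {i}) < CARD('n)" by (intro psubset_card_mono) auto
  then show ?thesis using degree_epoly[of a "- {i}"] by linarith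
qed

text \<open>\<open>epoly\<close> is the reversal, up to signs, of the monic polynomial with roots
  \<open>a l\<close>; evaluating at -1 / a k undoes the reversal.\<close>

lemma poly_epoly_at_node:
  fixes a :: "'n::finite \<Rightarrow> real"
  assumes "a k \<noteq> 0"
  shows "a k ^ (CARD('n) - 1) * poly (epoly a (- {i})) (- 1 / a k) = (\<Prod>l\<in>-{i}. a k - a l)"
proof -
  have c: "card (- {i}) = CARD('n) - 1" by (simp add: Compl_eq_Diff_UNIV card_Diff_singleton)
  have "(\<Prod>l\<in>-{i}. a k - a l) = (\<Prod>l\<in>-{i}. a k * (1 + (- 1 / a k) * a l))"
    using assms by (intro prod.cong refl) (simp add: field_simps)
  then show ?thesis by (simp add: prod.distrib poly_epoly c)
qed

lemma prod_diff_nonzero: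
  fixes a :: "'n::finite \<Rightarrow> real"
  assumes "inj a"
  shows "(\<Prod>l\<in>-{i}. a i - a l) \<noteq> 0"
  using assms by (auto simp: inj_eq)

text \<open>Reversing the order of summation recovers \<open>epoly\<close> at -1 / a k, and
  \<open>poly_epoly_at_node\<close> turns this into the usual Lagrange quotient of products of
  differences.\<close>

lemma sum_lcoeff_power:
  fixes a :: "'n::finite \<Rightarrow> real"
  assumes inj: "inj a" and pos: "\<And>i. a i \<noteq> 0"
  shows "(\<Sum>j<CARD('n). lcoeff a i j * a k ^ j) = (if i = k then 1 else 0)"
proof -
  let ?n = "CARD('n)" and ?E = "epoly a (- {i})" and ?D = "\<Prod>l\<in>-{i}. a i - a l"
  have "(\<Sum>j<?n. lcoeff a i j * a k ^ j) = (\<Sum>m<?n. lcoeff a i (?n - Suc m) * a k ^ (?n - Suc m))"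
    by (rule sum.nat_diff_reindex[symmetric])
  also have "\<dots> = (\<Sum>m<?n. a k ^ (?n - 1) * (coeff ?E m * (- 1 / a k) ^ m) / ?D)"
  proof (intro sum.cong refl)
    fix m assume "m \<in> {..<?n}"
    then have m: "?n - 1 - (?n - Suc m) = m" "?n - 1 = (?n - Suc m) + m" by auto
    have "a k ^ (?n - 1) * (- 1 / a k) ^ m = a k ^ (?n - Suc m) * (a k * (- 1 / a k)) ^ m"
      unfolding m(2) by (simp only: power_add power_mult_distrib mult.assoc)
    also have "a k * (- 1 / a k) = - 1" using pos[of k] by simp
    finally have "a k ^ (?n - 1) * (- 1 / a k) ^ m = a k ^ (?n - Suc m) * (- 1) ^ m" .
    then have "a k ^ (?n - 1) * (coeff ?E m * (- 1 / a k) ^ m) = a k ^ (?n - Suc m) * (- 1) ^ m * coeff ?E m"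
      by (metis mult.assoc mult.commute)
    then show "lcoeff a i (?n - Suc m) * a k ^ (?n - Suc m) = a k ^ (?n - 1) * (coeff ?E m * (- 1 / a k) ^ m) / ?D"
      unfolding lcoeff_def m(1) by (simp only: divide_inverse mult_ac)
  qed
  also have "\<dots> = a k ^ (?n - 1) * poly ?E (- 1 / a k) / ?D"
    by (simp only: poly_as_sum_bound[OF degree_epoly_remove] sum_distrib_left sum_divide_distrib)
  also have "\<dots> = (\<Prod>l\<in>-{i}. a k - a l) / ?D" unfolding poly_epoly_at_node[where a = a and k = k, OF pos] ..
  also have "\<dots> = (if i = k then 1 else 0)"
  proof (cases "i = k")
    case True
    then show ?thesis using prod_diff_nonzero[OF inj, of i] by simp
  next
    case False
    then have "(\<Prod>l\<in>-{i}. a k - a l) = 0" by (intro prod_zero) auto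
    then show ?thesis using False by simp
  qed
  finally show ?thesis .
qed

text \<open>e_s of all nodes is e_s plus a_k e_(s-1) of the nodes other than k; after weighting by
  (-1 / a_k)^s consecutive terms cancel.\<close>

lemma sum_coeff_epoly_telescope:
  fixes a :: "'n::finite \<Rightarrow> real"
  assumes "a k \<noteq> 0"
  shows "(\<Sum>s<Suc M. coeff (epoly a UNIV) s * (- 1 / a k) ^ s) = coeff (epoly a (- {k})) M * (- 1 / a k) ^ M"
proof -
  have e: "epoly a UNIV = epoly a (- {k}) + smult (a k) (pCons 0 (epoly a (- {k})))"
    using epoly_remove[of UNIV k a] by (simp add: Compl_eq_Diff_UNIV)
  show ?thesis
  proof (induction M)
    case 0
    show ?case by (simp add: e)
  next
    case (Suc M)
    have "(\<Sum>s<Suc (Suc M). coeff (epoly a UNIV) s * (- 1 / a k) ^ s)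
      = coeff (epoly a (- {k})) M * (- 1 / a k) ^ M + coeff (epoly a UNIV) (Suc M) * (- 1 / a k) ^ Suc M"
      by (simp only: sum.lessThan_Suc[of _ "Suc M"] Suc.IH)
    also have "coeff (epoly a UNIV) (Suc M) = coeff (epoly a (- {k})) (Suc M) + a k * coeff (epoly a (- {k})) M"
      by (simp add: e)
    finally show ?case using assms by (simp add: algebra_simps)
  qed
qed

text \<open>A partial fraction expansion in r. After clearing denominators both sides are
  polynomials of degree below n, and they agree at the n distinct poles -1 / a k.\<close>

lemma sum_lcoeff_partial_fraction:
  fixes a :: "'n::finite \<Rightarrow> real"
  assumes inj: "inj a" and pos: "\<And>i. 0 < a i" and j: "j < CARD('n)" and r: "0 \<le> r"
  shows "(\<Sum>i\<in>UNIV. lcoeff a i j * a i ^ j / (1 + r * a i))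
    = char_inv a r * (\<Sum>s<CARD('n) - j. coeff (epoly a UNIV) s * r ^ s)"
proof -
  let ?n = "CARD('n)"
  define M where "M = ?n - 1 - j"
  have M: "?n - j = Suc M" "?n - 1 = M + j" using j by (auto simp: M_def)
  have nz: "a i \<noteq> 0" for i using pos[of i] by simp
  have p1: "0 < 1 + r * a i" for i using pos[of i] r by (simp add: add_pos_nonneg)
  define P where "P = (\<Sum>i\<in>UNIV. smult (lcoeff a i j * a i ^ j) (epoly a (- {i})))"
  define Q where "Q = (\<Sum>s<Suc M. monom (coeff (epoly a UNIV) s) s)"
  have PQ: "P = Q"
  proof (rule poly_eqI_degree)
    let ?A = "range (\<lambda>k. - 1 / a k)"
    have card: "card ?A = ?n"
      using inj nz by (intro card_image) (auto simp: inj_on_def dest: injD)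
    have "degree P \<le> ?n - 1" unfolding P_def
    proof (rule degree_sum_le)
      show "degree (smult (lcoeff a i j * a i ^ j) (epoly a (- {i}))) \<le> ?n - 1" for i
        using degree_smult_le[of "lcoeff a i j * a i ^ j" "epoly a (- {i})"] degree_epoly_remove[of a i] by linarith
    qed simp
    then show "degree P < card ?A" unfolding card by (rule le_less_trans) simp
    have "degree Q \<le> M" unfolding Q_def
    proof (rule degree_sum_le)
      show "s \<in> {..<Suc M} \<Longrightarrow> degree (monom (coeff (epoly a UNIV) s) s) \<le> M" for s
        using degree_monom_le[of "coeff (epoly a UNIV) s" s] by simp
    qed simp
    then show "degree Q < card ?A" unfolding card using M by linarith
    fix x assume "x \<in> ?A"
    then obtain k where x: "x = - 1 / a k" by auto
    \<comment> \<open>Every summand with i different from k still contains the factor 1 + x a_k,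
      which vanishes at this node.\<close>
    have "poly (epoly a (- {i})) x = 0" if "i \<noteq> k" for i
      unfolding poly_epoly x using nz[of k] that by (intro prod_zero bexI[of _ k]) auto
    then have "poly P x = lcoeff a k j * a k ^ j * poly (epoly a (- {k})) x"
      unfolding P_def poly_sum poly_smult by (subst sum.remove[of _ k]) auto
    also have "\<dots> = (- 1) ^ M * coeff (epoly a (- {k})) M * (a k ^ j * poly (epoly a (- {k})) x / (\<Prod>l\<in>-{k}. a k - a l))"
      unfolding lcoeff_def M_def by simp
    also have "a k ^ j * poly (epoly a (- {k})) x / (\<Prod>l\<in>-{k}. a k - a l) = 1 / a k ^ M"
    proof -
      let ?D = "\<Prod>l\<in>-{k}. a k - a l"
      have "a k ^ M * (a k ^ j * poly (epoly a (- {k})) x) = ?D"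
        using poly_epoly_at_node[of a k k, OF nz] by (simp only: x M(2) power_add mult.assoc)
      then have "a k ^ M * (a k ^ j * poly (epoly a (- {k})) x / ?D) = 1"
        using prod_diff_nonzero[OF inj, of k] by (simp only: times_divide_eq_right divide_self_if if_False)
      moreover have "Y = 1 / A" if "A * Y = 1" for A Y :: real using that by (auto simp: eq_divide_eq mult.commute)
      ultimately show ?thesis by blast
    qed
    also have "(- 1) ^ M * coeff (epoly a (- {k})) M * (1 / a k ^ M) = coeff (epoly a (- {k})) M * (- 1 / a k) ^ M"
      unfolding power_divide by (simp add: mult.commute)
    also have "\<dots> = poly Q x"
      unfolding Q_def poly_sum poly_monom x
      by (rule sum_coeff_epoly_telescope[where a = a and k = k, OF nz, symmetric])
    finally show "poly P x = poly Q x" .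
  qed
  have "(\<Sum>i\<in>UNIV. lcoeff a i j * a i ^ j / (1 + r * a i))
      = (\<Sum>i\<in>UNIV. char_inv a r * (lcoeff a i j * a i ^ j * poly (epoly a (- {i})) r))"
  proof (intro sum.cong refl)
    fix i
    have "char_inv a r = inverse (1 + r * a i) * (\<Prod>l\<in>-{i}. inverse (1 + r * a l))"
      by (subst prod.remove[of _ i]) (auto simp: Compl_eq_Diff_UNIV)
    moreover have "(\<Prod>l\<in>-{i}. inverse (1 + r * a l)) * poly (epoly a (- {i})) r = 1"
      unfolding poly_epoly prod.distrib[symmetric] using p1 by (intro prod.neutral) (simp add: less_imp_neq[THEN not_sym])
    ultimately show "lcoeff a i j * a i ^ j / (1 + r * a i)
        = char_inv a r * (lcoeff a i j * a i ^ j * poly (epoly a (- {i})) r)"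
      by (simp add: divide_inverse mult_ac)
  qed
  also have "\<dots> = char_inv a r * poly P r"
    by (simp add: P_def poly_sum sum_distrib_left)
  also have "poly P r = (\<Sum>s<?n - j. coeff (epoly a UNIV) s * r ^ s)"
    unfolding PQ Q_def M(1) by (simp only: poly_sum poly_monom)
  finally show ?thesis .
qed

text \<open>Sort the truncated product by powers of w r: the coefficient of (w r)^j / j! is
  \<open>epoly\<close> cut at degree n - j, exactly the numerator expanded by
  \<open>sum_lcoeff_partial_fraction\<close>.\<close>

lemma rtrans_lagrange:
  fixes a :: "'n::finite \<Rightarrow> real"
  assumes inj: "inj a" and pos: "\<And>i. 0 < a i" and r: "0 \<le> r"
  shows "rtrans a w r = (\<Sum>i\<in>UNIV. \<Sum>j<CARD('n). lcoeff a i j / fact j *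
    (exp (- w * r) * (w * r * a i) ^ j / (1 + r * a i)))"
proof -
  let ?n = "CARD('n)"
  let ?e = "\<lambda>s. coeff (epoly a UNIV) s * r ^ s" and ?H = "\<Prod>i\<in>UNIV. inverse (1 + r * a i)"
  let ?u = "\<lambda>j. (w * r) ^ j / fact j"
  have "(\<Sum>d<?n. exp_part w r d (epoly a UNIV)) = (\<Sum>d<?n. \<Sum>m\<le>d. ?e m * ?u (d - m))"
    by (simp only: exp_part_eq)
  also have "\<dots> = (\<Sum>(m, j)\<in>{(m, j). m + j < ?n}. ?e m * ?u j)"
    by (rule sum.triangle_reindex[symmetric])
  also have "{(m, j). m + j < ?n} = prod.swap ` (SIGMA j:{..<?n}. {..<?n - j})"
    by (auto simp: image_iff)
  also have "(\<Sum>(m, j)\<in>prod.swap ` (SIGMA j:{..<?n}. {..<?n - j}). ?e m * ?u j)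
      = (\<Sum>(j, m)\<in>(SIGMA j:{..<?n}. {..<?n - j}). ?e m * ?u j)"
    by (subst sum.reindex) (auto simp: case_prod_unfold)
  also have "\<dots> = (\<Sum>j<?n. \<Sum>m<?n - j. ?e m * ?u j)" by (subst sum.Sigma) auto
  finally have q: "(\<Sum>d<?n. exp_part w r d (epoly a UNIV)) = (\<Sum>j<?n. ?u j * (\<Sum>m<?n - j. ?e m))"
    by (simp add: sum_distrib_left mult.commute)
  have "rtrans a w r = exp (- w * r) * (\<Sum>j<?n. ?u j * (?H * (\<Sum>m<?n - j. ?e m)))"
    unfolding rtrans_def q by (simp add: sum_distrib_left mult_ac)
  also have "\<dots> = exp (- w * r) * (\<Sum>j<?n. ?u j * (\<Sum>i\<in>UNIV. lcoeff a i j * a i ^ j / (1 + r * a i)))"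
    by (simp add: sum_lcoeff_partial_fraction[where a = a, OF inj pos _ r])
  also have "\<dots> = (\<Sum>j<?n. \<Sum>i\<in>UNIV. lcoeff a i j / fact j * (exp (- w * r) * (w * r * a i) ^ j / (1 + r * a i)))"
    by (simp add: sum_distrib_left power_mult_distrib mult_ac)
  finally show ?thesis by (subst sum.swap)
qed

section \<open>Determinants indexed by natural numbers, and Cramer's rule\<close>

lemma det_nat_conv_det:
  fixes \<sigma> :: "'n::finite \<Rightarrow> nat"
  assumes \<sigma>: "bij_betw \<sigma> UNIV {..<n}"
  shows "det_nat n M = det (\<chi> i j. M (\<sigma> i) (\<sigma> j))"
proof -
  have inj: "inj \<sigma>" using \<sigma> by (simp add: bij_betw_def)
  have im: "range \<sigma> = {..<n}" using \<sigma> by (simp add: bij_betw_def)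
  let ?\<tau> = "inv_into UNIV \<sigma>"
  have \<tau>: "bij_betw ?\<tau> {..<n} UNIV" using bij_betw_inv_into[OF \<sigma>] .
  have "det (\<chi> i j. M (\<sigma> i) (\<sigma> j)) = (\<Sum>p | p permutes (UNIV::'n set). of_int (sign p) * (\<Prod>i\<in>UNIV. M (\<sigma> i) (\<sigma> (p i))))"
    by (simp add: det_def)
  also have "\<dots> = (\<Sum>q | q permutes {..<n}. of_int (sign q) * (\<Prod>j<n. M j (q j)))"
  \<comment> \<open>Rows and columns are relabelled by the same bijection, so permutations are
    conjugated and keep their sign.\<close>
  proof (rule sum.reindex_bij_witness[where j = "map_permutation UNIV \<sigma>" and i = "map_permutation {..<n} ?\<tau>"])
    fix p assume "p \<in> {p. p permutes (UNIV::'n set)}"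
    then have p: "p permutes UNIV" by simp
    show "map_permutation {..<n} ?\<tau> (map_permutation UNIV \<sigma> p) = p"
      by (rule map_permutation_compose_inv[OF \<sigma> p]) (simp add: inj)
    show "map_permutation UNIV \<sigma> p \<in> {q. q permutes {..<n}}"
      using map_permutation_permutes[OF \<sigma> p] by simp
    have "sign (map_permutation UNIV \<sigma> p) = sign p"
      by (rule sign_map_permutation) (use p inj in auto)
    moreover have "(\<Prod>j<n. M j (map_permutation UNIV \<sigma> p j)) = (\<Prod>i\<in>UNIV. M (\<sigma> i) (\<sigma> (p i)))"
      by (rule prod.reindex_bij_betw[OF \<sigma>, symmetric, THEN trans])
        (simp add: map_permutation_apply[OF inj])
    ultimately show "of_int (sign (map_permutation UNIV \<sigma> p)) * (\<Prod>j<n. M j (map_permutation UNIV \<sigma> p j))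
        = of_int (sign p) * (\<Prod>i\<in>UNIV. M (\<sigma> i) (\<sigma> (p i)))" by simp
  next
    fix q assume "q \<in> {q. q permutes {..<n}}"
    then have q: "q permutes {..<n}" by simp
    show "map_permutation UNIV \<sigma> (map_permutation {..<n} ?\<tau> q) = q"
      by (rule map_permutation_compose_inv[OF \<tau> q]) (simp add: f_inv_into_f im)
    show "map_permutation {..<n} ?\<tau> q \<in> {p. p permutes UNIV}"
      using map_permutation_permutes[OF \<tau> q] by simp
  qed
  finally show ?thesis by (simp add: det_nat_def)
qed

text \<open>Cramer's rule: replacing the row of the \<open>j\<close>-th powers by a vector \<open>g\<close> extracts the \<open>j\<close>-th
  coefficient of the polynomial interpolating \<open>g\<close>.\<close>

lemma det_replace_power_row:
  fixes a :: "'n::finite \<Rightarrow> real" and g :: "'n \<Rightarrow> real" and e :: "'n \<Rightarrow> nat"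
  assumes inj: "inj a" and pos: "\<And>i. a i \<noteq> 0" and e: "bij_betw e UNIV {..<CARD('n)}"
  shows "det (\<chi> r i. a i ^ e r) \<noteq> 0"
    and "det (\<chi> r i. if r = k then g i else a i ^ e r) / det (\<chi> r i. a i ^ e r) = (\<Sum>i\<in>UNIV. lcoeff a i (e k) * g i)"
proof -
  define A :: "real^'n^'n" where "A = (\<chi> i r. a i ^ e r)"
  define C :: "real^'n^'n" where "C = (\<chi> r i. lcoeff a i (e r))"
  have "(A ** C) $ k $ i = (mat 1 :: real^'n^'n) $ k $ i" for k i
  proof -
    have "(A ** C) $ k $ i = (\<Sum>r\<in>UNIV. lcoeff a i (e r) * a k ^ e r)"
      by (simp add: A_def C_def matrix_matrix_mult_def mult.commute)
    also have "\<dots> = (\<Sum>j<CARD('n). lcoeff a i j * a k ^ j)"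
      by (rule sum.reindex_bij_betw[OF e])
    also have "\<dots> = (mat 1 :: real^'n^'n) $ k $ i"
      using sum_lcoeff_power[where a = a and i = i and k = k, OF inj pos] by (simp add: mat_def)
    finally show ?thesis .
  qed
  \<comment> \<open>Lagrange interpolation inverts the Vandermonde matrix, which also shows that its
    determinant is nonzero.\<close>
  then have AC: "A ** C = mat 1" by (simp add: vec_eq_iff)
  then have "det A * det C = 1" by (metis det_mul det_I)
  then have d0: "det A \<noteq> 0" by auto
  have tA: "det (\<chi> r i. a i ^ e r) = det A"
    using det_transpose[of A] by (simp add: transpose_def A_def)
  then show "det (\<chi> r i. a i ^ e r) \<noteq> 0" using d0 by simp
  have "A *v (C *v (\<chi> i. g i)) = (\<chi> i. g i)" by (simp add: matrix_vector_mul_assoc AC)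
  then have "C *v (\<chi> i. g i) = (\<chi> k. det (\<chi> i j. if j = k then (\<chi> i. g i) $ i else A $ i $ j) / det A)"
    using cramer[OF d0] by blast
  then have "(C *v (\<chi> i. g i)) $ k = det (\<chi> i j. if j = k then g i else A $ i $ j) / det A"
    by (simp cong: if_cong)
  also have "det (\<chi> i j. if j = k then g i else A $ i $ j) = det (\<chi> r i. if r = k then g i else a i ^ e r)"
    using det_transpose[of "\<chi> i j. if j = k then g i else A $ i $ j"] by (simp add: transpose_def A_def cong: if_cong)
  finally show "det (\<chi> r i. if r = k then g i else a i ^ e r) / det (\<chi> r i. a i ^ e r) = (\<Sum>i\<in>UNIV. lcoeff a i (e k) * g i)"
    by (simp add: tA C_def matrix_vector_mult_def)
qed

text \<open>Row k carries the exponent n - 1 - k, a reversal of {..<n}. Hence the sum over replaced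
  rows is a sum over all exponents j, and the power and factorial of the replacing row follow that
  exponent.\<close>

lemma sum_det_T_mat:
  fixes a :: "'n::finite \<Rightarrow> real" and \<sigma> :: "'n \<Rightarrow> nat"
  assumes inj: "inj a" and pos: "\<And>i. a i \<noteq> 0" and \<sigma>: "bij_betw \<sigma> UNIV {..<n}" and n: "n = CARD('n)"
    and d: "\<And>i. d (\<sigma> i) = a i"
  shows "1 / det_nat n (vandermonde n d) * (\<Sum>k<n. det_nat n (T_mat n f d k))
    = (\<Sum>i\<in>UNIV. \<Sum>j<n. lcoeff a i j / fact j * (LBINT t:{0..}. exp (- t) * (t * a i) ^ j * f (t * a i)))"
proof -
  let ?e = "\<lambda>r. n - Suc (\<sigma> r)" and ?I = "\<lambda>i j. LBINT t:{0..}. exp (- t) * (t * a i) ^ j * f (t * a i)"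
  have rev: "bij_betw (\<lambda>k. n - Suc k) {..<n} {..<n}"
    by (rule bij_betw_byWitness[where f' = "\<lambda>k. n - Suc k"]) auto
  have e: "bij_betw ?e UNIV {..<CARD('n)}"
    using bij_betw_trans[OF \<sigma> rev] by (simp add: o_def n)
  have V: "det_nat n (vandermonde n d) = det (\<chi> r i. a i ^ ?e r)"
    by (simp add: det_nat_conv_det[OF \<sigma>] vandermonde_def d)
  have T: "det_nat n (T_mat n f d (\<sigma> k)) = det (\<chi> r i. if r = k then ?I i (?e k) / fact (?e k) else a i ^ ?e r)" for k
  proof -
    have "\<sigma> r = \<sigma> k \<longleftrightarrow> r = k" for r using \<sigma> by (auto simp: bij_betw_def inj_eq)
    then show ?thesis
      by (simp add: det_nat_conv_det[OF \<sigma>] T_mat_def vandermonde_def f_aux_def d cong: if_cong)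
  qed
  have "1 / det_nat n (vandermonde n d) * (\<Sum>k<n. det_nat n (T_mat n f d k))
      = (\<Sum>k\<in>UNIV. det_nat n (T_mat n f d (\<sigma> k)) / det_nat n (vandermonde n d))"
    unfolding sum.reindex_bij_betw[OF \<sigma>, symmetric] by (simp add: sum_divide_distrib)
  also have "\<dots> = (\<Sum>k\<in>UNIV. \<Sum>i\<in>UNIV. lcoeff a i (?e k) * (?I i (?e k) / fact (?e k)))"
    unfolding V T det_replace_power_row(2)[where a = a, OF inj pos e] ..
  also have "\<dots> = (\<Sum>i\<in>UNIV. \<Sum>k\<in>UNIV. lcoeff a i (?e k) * (?I i (?e k) / fact (?e k)))"
    by (rule sum.swap)
  also have "\<dots> = (\<Sum>i\<in>UNIV. \<Sum>j<CARD('n). lcoeff a i j * (?I i j / fact j))"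
    by (intro sum.cong refl) (rule sum.reindex_bij_betw[OF e])
  finally show ?thesis by (simp add: n)
qed

section \<open>Scaling and integrability on the half-line\<close>

lemma integral_scale_Ici:
  fixes g :: "real \<Rightarrow> real"
  assumes c: "0 < c"
  shows "(\<integral>s. ray s * g s \<partial>lborel) = c * (\<integral>t. ray t * g (c * t) \<partial>lborel)"
    and "integrable lborel (\<lambda>s. ray s * g s) \<longleftrightarrow> integrable lborel (\<lambda>t. ray t * g (c * t))"
proof -
  have i: "ray (0 + c * t) = (ray t :: real)" for t
    using c by (auto simp: indicator_def zero_le_mult_iff)
  show "(\<integral>s. ray s * g s \<partial>lborel) = c * (\<integral>t. ray t * g (c * t) \<partial>lborel)"
    using lborel_integral_real_affine[of c "\<lambda>s. ray s * g s" 0] c by (simp only: i) simp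
  show "integrable lborel (\<lambda>s. ray s * g s) \<longleftrightarrow> integrable lborel (\<lambda>t. ray t * g (c * t))"
    using lborel_integrable_real_affine_iff[of c "\<lambda>s. ray s * g s" 0] c by (simp only: i) simp
qed

lemma integrable_power_exp_Ici:
  assumes "0 < c"
  shows "integrable lborel (\<lambda>s. ray s * (s ^ k * exp (- c * s)) :: real)"
proof -
  have "integrable lborel (\<lambda>s. ray s * (s ^ k * exp (- s)) :: real)"
  proof (rule integrableI_nonneg)
    have "(\<integral>\<^sup>+s. ennreal (ray s * (s ^ k * exp (- s))) \<partial>lborel)
        = (\<integral>\<^sup>+s. ennreal (s ^ k * exp (- s)) * indicator {0..} s \<partial>lborel)"
      by (intro nn_integral_cong) (auto split: split_indicator)
    also have "\<dots> < \<infinity>" by (simp only: nn_intergal_power_times_exp_Ici) simp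
    finally show "(\<integral>\<^sup>+s. ennreal (ray s * (s ^ k * exp (- s))) \<partial>lborel) < \<infinity>" .
  qed (auto split: split_indicator)
  then have "integrable lborel (\<lambda>s. ray s * ((c * s) ^ k * exp (- (c * s))) :: real)"
    by (subst (asm) integral_scale_Ici(2)[OF assms])
  then have "integrable lborel (\<lambda>s. (1 / c ^ k) * (ray s * ((c * s) ^ k * exp (- (c * s)))) :: real)"
    by (rule integrable_mult_right)
  also have "(\<lambda>s. (1 / c ^ k) * (ray s * ((c * s) ^ k * exp (- (c * s)))) :: real)
      = (\<lambda>s. ray s * (s ^ k * exp (- c * s)))"
    using assms by (auto simp: fun_eq_iff power_mult_distrib)
  finally show ?thesis .
qed

text \<open>The square integrability of \<open>f\<close> enters through |s^k f(s)| \<le> s^(2k) +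
  f(s)^2, both terms being integrable at the same exponential rate.\<close>

lemma integrable_power_exp_mult_Ici:
  fixes f :: "real \<Rightarrow> real"
  assumes c: "0 < c" and cont: "continuous_on {0..} f"
    and L2: "(\<integral>\<^sup>+t. ennreal (exp (- c * t) * (f t)\<^sup>2) * indicator {0..} t \<partial>lborel) < \<infinity>"
  shows "integrable lborel (\<lambda>s. ray s * (s ^ k * exp (- c * s) * f s))"
proof (rule Bochner_Integration.integrable_bound)
  have meas: "(\<lambda>s. ray s *\<^sub>R (g s)) \<in> borel_measurable borel" if "continuous_on {0..} g" for g :: "real \<Rightarrow> real"
    using that by (intro borel_measurable_continuous_on_indicator) auto
  have m2: "(\<lambda>s. ray s * (exp (- c * s) * (f s)\<^sup>2)) \<in> borel_measurable borel"
  proof -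
    have "continuous_on {0..} (\<lambda>s. exp (- c * s) * (f s)\<^sup>2)" by (intro continuous_intros cont)
    from meas[OF this] show ?thesis by simp
  qed
  have "integrable lborel (\<lambda>s. ray s * (exp (- c * s) * (f s)\<^sup>2))"
  proof (rule integrableI_nonneg)
    have "(\<integral>\<^sup>+s. ennreal (ray s * (exp (- c * s) * (f s)\<^sup>2)) \<partial>lborel)
        = (\<integral>\<^sup>+t. ennreal (exp (- c * t) * (f t)\<^sup>2) * indicator {0..} t \<partial>lborel)"
      by (intro nn_integral_cong) (auto split: split_indicator)
    then show "(\<integral>\<^sup>+s. ennreal (ray s * (exp (- c * s) * (f s)\<^sup>2)) \<partial>lborel) < \<infinity>" using L2 by simp
  qed (use m2 in \<open>auto split: split_indicator\<close>)
  then show "integrable lborel (\<lambda>s. ray s * (s ^ (2 * k) * exp (- c * s)) + ray s * (exp (- c * s) * (f s)\<^sup>2))"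
    by (intro Bochner_Integration.integrable_add integrable_power_exp_Ici c)
  show "(\<lambda>s. ray s * (s ^ k * exp (- c * s) * f s)) \<in> borel_measurable lborel"
  proof -
    have "continuous_on {0..} (\<lambda>s. s ^ k * exp (- c * s) * f s)" by (intro continuous_intros cont)
    from meas[OF this] show ?thesis by simp
  qed
  show "AE s in lborel. norm (ray s * (s ^ k * exp (- c * s) * f s))
      \<le> norm (ray s * (s ^ (2 * k) * exp (- c * s)) + ray s * (exp (- c * s) * (f s)\<^sup>2))"
  proof (rule AE_I2)
    fix s :: real
    have "\<bar>s ^ k * f s\<bar> \<le> (s ^ k)\<^sup>2 + (f s)\<^sup>2"
    proof -
      have "0 \<le> (\<bar>s ^ k\<bar> - \<bar>f s\<bar>)\<^sup>2" by simp
      then have "2 * (\<bar>s ^ k\<bar> * \<bar>f s\<bar>) \<le> (s ^ k)\<^sup>2 + (f s)\<^sup>2" by (simp add: power2_diff)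
      moreover have "0 \<le> \<bar>s ^ k\<bar> * \<bar>f s\<bar>" by simp
      ultimately show ?thesis unfolding abs_mult by linarith
    qed
    then have "exp (- c * s) * \<bar>s ^ k * f s\<bar> \<le> exp (- c * s) * ((s ^ k)\<^sup>2 + (f s)\<^sup>2)"
      by (rule mult_left_mono) simp
    also have "(s ^ k)\<^sup>2 = s ^ (2 * k)" by (simp only: power_mult[symmetric] mult.commute)
    also have "exp (- c * s) * (s ^ (2 * k) + (f s)\<^sup>2) = s ^ (2 * k) * exp (- c * s) + exp (- c * s) * (f s)\<^sup>2"
      by (simp add: algebra_simps)
    finally have "\<bar>s ^ k * exp (- c * s) * f s\<bar> \<le> s ^ (2 * k) * exp (- c * s) + exp (- c * s) * (f s)\<^sup>2"
      by (simp add: abs_mult mult_ac)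
    then have "\<bar>s ^ k * exp (- c * s) * f s\<bar> \<le> \<bar>s ^ (2 * k) * exp (- c * s) + exp (- c * s) * (f s)\<^sup>2\<bar>"
      by (rule order_trans[OF _ abs_ge_self])
    then show "norm (ray s * (s ^ k * exp (- c * s) * f s))
      \<le> norm (ray s * (s ^ (2 * k) * exp (- c * s)) + ray s * (exp (- c * s) * (f s)\<^sup>2))"
      by (cases "0 \<le> s") (simp_all only: indicator_def atLeast_iff of_bool_eq if_True if_False mult_1_left mult_zero_left real_norm_def add_0_left order_refl abs_zero)
  qed
qed

section \<open>The main theorem\<close>

lemma positive_definite_diagonalize:
  fixes A :: "complex^'n^'n"
  assumes pd: "positive_definite A"
  obtains V a where "unitary_mat V" "A = V ** cdiag a ** cadj V" "\<And>i. 0 < a i"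
    "eigenvalues_mat A = range (\<lambda>i. complex_of_real (a i))"
proof -
  have "hermitian_mat A" using pd by (simp add: positive_definite_def)
  then obtain V a where V: "unitary_mat V" and A: "A = V ** cdiag a ** cadj V"
    by (rule hermitian_spectral)
  let ?D = "cdiag a"
  have AV: "A *v (V *v y) = V *v (?D *v y)" for y
    using V by (simp add: A matrix_vector_mul_assoc matrix_mul_assoc[symmetric] unitary_cancel)
  have D: "?D *v y = (\<chi> i. of_real (a i) * y $ i)" for y
    by (simp add: vec_eq_iff matrix_vector_mult_def diag_mat_def if_distrib if_distribR cong: if_cong)
  have pos: "0 < a k" for k
  proof -
    define x where "x = V *v (axis k 1 :: complex^'n)"
    have n: "norm x = 1" using V by (simp add: x_def norm_unitary_vec norm_axis_1)
    then have "x \<noteq> 0" by auto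
    then have "0 < Re (\<Sum>i\<in>UNIV. \<Sum>j\<in>UNIV. cnj (x $ i) * A $ i $ j * x $ j)"
      using pd by (simp add: positive_definite_def)
    also have "(\<Sum>i\<in>UNIV. \<Sum>j\<in>UNIV. cnj (x $ i) * A $ i $ j * x $ j) = cprod x (A *v x)"
      by (simp add: cprod_def matrix_vector_mult_def sum_distrib_left mult.assoc)
    also have "\<dots> = cprod (axis k 1) (?D *v axis k 1)"
      unfolding x_def AV using V by (simp add: cprod_mult_cadj unitary_cancel)
    also have "\<dots> = of_real (\<Sum>i\<in>UNIV. a i * (norm ((axis k 1 :: complex^'n) $ i))\<^sup>2)" by (rule cprod_diag)
    also have "(\<Sum>i\<in>UNIV. a i * (norm ((axis k 1 :: complex^'n) $ i))\<^sup>2) = (\<Sum>i\<in>UNIV. if i = k then a i else 0)"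
      by (intro sum.cong) (auto simp: axis_def)
    finally show ?thesis by simp
  qed
  have "eigenvalues_mat A = range (\<lambda>i. complex_of_real (a i))"
  proof (intro equalityI subsetI)
    fix c assume "c \<in> eigenvalues_mat A"
    then obtain v where v: "v \<noteq> 0" "A *v v = c *s v" by (auto simp: eigenvalues_mat_def)
    define y where "y = cadj V *v v"
    have vy: "v = V *v y" using V by (simp add: y_def unitary_cancel)
    then have "y \<noteq> 0" using v by auto
    have "V *v (?D *v y) = V *v (c *s y)" using v(2) unfolding vy AV by (simp add: vector_scalar_commute)
    then have "?D *v y = c *s y" using unitary_cancel(6)[OF V] by metis
    then have "of_real (a i) * y $ i = c * y $ i" for i by (simp add: D vec_eq_iff)
    moreover obtain i where "y $ i \<noteq> 0" using \<open>y \<noteq> 0\<close> by (auto simp: vec_eq_iff)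
    ultimately have "c = of_real (a i)" by (metis mult_right_cancel)
    then show "c \<in> range (\<lambda>i. complex_of_real (a i))" by blast
  next
    fix c assume "c \<in> range (\<lambda>i. complex_of_real (a i))"
    then obtain i where c: "c = of_real (a i)" by blast
    define v where "v = V *v (axis i 1 :: complex^'n)"
    have "norm v = 1" using V by (simp add: v_def norm_unitary_vec norm_axis_1)
    then have "v \<noteq> 0" by auto
    moreover have "?D *v axis i 1 = c *s axis i 1" by (auto simp: D c vec_eq_iff axis_def)
    then have "A *v v = c *s v" unfolding v_def AV by (simp add: vector_scalar_commute)
    ultimately show "c \<in> eigenvalues_mat A" by (auto simp: eigenvalues_mat_def)
  qed
  with V A pos that show ?thesis by blast
qed

section \<open>Finiteness and unitary invariance of the Gaussian measure\<close>

lemma sets_gauss_mat_measure [simp, measurable_cong]: "sets gauss_mat_measure = sets borel"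
  by (simp add: gauss_mat_measure_def)

lemma space_gauss_mat_measure [simp]: "space gauss_mat_measure = UNIV"
  by (simp add: gauss_mat_measure_def)

lemma gauss_mat_measure_eq:
  "(gauss_mat_measure :: (complex^'n^'n) measure)
    = density lborel (\<lambda>H. ennreal (exp (- (norm H)\<^sup>2) / pi ^ (CARD('n)\<^sup>2)))"
  by (simp only: gauss_mat_measure_def trace_cadj_mult Re_complex_of_real)

lemma finite_gauss_mat_measure: "finite_measure (gauss_mat_measure :: (complex^'n^'n) measure)"
proof
  have "emeasure gauss_mat_measure (UNIV :: (complex^'n^'n) set)
      = (\<integral>\<^sup>+H. ennreal (1 / pi ^ (CARD('n)\<^sup>2)) * ennreal (exp (- wnorm (\<lambda>_ _. 1) H)) \<partial>(lborel :: (complex^'n^'n) measure))"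
    unfolding gauss_mat_measure_eq
    by (subst emeasure_density) (auto intro!: nn_integral_cong simp: wnorm_def norm_mat_square simp flip: ennreal_mult)
  also have "\<dots> = ennreal (1 / pi ^ (CARD('n)\<^sup>2)) * (\<integral>\<^sup>+H. ennreal (exp (- wnorm (\<lambda>_ _. 1) H)) \<partial>(lborel :: (complex^'n^'n) measure))"
    by (rule nn_integral_cmult) measurable
  also have "(\<integral>\<^sup>+H. ennreal (exp (- wnorm (\<lambda>_ _. 1) H)) \<partial>(lborel :: (complex^'n^'n) measure)) < \<infinity>"
    using nn_integral_gaussian_moment[of "\<lambda>(_::'n) (_::'n). 1" "\<lambda>_ _. False"] by simp
  then have "ennreal (1 / pi ^ (CARD('n)\<^sup>2)) * (\<integral>\<^sup>+H. ennreal (exp (- wnorm (\<lambda>_ _. 1) H)) \<partial>(lborel :: (complex^'n^'n) measure)) < \<infinity>"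
    by (simp add: ennreal_mult_less_top)
  finally show "emeasure gauss_mat_measure (space (gauss_mat_measure :: (complex^'n^'n) measure)) \<noteq> \<infinity>"
    by simp
qed

lemma distr_gauss_mat_measure_unitary:
  fixes U :: "complex^'n^'n"
  assumes U: "unitary_mat U"
  shows "distr gauss_mat_measure gauss_mat_measure (\<lambda>H. U ** H) = gauss_mat_measure"
proof (rule measure_eqI)
  fix X assume "X \<in> sets (distr gauss_mat_measure gauss_mat_measure (\<lambda>H. U ** H))"
  then have X [measurable]: "X \<in> sets borel" by simp
  have [measurable]: "(\<lambda>H. U ** H) \<in> borel_measurable borel"
    by (rule borel_measurable_linear[OF linear_mat_mult(1)])
  let ?g = "\<lambda>H::complex^'n^'n. ennreal (exp (- (norm H)\<^sup>2) / pi ^ (CARD('n)\<^sup>2)) * indicator X H"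
  have "emeasure (distr gauss_mat_measure gauss_mat_measure (\<lambda>H. U ** H)) X
      = emeasure gauss_mat_measure ((\<lambda>H. U ** H) -` X)"
    by (subst emeasure_distr) auto
  also have "\<dots> = (\<integral>\<^sup>+H. ?g (U ** H) \<partial>lborel)"
  proof -
    have "(\<lambda>H. U ** H) -` X \<in> sets borel"
      using measurable_sets[of "\<lambda>H. U ** H" borel borel X] by simp
    then show ?thesis unfolding gauss_mat_measure_eq
      by (subst emeasure_density) (auto intro!: nn_integral_cong simp: norm_unitary_mult(1)[OF U] split: split_indicator)
  qed
  also have "\<dots> = (\<integral>\<^sup>+H. ?g H \<partial>lborel)"
    by (rule nn_integral_lborel_isometry[OF linear_mat_mult(1) norm_unitary_mult(1)[OF U]]) measurable
  also have "\<dots> = emeasure gauss_mat_measure X"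
    unfolding gauss_mat_measure_eq by (subst emeasure_density) auto
  finally show "emeasure (distr gauss_mat_measure gauss_mat_measure (\<lambda>H. U ** H)) X = emeasure gauss_mat_measure X" .
qed simp

text \<open>Since \<open>det_avg\<close> is nonnegative, \<open>rtrans\<close> is nonincreasing, and
  it tends to 0. The sign lets the nonnegative integral of the resolvent formula be read as an
  integral of a real function.\<close>

lemma rtrans_nonneg:
  fixes a :: "'n::finite \<Rightarrow> real"
  assumes a: "\<And>i. 0 < a i" and w: "0 < w" and r: "0 \<le> r"
  shows "0 \<le> rtrans a w r"
proof (rule tendsto_upperbound[OF tendsto_rtrans[where a = a, OF a w]])
  show "\<forall>\<^sub>F s in at_top. rtrans a w s \<le> rtrans a w r"
    using eventually_ge_at_top[of r]
  proof eventually_elim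
    case (elim s)
    show ?case
    proof (rule DERIV_nonpos_imp_nonincreasing[OF elim])
      fix x assume "r \<le> x" "x \<le> s"
      then have x: "0 \<le> x" using r by simp
      have "0 \<le> exp (- w * x) * (x ^ (CARD('n) - 1) / fact (CARD('n) - 1)) * det_avg a w x"
        using x nn_integral_det_gram(2)[where a = a, OF a w x] by simp
      then show "\<exists>y. (rtrans a w has_real_derivative y) (at x) \<and> y \<le> 0"
        using has_real_derivative_rtrans[where a = a and w = w, OF a x] by (metis neg_le_0_iff_le)
    qed
  qed
qed simp

text \<open>The density of the mean eigenvalue counting measure of \<open>gram a H\<close>, as the
  expectation formula will show. Integrated against f with s = a_i t, it yields the integrals on the
  right-hand side of the theorem.\<close>

definition eigen_weight :: "('n::finite \<Rightarrow> real) \<Rightarrow> real \<Rightarrow> real" where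
  "eigen_weight a s = (\<Sum>i\<in>UNIV. \<Sum>j<CARD('n). lcoeff a i j / fact j / a i * (s ^ j * exp (- (1 / a i) * s)))"

lemma eigen_weight_mult:
  "ray s * eigen_weight a s * g s = (\<Sum>i\<in>UNIV. \<Sum>j<CARD('n::finite).
     lcoeff (a :: 'n \<Rightarrow> real) i j / fact j / a i * (ray s * (s ^ j * exp (- (1 / a i) * s) * g s)))"
  by (simp add: eigen_weight_def sum_distrib_left sum_distrib_right mult_ac)

lemma has_bochner_integral_double_sum:
  fixes c :: "'i \<Rightarrow> 'j \<Rightarrow> real"
  assumes "\<And>i j. integrable M (G i j)"
  shows "has_bochner_integral M (\<lambda>x. \<Sum>i\<in>I. \<Sum>j\<in>J. c i j * G i j x) (\<Sum>i\<in>I. \<Sum>j\<in>J. c i j * (\<integral>x. G i j x \<partial>M))"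
  by (intro has_bochner_integral_sum has_bochner_integral_mult_right has_bochner_integral_integrable assms)

lemma integral_eigen_weight:
  fixes a :: "'n::finite \<Rightarrow> real"
  assumes int: "\<And>i j. integrable lborel (\<lambda>s. ray s * (s ^ j * exp (- (1 / a i) * s) * g s))"
  shows "integrable lborel (\<lambda>s. ray s * eigen_weight a s * g s)"
    and "(\<integral>s. ray s * eigen_weight a s * g s \<partial>lborel) = (\<Sum>i\<in>UNIV. \<Sum>j<CARD('n).
      lcoeff a i j / fact j / a i * (\<integral>s. ray s * (s ^ j * exp (- (1 / a i) * s) * g s) \<partial>lborel))"
proof -
  note hb = has_bochner_integral_double_sum[where I = UNIV and J = "{..<CARD('n)}" and M = lborel
      and c = "\<lambda>i j. lcoeff a i j / fact j / a i"
      and G = "\<lambda>i j s. ray s * (s ^ j * exp (- (1 / a i) * s) * g s)", OF int]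
  show "integrable lborel (\<lambda>s. ray s * eigen_weight a s * g s)"
    unfolding eigen_weight_mult using hb by (rule integrable.intros)
  show "(\<integral>s. ray s * eigen_weight a s * g s \<partial>lborel) = (\<Sum>i\<in>UNIV. \<Sum>j<CARD('n).
      lcoeff a i j / fact j / a i * (\<integral>s. ray s * (s ^ j * exp (- (1 / a i) * s) * g s) \<partial>lborel))"
    unfolding eigen_weight_mult using hb by (rule has_bochner_integral_integral_eq)
qed

text \<open>Substitute s = w a_i r in the term of index i: exp (-s / a_i) becomes exp (-w r), and 1
  / (w + s) becomes 1 / (w (1 + r a_i)), which reproduces \<open>rtrans_lagrange\<close> term by
  term.\<close>

lemma integral_eigen_weight_resolvent:
  fixes a :: "'n::finite \<Rightarrow> real"
  assumes inj: "inj a" and a: "\<And>i. 0 < a i" and w: "0 < w"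
  shows "integrable lborel (\<lambda>r. ray r * rtrans a w r)"
    and "(\<integral>s. ray s * eigen_weight a s * (1 / (w + s)) \<partial>lborel) = (\<integral>r. ray r * rtrans a w r \<partial>lborel)"
proof -
  let ?g = "\<lambda>i j s. s ^ j * exp (- (1 / a i) * s) * (1 / (w + s))"
  let ?h = "\<lambda>i j r. exp (- w * r) * (w * r * a i) ^ j / (1 + r * a i)"
  have int: "integrable lborel (\<lambda>s. ray s * ?g i j s)" for i j
  proof (rule Bochner_Integration.integrable_bound)
    show "integrable lborel (\<lambda>s. (1 / w) * (ray s * (s ^ j * exp (- (1 / a i) * s))))"
      using a[of i] by (intro integrable_mult_right integrable_power_exp_Ici) simp
    show "AE s in lborel. norm (ray s * ?g i j s) \<le> norm ((1 / w) * (ray s * (s ^ j * exp (- (1 / a i) * s))))"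
    proof (rule AE_I2)
      fix s :: real
      show "norm (ray s * ?g i j s) \<le> norm ((1 / w) * (ray s * (s ^ j * exp (- (1 / a i) * s))))"
      proof (cases "0 \<le> s")
        case True
        have "1 / (w + s) \<le> 1 / w" using True w by (intro divide_left_mono) auto
        then have "(s ^ j * exp (- (1 / a i) * s)) * (1 / (w + s)) \<le> (s ^ j * exp (- (1 / a i) * s)) * (1 / w)"
          using True by (intro mult_left_mono) auto
        then show ?thesis using True w by (simp add: mult_ac)
      qed simp
    qed
  qed measurable
  have eq: "(w * a i) * (ray r * ?g i j (w * a i * r)) = a i * (ray r * ?h i j r)" for i j r
  proof (cases "0 \<le> r")
    case True
    have "w + w * a i * r = w * (1 + r * a i)" by (simp add: algebra_simps)
    then have k: "w * (1 / (w + w * a i * r)) = 1 / (1 + r * a i)" using w by simp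
    have e: "- (1 / a i) * (w * a i * r) = - w * r" using a[of i] by simp
    have q: "w * a i * r = w * r * a i" by simp
    have "(w * a i) * ?g i j (w * a i * r)
        = a i * ((w * a i * r) ^ j * exp (- (1 / a i) * (w * a i * r)) * (w * (1 / (w + w * a i * r))))"
      by (simp only: mult_ac)
    also have "\<dots> = a i * ((w * r * a i) ^ j * exp (- w * r) * (1 / (1 + r * a i)))"
      unfolding k e unfolding q ..
    also have "\<dots> = a i * ?h i j r" by (simp only: divide_inverse mult_1_left mult_ac)
    finally show ?thesis using True by simp
  qed simp
  have wa: "0 < w * a i" for i using w a[of i] by simp
  have inth: "integrable lborel (\<lambda>r. ray r * ?h i j r)" for i j
  proof -
    have "integrable lborel (\<lambda>r. ray r * ?g i j (w * a i * r))"
      using int[of j i] by (subst (asm) integral_scale_Ici(2)[OF wa[of i]])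
    then have "integrable lborel (\<lambda>r. (1 / a i) * ((w * a i) * (ray r * ?g i j (w * a i * r))))"
      by (intro integrable_mult_right)
    then show ?thesis unfolding eq using a[of i] by (simp add: less_imp_neq[THEN not_sym])
  qed
  have I: "(\<integral>s. ray s * ?g i j s \<partial>lborel) = a i * (\<integral>r. ray r * ?h i j r \<partial>lborel)" for i j
    unfolding integral_scale_Ici(1)[OF wa[of i], of "?g i j"]
    by (simp only: integral_mult_right_zero[symmetric] eq)
  have T: "ray r * rtrans a w r = (\<Sum>i\<in>UNIV. \<Sum>j<CARD('n). lcoeff a i j / fact j * (ray r * ?h i j r))" for r
  proof (cases "0 \<le> r")
    case True
    then show ?thesis using rtrans_lagrange[where a = a and w = w, OF inj a True] by simp
  qed simp
  show "integrable lborel (\<lambda>r. ray r * rtrans a w r)"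
    unfolding T using inth by (intro Bochner_Integration.integrable_sum integrable_mult_right)
  have "(\<integral>r. ray r * rtrans a w r \<partial>lborel)
      = (\<Sum>i\<in>UNIV. \<Sum>j<CARD('n). lcoeff a i j / fact j * (\<integral>r. ray r * ?h i j r \<partial>lborel))"
    unfolding T by (rule has_bochner_integral_integral_eq[OF has_bochner_integral_double_sum[where I = UNIV
        and J = "{..<CARD('n)}" and M = lborel and c = "\<lambda>i j. lcoeff a i j / fact j"
        and G = "\<lambda>i j r. ray r * ?h i j r", OF inth]])
  also have "\<dots> = (\<Sum>i\<in>UNIV. \<Sum>j<CARD('n). lcoeff a i j / fact j / a i * (a i * (\<integral>r. ray r * ?h i j r \<partial>lborel)))"
    using a by (intro sum.cong refl) (simp add: less_imp_neq[THEN not_sym])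
  also have "\<dots> = (\<integral>s. ray s * eigen_weight a s * (1 / (w + s)) \<partial>lborel)"
    unfolding I[symmetric] by (rule integral_eigen_weight(2)[where a = a and g = "\<lambda>s. 1 / (w + s)", OF int, symmetric])
  finally show "(\<integral>s. ray s * eigen_weight a s * (1 / (w + s)) \<partial>lborel) = (\<integral>r. ray r * rtrans a w r \<partial>lborel)" ..
qed

theorem expectation_trace_mat_fun_gram:
  fixes a :: "'n::finite \<Rightarrow> real"
  assumes inj: "inj a" and a: "\<And>i. 0 < a i" and cont: "continuous_on {0..} f"
    and L2: "\<And>\<alpha>. \<alpha> > 0 \<Longrightarrow>
               (\<integral>\<^sup>+ t. ennreal (exp (- \<alpha> * t) * (f t)\<^sup>2) * indicator {0..} t \<partial>lborel) < \<infinity>"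
  shows "has_bochner_integral gauss_mat_measure (\<lambda>H. trace (mat_fun f (gram a H)))
    (of_real (\<Sum>i\<in>UNIV. \<Sum>j<CARD('n). lcoeff a i j / fact j *
      (LBINT t:{0..}. exp (- t) * (t * a i) ^ j * f (t * a i))))"
proof -
  \<comment> \<open>One family of eigenvalues serves all functions f at once, so the resolvent
    information and the target statement concern the same numbers.\<close>
  have "\<forall>H. \<exists>b::'n \<Rightarrow> real. (\<forall>i. 0 \<le> b i) \<and> (\<forall>f. trace (mat_fun f (gram a H)) = of_real (\<Sum>i\<in>UNIV. f (b i)))"
  proof
    fix H
    obtain U b where U: "unitary_mat U" "gram a H = U ** cdiag b ** cadj U" "\<And>i. 0 \<le> b i"
      by (rule gram_diagonalize[where a = a and H = H]) (use a in \<open>auto simp: less_imp_le\<close>)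
    have t: "\<forall>f. trace (mat_fun f (gram a H)) = of_real (\<Sum>i\<in>UNIV. f (b i))"
      by (rule allI) (rule trace_mat_fun[OF U(1,2)])
    have "\<forall>i. 0 \<le> b i" by (rule allI) (rule U(3))
    from conjI[OF this t] show "\<exists>b::'n \<Rightarrow> real. (\<forall>i. 0 \<le> b i) \<and> (\<forall>f. trace (mat_fun f (gram a H)) = of_real (\<Sum>i\<in>UNIV. f (b i)))"
      by (rule exI[where x = b])
  qed
  from choice[OF this] obtain \<beta> :: "complex^'n^'n \<Rightarrow> 'n \<Rightarrow> real" where
    "\<forall>H. (\<forall>i. 0 \<le> \<beta> H i) \<and> (\<forall>f. trace (mat_fun f (gram a H)) = of_real (\<Sum>i\<in>UNIV. f (\<beta> H i)))" ..
  note both = spec[OF this]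
  have \<beta>: "0 \<le> \<beta> H i" for H i using conjunct1[OF both] by (rule spec)
  have tr: "trace (mat_fun f (gram a H)) = of_real (\<Sum>i\<in>UNIV. f (\<beta> H i))" for H f
    using conjunct2[OF both] by (rule spec)
  have R: "resolvent_trace a w = (\<lambda>H. \<Sum>i\<in>UNIV. 1 / (w + \<beta> H i))" for w
    by (simp only: resolvent_trace_def[abs_def] tr Re_complex_of_real)
  interpret resolvent_determined "gauss_mat_measure :: (complex^'n^'n) measure" \<beta> "eigen_weight a"
  proof (intro resolvent_determined.intro resolvent_determined_axioms.intro finite_gauss_mat_measure)
    show "0 \<le> \<beta> H i" for H i by (rule \<beta>)
    show "integrable lborel (\<lambda>s. ray s * eigen_weight a s)"
    proof -
      have "integrable lborel (\<lambda>s. ray s * eigen_weight a s * 1)"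
      proof (rule integral_eigen_weight(1))
        fix i j
        have "0 < 1 / a i" using a[of i] by simp
        from integrable_power_exp_Ici[OF this, of j]
        show "integrable lborel (\<lambda>s. ray s * (s ^ j * exp (- (1 / a i) * s) * 1))" by simp
      qed
      then show ?thesis by simp
    qed
    fix w :: real assume w: "0 < w"
    show m: "(\<lambda>H. \<Sum>i\<in>UNIV. 1 / (w + \<beta> H i)) \<in> borel_measurable gauss_mat_measure"
      using nn_integral_resolvent_trace(1)[where a = a, OF a w] unfolding R by simp
    have "(\<integral>H. (\<Sum>i\<in>UNIV. 1 / (w + \<beta> H i)) \<partial>gauss_mat_measure)
        = enn2real (\<integral>\<^sup>+H. ennreal (\<Sum>i\<in>UNIV. 1 / (w + \<beta> H i)) \<partial>gauss_mat_measure)"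
    proof (rule integral_eq_nn_integral[OF m], rule AE_I2)
      fix H :: "complex^'n^'n"
      have "0 \<le> 1 / (w + \<beta> H i)" for i using w \<beta>[of H i] by simp
      then show "0 \<le> (\<Sum>i\<in>UNIV. 1 / (w + \<beta> H i))" by (rule sum_nonneg)
    qed
    also have "\<dots> = enn2real (\<integral>\<^sup>+r. ennreal (ray r * rtrans a w r) \<partial>lborel)"
    proof -
      have "(\<integral>\<^sup>+r. ennreal (rtrans a w r) * indicator {0..} r \<partial>lborel) = (\<integral>\<^sup>+r. ennreal (ray r * rtrans a w r) \<partial>lborel)"
        by (intro nn_integral_cong) (auto split: split_indicator)
      then show ?thesis using nn_integral_resolvent_trace(2)[where a = a, OF a w] unfolding R by simp
    qed
    also have "\<dots> = (\<integral>r. ray r * rtrans a w r \<partial>lborel)"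
    proof (rule integral_eq_nn_integral[symmetric])
      show "(\<lambda>r. ray r * rtrans a w r) \<in> borel_measurable lborel"
        using integral_eigen_weight_resolvent(1)[where a = a, OF inj a w] by (rule borel_measurable_integrable)
      show "AE r in lborel. 0 \<le> ray r * rtrans a w r"
        using rtrans_nonneg[where a = a, OF a w] by (auto intro!: AE_I2 split: split_indicator)
    qed
    also have "\<dots> = (\<integral>s. ray s * eigen_weight a s * (1 / (w + s)) \<partial>lborel)"
      by (rule integral_eigen_weight_resolvent(2)[where a = a, OF inj a w, symmetric])
    finally show "(\<integral>H. (\<Sum>i\<in>UNIV. 1 / (w + \<beta> H i)) \<partial>gauss_mat_measure)
      = (\<integral>s. ray s * eigen_weight a s * (1 / (w + s)) \<partial>lborel)" .
  qed
  \<comment> \<open>Term i of the density decays at rate 1 / a i, so the growth condition is used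
    with this value of \<alpha>.\<close>
  have int: "integrable lborel (\<lambda>s. ray s * (s ^ j * exp (- (1 / a i) * s) * f s))" for i j
    using a[of i] by (intro integrable_power_exp_mult_Ici cont L2) auto
  have I: "(\<integral>s. ray s * (s ^ j * exp (- (1 / a i) * s) * f s) \<partial>lborel)
      = a i * (LBINT t:{0..}. exp (- t) * (t * a i) ^ j * f (t * a i))" for i j
  proof -
    have e: "- (1 / a i) * (a i * t) = - t" for t using a[of i] by simp
    have c: "a i * t = t * a i" for t by (rule mult.commute)
    have p: "x * (p * q * r) = x *\<^sub>R (q * p * r)" for x p q r :: real by simp
    show ?thesis
      unfolding integral_scale_Ici(1)[OF a[of i], of "\<lambda>s. s ^ j * exp (- (1 / a i) * s) * f s"]
        set_lebesgue_integral_def e unfolding c p ..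
  qed
  note det = resolvent_determines[OF cont integral_eigen_weight(1)[where a = a and g = f, OF int]]
  have "(\<integral>s. ray s * eigen_weight a s * f s \<partial>lborel)
      = (\<Sum>i\<in>UNIV. \<Sum>j<CARD('n). lcoeff a i j / fact j * (LBINT t:{0..}. exp (- t) * (t * a i) ^ j * f (t * a i)))"
    unfolding integral_eigen_weight(2)[where a = a and g = f, OF int] I
  proof (intro sum.cong refl)
    fix i j
    have "c / a i * (a i * x) = c * x" for c x :: real using a[of i] by simp
    then show "lcoeff a i j / fact j / a i * (a i * (LBINT t:{0..}. exp (- t) * (t * a i) ^ j * f (t * a i)))
      = lcoeff a i j / fact j * (LBINT t:{0..}. exp (- t) * (t * a i) ^ j * f (t * a i))" .
  qed
  with det have "has_bochner_integral gauss_mat_measure (\<lambda>H. \<Sum>i\<in>UNIV. f (\<beta> H i))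
      (\<Sum>i\<in>UNIV. \<Sum>j<CARD('n). lcoeff a i j / fact j * (LBINT t:{0..}. exp (- t) * (t * a i) ^ j * f (t * a i)))"
    by (simp only: has_bochner_integral_iff simp_thms)
  then show ?thesis unfolding tr by (rule has_bochner_integral_of_real)
qed

theorem theorem2:
  fixes A :: "complex^'n^'n" and d :: "nat \<Rightarrow> real" and f :: "real \<Rightarrow> real"
  defines "n \<equiv> CARD('n)"
  assumes pd: "positive_definite A"
    and eig: "eigenvalues_mat A = (\<lambda>i. complex_of_real (d i)) ` {..<n}"
    and dist: "inj_on d {..<n}"
    and cont: "continuous_on {0..} f"
    and L2: "\<And>\<alpha>. \<alpha> > 0 \<Longrightarrow>
               (\<integral>\<^sup>+ t. ennreal (exp (- \<alpha> * t) * (f t)\<^sup>2) * indicator {0..} t \<partial>lborel) < \<infinity>"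
  shows "integrable gauss_mat_measure (\<lambda>H. trace (mat_fun f (cadj H ** A ** H))) \<and>
         (\<integral>H. trace (mat_fun f (cadj H ** A ** H)) \<partial>gauss_mat_measure)
           = complex_of_real ((1 / det_nat n (vandermonde n d)) *
                 (\<Sum>k<n. det_nat n (T_mat n f d k)))"
proof -
  obtain V a where V: "unitary_mat V" and A: "A = V ** cdiag a ** cadj V"
    and a: "\<And>i. 0 < a i" and eig': "eigenvalues_mat A = range (\<lambda>i. complex_of_real (a i))"
    by (rule positive_definite_diagonalize[OF pd]) blast
  have ran: "range a = d ` {..<n}"
  proof -
    have "complex_of_real ` range a = complex_of_real ` d ` {..<n}"
      using eig eig' by (simp add: image_image)
    then show ?thesis by (simp add: inj_image_eq_iff inj_of_real)
  qed
  \<comment> \<open>The spectrum is given as a set; having n elements, it forces the n diagonal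
    entries to be distinct.\<close>
  have "card (range a) = CARD('n)" unfolding ran n_def using dist by (simp add: card_image n_def)
  then have inj: "inj a" by (simp add: eq_card_imp_inj_on)
  \<comment> \<open>The position in the list \<open>d\<close> of the eigenvalue attached to a matrix
    index.\<close>
  define \<sigma> where "\<sigma> i = the_inv_into {..<n} d (a i)" for i
  have "bij_betw d {..<n} (range a)" using dist ran by (simp add: bij_betw_def)
  then have "bij_betw (the_inv_into {..<n} d) (range a) {..<n}" by (rule bij_betw_the_inv_into)
  moreover have "bij_betw a UNIV (range a)" using inj by (rule inj_on_imp_bij_betw)
  ultimately have \<sigma>: "bij_betw \<sigma> UNIV {..<n}"
    using bij_betw_trans[of a UNIV "range a" "the_inv_into {..<n} d" "{..<n}"] by (simp add: \<sigma>_def[abs_def] o_def)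
  have d\<sigma>: "d (\<sigma> i) = a i" for i
    unfolding \<sigma>_def by (rule f_the_inv_into_f[OF dist]) (use ran in auto)
  have nz: "a i \<noteq> 0" for i using a[of i] by simp
  let ?F = "\<lambda>H. trace (mat_fun f (gram a H))"
  \<comment> \<open>The eigenvector matrix of \<open>A\<close> is absorbed into \<open>H\<close>,
    whose law is invariant under left multiplication by a unitary.\<close>
  let ?T = "\<lambda>H. cadj V ** H"
  have F: "trace (mat_fun f (cadj H ** A ** H)) = ?F (?T H)" for H
    by (simp add: gram_def A cadj_mul matrix_mul_assoc)
  have hb: "has_bochner_integral gauss_mat_measure ?F
      (of_real ((1 / det_nat n (vandermonde n d)) * (\<Sum>k<n. det_nat n (T_mat n f d k))))"
    using expectation_trace_mat_fun_gram[where a = a and f = f, OF inj a cont L2]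
    unfolding sum_det_T_mat[where a = a and \<sigma> = \<sigma> and d = d and n = n, OF inj nz \<sigma> n_def[THEN meta_eq_to_obj_eq] d\<sigma>]
    by (simp add: n_def)
  have T: "?T \<in> gauss_mat_measure \<rightarrow>\<^sub>M gauss_mat_measure"
    using borel_measurable_linear[OF linear_mat_mult(1)] by (simp add: measurable_cong_sets[OF sets_gauss_mat_measure sets_gauss_mat_measure])
  note di = distr_gauss_mat_measure_unitary[OF unitary_mat_cadj[OF V]]
  have m: "?F \<in> borel_measurable gauss_mat_measure"
    using hb unfolding has_bochner_integral_iff by (blast intro: borel_measurable_integrable)
  have "integrable gauss_mat_measure (\<lambda>H. ?F (?T H)) \<longleftrightarrow> integrable gauss_mat_measure ?F"
    using integrable_distr_eq[OF T m] unfolding di by simp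
  moreover have "(\<integral>H. ?F (?T H) \<partial>gauss_mat_measure) = (\<integral>H. ?F H \<partial>gauss_mat_measure)"
    using integral_distr[OF T m] unfolding di by simp
  ultimately show ?thesis using hb unfolding F by (simp add: has_bochner_integral_iff)
qed

end
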